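(* Let $Y=\mathrm{TV}(\Sigma)$ be a smooth, complete toric surface and let $R\in M$ be primitive. For $2\le i\le m$ with $\langle\nu(\rho_i),R\rangle=1$, let $\pi(i)$ be the one-parameter deformation of $Y$ associated to $\lambda_0=0$ and the tuple $a$ with $a_j=1$ for $j<i$ and $a_j=-1$ for $j\ge i$ ($0\le j\le m+1$). Then the deformations $$\{\pi(i)\ :\ 2\le i\le m,\ \langle\nu(\rho_i),R\rangle=1\}$$ form a basis of $T_Y^1(-R)$, that is, their images under the Kodaira-Spencer map form a basis of $T_Y^1(-R)$.
   Context: Everything is over $\mathbb{C}$. $T_Y^1=H^1(Y,\mathcal{T}_Y)$ is the space of infinitesimal deformations of $Y$, where $\mathcal{T}_Y$ is the tangent sheaf; it is $M$-graded, with $\chi^u$ times a torus-invariant vector field having degree $u$, and $T_Y^1(u)$ is the component of degree $u$. Fan and slice. $N$ is a rank $2$ lattice with dual $M$, and $\Sigma$ is a complete smooth fan on $N_\mathbb{Q}$ with rays $\rho_1,\dots,\rho_l$ numbered counterclockwise, indices modulo $l$ ($\rho_0=\rho_l$, $\rho_{l+1}=\rho_1$); $\nu(\rho_i)$ is the minimal lattice generator of $\rho_i$. Choose a basis of $N$ such that $R=[0,1]$ in the dual basis of $M$; write $x=\chi^{[1,0]}$, $y=\chi^{[0,1]}$, so $\chi^{[r,s]}=x^ry^s$. Let $\Xi_0=\Sigma\cap\{v\in N_\mathbb{Q}:\langle v,R\rangle=1\}$, regarded as a polyhedral subdivision of $\mathbb{Q}$ by taking $(0,1)$ as origin (the point $(p,1)$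 corresponds to $p\in\mathbb{Q}$; lattice points are the integers). Its segments are $\Delta_0^0,\dots,\Delta_0^{m+1}$, ordered with $\Delta_0^i\ge\Delta_0^{i+1}$ (from right to left), so $\Delta_0^0$ and $\Delta_0^{m+1}$ are half-lines and the others are bounded. The rays are numbered so that $\rho_1$ passes through $\Delta_0^0\cap\Delta_0^1$; hence $\rho_i$ passes through $\Delta_0^{i-1}\cap\Delta_0^i$ for $1\le i\le m+1$. Data defining a deformation. Let $\lambda_0$ be an integer and let $a=(a_0,\dots,a_{m+1})\in\{-1,1\}^{m+2}$ be an admissible tuple, meaning that $\Delta_0^i\cap\Delta_0^{i+1}$ is a lattice point for every $0\le i\le m$ with $a_i\ne a_{i+1}$. The integers $\lambda_1,\dots,\lambda_{m+1}$ are determined by $\lambda_{i+1}=\lambda_i$ if $a_{i+1}=a_i$, and $\lambda_i+\lambda_{i+1}=\Delta_0^i\cap\Delta_0^{i+1}$ if $a_{i+1}\neq a_i$. For $m+1<i<l$ put $a_i=1$, $\lambda_i=0$. The family. Let $\sigma_i\in\Sigma$ be the cone spanned by $\rho_i,\rho_{i+1}$. Let $w_i^1=[r_i^1,s_i^1]$, $w_i^2=[r_i^2,s_i^2]$ be the positively oriented minimal lattice generators of $\sigma_i^\vee$ (so $w_i^1$ vanishes on $\rho_{i+1}$, $w_i^2$ vanishes on $\rho_i$, and $w_i^1=-w_{i+1}^2$). Then $\mathrm{TV}(\sigma_i)=\operatorname{Spec}A_i$ with $A_i=\mathbb{C}[\sigma_i^\vee\cap M]=\mathbb{C}[Z_{i,1},Z_{i,2}]$,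 $Z_{i,j}=x^{r_i^j}y^{s_i^j}$. For $0\le i\le l-1$ and $j\in\{1,2\}$ define, in $\mathbb{C}(x,y,t)$, $$\widetilde Z_{i,j}=\begin{cases}x^{r_i^j}y^{s_i^j+\lambda_ir_i^j}(y-t)^{-\lambda_ir_i^j}&\text{if }a_i=1,\\ x^{r_i^j}y^{-\lambda_ir_i^j}(y-t)^{s_i^j+\lambda_ir_i^j}&\text{if }a_i=-1,\end{cases}$$ and let $\widetilde A_i=\mathbb{C}[t,\widetilde Z_{i,1},\widetilde Z_{i,2}]$ for $0\le i\le m+1$, and $\widetilde A_i=\mathbb{C}[t,\widetilde Z_{i,1},\widetilde Z_{i,2},y(y-t)^{-1}]$ for $m+1<i\le l-1$. The scheme $X$ is obtained by identifying, for all $0\le i,j<l$, $\operatorname{Spec}\widetilde A_i$ with $\operatorname{Spec}\widetilde A_j$ along all open subsets $\operatorname{Spec}B$, where $B\subset\mathbb{C}(x,y,t)$ is a localization of both $\widetilde A_i$ and $\widetilde A_j$; the deformation associated to $\lambda_0$ and $a$ is the map $\pi:X\to\mathbb{A}^1=\operatorname{Spec}\mathbb{C}[t]$ glued from the maps given by $\mathbb{C}[t]\subset\widetilde A_i$. It is a one-parameter deformation of $Y$ (a flat family with $\pi^{-1}(0)=Y$). Kodaira-Spencer map. The Kodaira-Spencer class of $\pi$ is computed over $\operatorname{Spec}\mathbb{C}[t]/t^2$: given trivializations $\theta_i^\#:\widetilde A_i\otimes\mathbb{C}[t]/t^2\to A_i\otimes\mathbb{C}[t]/t^2$ over $\mathbb{C}[t]/t^2$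 that are the identity modulo $t$, it is the class in $H^1(Y,\mathcal{T}_Y)$ of the Čech cocycle $(d_{i,j})$, with respect to the covering $\{\mathrm{TV}(\sigma_i)\}_i$, defined on overlaps by $\theta_j^\#(\theta_i^\#)^{-1}=\mathrm{id}+t\cdot d_{i,j}$. *)

theory Defs
  imports
    "HOL-Computational_Algebra.Fraction_Field"
    "HOL-Computational_Algebra.Polynomial"
    "Jordan_Normal_Form.VS_Connect"
begin

section \<open>Lattices, cones and fans in the plane\<close>

text \<open>
  A basis identifies the rank 2 lattice \<open>N\<close> and its dual \<open>M\<close> with \<open>\<int>\<^sup>2\<close>, the pairing being the
  standard one; cones live in \<open>N \<otimes> \<rat> = \<rat>\<^sup>2\<close>.
\<close>

type_synonym lattice = "int \<times> int"
type_synonym cone = "(rat \<times> rat) set"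

definition pairing :: "lattice \<Rightarrow> lattice \<Rightarrow> int" where
  "pairing v u = fst v * fst u + snd v * snd u"

definition pairing_rat :: "rat \<times> rat \<Rightarrow> lattice \<Rightarrow> rat" where
  "pairing_rat v u = fst v * of_int (fst u) + snd v * of_int (snd u)"

definition det2 :: "lattice \<Rightarrow> lattice \<Rightarrow> int" where
  "det2 u v = fst u * snd v - snd u * fst v"

definition primitive :: "lattice \<Rightarrow> bool" where
  "primitive u \<longleftrightarrow> coprime (fst u) (snd u)"

definition cone_of :: "lattice set \<Rightarrow> cone" where
  "cone_of G = {(\<Sum>v\<in>G. c v * of_int (fst v), \<Sum>v\<in>G. c v * of_int (snd v)) | c. \<forall>v\<in>G. c v \<ge> 0}"

definition dual_lattice_points :: "cone \<Rightarrow> lattice set" where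
  "dual_lattice_points \<tau> = {u. \<forall>v\<in>\<tau>. pairing_rat v u \<ge> 0}"

definition rational_polyhedral_cone :: "cone \<Rightarrow> bool" where
  "rational_polyhedral_cone \<tau> \<longleftrightarrow> (\<exists>G. finite G \<and> \<tau> = cone_of G)"

definition strongly_convex :: "cone \<Rightarrow> bool" where
  "strongly_convex \<tau> \<longleftrightarrow> (\<forall>p q. (p, q) \<in> \<tau> \<and> (- p, - q) \<in> \<tau> \<longrightarrow> p = 0 \<and> q = 0)"

definition face_of_cone :: "cone \<Rightarrow> cone \<Rightarrow> bool" where
  "face_of_cone \<phi> \<tau> \<longleftrightarrow> (\<exists>u\<in>dual_lattice_points \<tau>. \<phi> = {v\<in>\<tau>. pairing_rat v u = 0})"

definition is_fan :: "cone set \<Rightarrow> bool" where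
  "is_fan F \<longleftrightarrow> finite F \<and> F \<noteq> {} \<and>
     (\<forall>\<tau>\<in>F. rational_polyhedral_cone \<tau> \<and> strongly_convex \<tau>) \<and>
     (\<forall>\<tau>\<in>F. \<forall>\<phi>. face_of_cone \<phi> \<tau> \<longrightarrow> \<phi> \<in> F) \<and>
     (\<forall>\<tau>\<in>F. \<forall>\<tau>'\<in>F. face_of_cone (\<tau> \<inter> \<tau>') \<tau> \<and> face_of_cone (\<tau> \<inter> \<tau>') \<tau>')"

definition complete_fan :: "cone set \<Rightarrow> bool" where
  "complete_fan F \<longleftrightarrow> \<Union>F = UNIV"

definition smooth_fan :: "cone set \<Rightarrow> bool" where
  "smooth_fan F \<longleftrightarrow>
     (\<forall>\<tau>\<in>F. \<exists>b b' G. \<bar>det2 b b'\<bar> = 1 \<and> G \<subseteq> {b, b'} \<and> \<tau> = cone_of G)"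

definition is_ray :: "cone \<Rightarrow> bool" where
  "is_ray \<rho> \<longleftrightarrow> (\<exists>v. v \<noteq> (0, 0) \<and> \<rho> = cone_of {v})"

text \<open>
  The rays are \<open>\<rho>\<^sub>i = cone_of {\<nu> i}\<close> for \<open>1 \<le> i \<le> l\<close>, with \<open>\<rho>\<^sub>0 = \<rho>\<^sub>l\<close>. Numbering them
  counterclockwise means that \<open>\<rho>\<^sub>i\<close> and \<open>\<rho>\<^sub>i\<^sub>+\<^sub>1\<close> bound a cone of the fan, \<open>\<rho>\<^sub>i\<^sub>+\<^sub>1\<close> being the one
  that follows \<open>\<rho>\<^sub>i\<close> in the positive sense.
\<close>

definition max_cone :: "(nat \<Rightarrow> lattice) \<Rightarrow> nat \<Rightarrow> cone" where
  "max_cone \<nu> i = cone_of {\<nu> i, \<nu> (Suc i)}"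

definition ray_numbering :: "cone set \<Rightarrow> (nat \<Rightarrow> lattice) \<Rightarrow> nat \<Rightarrow> bool" where
  "ray_numbering F \<nu> l \<longleftrightarrow>
     bij_betw (\<lambda>i. cone_of {\<nu> i}) {1..l} {\<rho>\<in>F. is_ray \<rho>} \<and>
     (\<forall>i\<le>l. primitive (\<nu> i)) \<and> \<nu> 0 = \<nu> l \<and>
     (\<forall>i<l. max_cone \<nu> i \<in> F \<and> det2 (\<nu> i) (\<nu> (Suc i)) > 0)"


section \<open>The slice\<close>

text \<open>
  \<open>(S, R)\<close> is the basis of \<open>M\<close> dual to the chosen basis of \<open>N\<close>, so that \<open>[r, s]\<close> stands for
  \<open>r S + s R\<close>; in particular \<open>R = [0, 1]\<close>, and \<open>v \<in> N\<close> has coordinates \<open>(\<langle>v, S\<rangle>, \<langle>v, R\<rangle>)\<close>. All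
  definitions below suppose \<open>det2 S R = 1\<close>; \<open>coord_r\<close> and \<open>coord_s\<close> are Cramer's rule.
\<close>

definition coord_r :: "lattice \<Rightarrow> lattice \<Rightarrow> lattice \<Rightarrow> int" where
  "coord_r S R w = det2 w R"

definition coord_s :: "lattice \<Rightarrow> lattice \<Rightarrow> lattice \<Rightarrow> int" where
  "coord_s S R w = det2 S w"

definition slice :: "lattice \<Rightarrow> lattice \<Rightarrow> cone \<Rightarrow> rat set" where
  "slice S R \<tau> = {pairing_rat v S | v. v \<in> \<tau> \<and> pairing_rat v R = 1}"

definition seg :: "lattice \<Rightarrow> lattice \<Rightarrow> (nat \<Rightarrow> lattice) \<Rightarrow> nat \<Rightarrow> rat set" where
  "seg S R \<nu> i = slice S R (max_cone \<nu> i)"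

text \<open>
  The one-dimensional polyhedra of the subdivision (those with infinitely many points) are
  \<open>\<Delta>\<^sup>0, \<dots>, \<Delta>\<^sup>m\<^sup>+\<^sup>1\<close>, from right to left, and \<open>\<Delta>\<^sup>i\<close> is the slice of \<open>\<sigma>\<^sub>i\<close>; this says that \<open>\<rho>\<^sub>i\<close>
  passes through \<open>\<Delta>\<^sup>i\<^sup>-\<^sup>1 \<inter> \<Delta>\<^sup>i\<close>.
\<close>

definition slice_numbering ::
    "cone set \<Rightarrow> (nat \<Rightarrow> lattice) \<Rightarrow> nat \<Rightarrow> nat \<Rightarrow> lattice \<Rightarrow> lattice \<Rightarrow> bool" where
  "slice_numbering F \<nu> l m S R \<longleftrightarrow> m + 1 < l \<and>
     bij_betw (seg S R \<nu>) {0..m+1} {P \<in> slice S R ` F. infinite P} \<and>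
     (\<forall>i\<le>m. \<forall>p\<in>seg S R \<nu> i. \<forall>q\<in>seg S R \<nu> (Suc i). p \<ge> q)"


section \<open>The function field of the toric surface and its affine charts\<close>

text \<open>\<open>K0 = \<complex>(X\<^sub>1, X\<^sub>2)\<close>, the first variable being the inner one.\<close>

type_synonym K0 = "complex poly poly fract"

definition const0 :: "complex \<Rightarrow> K0" where
  "const0 c = Fract [:[:c:]:] 1"

definition chi :: "lattice \<Rightarrow> K0" where
  "chi u = Fract [:[:0, 1:]:] 1 powi fst u * Fract [:0, 1:] 1 powi snd u"

text \<open>\<open>\<complex>[\<tau>\<^sup>\<or> \<inter> M]\<close>, the coordinate ring of the affine toric variety of \<open>\<tau>\<close>.\<close>

definition coord_ring :: "cone \<Rightarrow> K0 set" where
  "coord_ring \<tau> =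
     {\<Sum>u\<in>U. const0 (c u) * chi u | U c. finite U \<and> U \<subseteq> dual_lattice_points \<tau>}"


section \<open>The tangent sheaf and its first cohomology\<close>

definition is_derivation :: "(K0 \<Rightarrow> K0) \<Rightarrow> bool" where
  "is_derivation D \<longleftrightarrow> (\<forall>f g. D (f + g) = D f + D g) \<and>
     (\<forall>f g. D (f * g) = f * D g + g * D f) \<and> (\<forall>c. D (const0 c) = 0)"

text \<open>
  Sections of the tangent sheaf over the affine open set of \<open>\<tau>\<close> are the \<open>\<complex>\<close>-derivations of
  \<open>coord_ring \<tau>\<close>. Each of them extends uniquely to the function field, and it is represented by
  this extension; restriction to a smaller open set thus becomes the identity.
\<close>

definition vector_fields :: "cone \<Rightarrow> (K0 \<Rightarrow> K0) set" where
  "vector_fields \<tau> = {D. is_derivation D \<and> D ` coord_ring \<tau> \<subseteq> coord_ring \<tau>}"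

definition torus_invariant :: "(K0 \<Rightarrow> K0) \<Rightarrow> bool" where
  "torus_invariant D \<longleftrightarrow> is_derivation D \<and> (\<forall>v. \<exists>c. D (chi v) = const0 c * chi v)"

definition homogeneous :: "lattice \<Rightarrow> (K0 \<Rightarrow> K0) \<Rightarrow> bool" where
  "homogeneous u D \<longleftrightarrow> (\<exists>E. torus_invariant E \<and> D = (\<lambda>f. chi u * E f))"

text \<open>
  \<open>H\<^sup>1(Y, T\<^sub>Y)\<close> is the Cech cohomology of the covering of \<open>Y\<close> by the affine open sets belonging to
  \<open>\<sigma> 0, \<dots>, \<sigma> (l - 1)\<close>; these sets and their intersections (belonging to intersections of cones)
  are affine. Cochains are functions on all indices and vanish if an index is not below \<open>l\<close>.
\<close>

type_synonym cochain = "nat \<Rightarrow> nat \<Rightarrow> K0 \<Rightarrow> K0"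

definition cocycles :: "nat \<Rightarrow> (nat \<Rightarrow> cone) \<Rightarrow> cochain set" where
  "cocycles l \<sigma> = {d.
     (\<forall>i<l. \<forall>j<l. d i j \<in> vector_fields (\<sigma> i \<inter> \<sigma> j)) \<and>
     (\<forall>i j. \<not> (i < l \<and> j < l) \<longrightarrow> d i j = (\<lambda>f. 0)) \<and>
     (\<forall>i<l. \<forall>j<l. \<forall>k<l. \<forall>f. d i j f + d j k f = d i k f)}"

definition coboundaries :: "nat \<Rightarrow> (nat \<Rightarrow> cone) \<Rightarrow> cochain set" where
  "coboundaries l \<sigma> = {\<lambda>i j f. if i < l \<and> j < l then D j f - D i f else 0 | D.
     \<forall>i<l. D i \<in> vector_fields (\<sigma> i)}"

definition cohomology_class :: "nat \<Rightarrow> (nat \<Rightarrow> cone) \<Rightarrow> cochain \<Rightarrow> cochain set" where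
  "cohomology_class l \<sigma> d = {\<lambda>i j f. d i j f + b i j f | b. b \<in> coboundaries l \<sigma>}"

text \<open>The fields \<open>mult\<close> and \<open>one\<close> of the record play no role for a vector space.\<close>

definition T1 :: "nat \<Rightarrow> (nat \<Rightarrow> cone) \<Rightarrow> (complex, cochain set) module" where
  "T1 l \<sigma> =
    \<lparr> carrier = cohomology_class l \<sigma> ` cocycles l \<sigma>,
      monoid.mult = undefined,
      one = undefined,
      zero = coboundaries l \<sigma>,
      add = (\<lambda>C C'. {\<lambda>i j f. d i j f + d' i j f | d d'. d \<in> C \<and> d' \<in> C'}),
      module.smult = (\<lambda>c C. {\<lambda>i j f. const0 c * d i j f + b i j f | d b.
                        d \<in> C \<and> b \<in> coboundaries l \<sigma>}) \<rparr>"

definition T1_degree :: "nat \<Rightarrow> (nat \<Rightarrow> cone) \<Rightarrow> lattice \<Rightarrow> (complex, cochain set) module" where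
  "T1_degree l \<sigma> u = (T1 l \<sigma>)
    \<lparr> carrier := {cohomology_class l \<sigma> d | d.
        d \<in> cocycles l \<sigma> \<and> (\<forall>i<l. \<forall>j<l. homogeneous u (d i j))} \<rparr>"


section \<open>The one-parameter deformations\<close>

text \<open>\<open>K = \<complex>(X\<^sub>1, X\<^sub>2)(t)\<close>.\<close>

type_synonym K = "K0 poly fract"

definition incl :: "K0 \<Rightarrow> K" where
  "incl f = Fract [:f:] 1"

definition tvar :: K where
  "tvar = Fract [:0, 1:] 1"

inductive_set adjoin :: "K set \<Rightarrow> K set" for G where
  const: "incl (const0 c) \<in> adjoin G"
| gen: "g \<in> G \<Longrightarrow> g \<in> adjoin G"
| add: "f \<in> adjoin G \<Longrightarrow> g \<in> adjoin G \<Longrightarrow> f + g \<in> adjoin G"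
| mult: "f \<in> adjoin G \<Longrightarrow> g \<in> adjoin G \<Longrightarrow> f * g \<in> adjoin G"

text \<open>Rotating \<open>\<nu> (i + 1)\<close> and \<open>\<nu> i\<close> by a right angle gives the generators of the dual cone.\<close>

definition w1 :: "(nat \<Rightarrow> lattice) \<Rightarrow> nat \<Rightarrow> lattice" where
  "w1 \<nu> i = (snd (\<nu> (Suc i)), - fst (\<nu> (Suc i)))"

definition w2 :: "(nat \<Rightarrow> lattice) \<Rightarrow> nat \<Rightarrow> lattice" where
  "w2 \<nu> i = (- snd (\<nu> i), fst (\<nu> i))"

definition admissible ::
    "(nat \<Rightarrow> lattice) \<Rightarrow> nat \<Rightarrow> lattice \<Rightarrow> lattice \<Rightarrow> (nat \<Rightarrow> int) \<Rightarrow> bool" where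
  "admissible \<nu> m S R a \<longleftrightarrow> (\<forall>i\<le>m+1. a i \<in> {-1, 1}) \<and>
     (\<forall>i\<le>m. a i \<noteq> a (Suc i) \<longrightarrow>
        (\<exists>k::int. seg S R \<nu> i \<inter> seg S R \<nu> (Suc i) = {of_int k}))"

definition tuple_ext :: "nat \<Rightarrow> (nat \<Rightarrow> int) \<Rightarrow> nat \<Rightarrow> int" where
  "tuple_ext m a i = (if i \<le> m + 1 then a i else 1)"

fun shift :: "(nat \<Rightarrow> lattice) \<Rightarrow> nat \<Rightarrow> lattice \<Rightarrow> lattice \<Rightarrow> int \<Rightarrow> (nat \<Rightarrow> int) \<Rightarrow> nat \<Rightarrow> int" where
  "shift \<nu> m S R lam0 a 0 = lam0"
| "shift \<nu> m S R lam0 a (Suc i) =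
     (if m + 1 < Suc i then 0
      else if a (Suc i) = a i then shift \<nu> m S R lam0 a i
      else (THE k::int. seg S R \<nu> i \<inter> seg S R \<nu> (Suc i) = {of_int k}) - shift \<nu> m S R lam0 a i)"

definition Z_tilde :: "lattice \<Rightarrow> lattice \<Rightarrow> int \<Rightarrow> int \<Rightarrow> lattice \<Rightarrow> K" where
  "Z_tilde S R ai lam w =
     (let x = incl (chi S); y = incl (chi R); r = coord_r S R w; s = coord_s S R w in
      if ai = 1 then x powi r * y powi (s + lam * r) * (y - tvar) powi (- lam * r)
      else x powi r * y powi (- lam * r) * (y - tvar) powi (s + lam * r))"

text \<open>
  The deformation is represented by its gluing data, the coordinate rings of the affine charts as
  subrings of \<open>K\<close>. Two charts are glued along the spectra of all their common localizations.
\<close>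

definition deformation ::
    "(nat \<Rightarrow> lattice) \<Rightarrow> nat \<Rightarrow> lattice \<Rightarrow> lattice \<Rightarrow> int \<Rightarrow> (nat \<Rightarrow> int) \<Rightarrow> nat \<Rightarrow> K set" where
  "deformation \<nu> m S R lam0 a i =
     (let ai = tuple_ext m a i; lam = shift \<nu> m S R lam0 a i;
          Z1 = Z_tilde S R ai lam (w1 \<nu> i); Z2 = Z_tilde S R ai lam (w2 \<nu> i);
          y = incl (chi R) in
      if i \<le> m + 1 then adjoin {tvar, Z1, Z2}
      else adjoin {tvar, Z1, Z2, y / (y - tvar)})"

text \<open>A localization with open spectrum is the localization at a single element.\<close>

definition is_localization :: "K set \<Rightarrow> K set \<Rightarrow> bool" where
  "is_localization B A \<longleftrightarrow> (\<exists>h\<in>A. h \<noteq> 0 \<and> B = {f / h ^ n | f n. f \<in> A})"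


section \<open>The Kodaira-Spencer class\<close>

text \<open>\<open>Dual a b\<close> is \<open>a + b t\<close> in \<open>K0[t]/t\<^sup>2\<close>.\<close>

datatype 'a dual_number = Dual (dual_fst: 'a) (dual_snd: 'a)

instantiation dual_number :: (comm_ring_1) comm_ring_1
begin

definition "0 = Dual 0 0"
definition "1 = Dual 1 0"
definition "z + w = Dual (dual_fst z + dual_fst w) (dual_snd z + dual_snd w)"
definition "z - w = Dual (dual_fst z - dual_fst w) (dual_snd z - dual_snd w)"
definition "- z = Dual (- dual_fst z) (- dual_snd z)"
definition "z * w = Dual (dual_fst z * dual_fst w)
                         (dual_fst z * dual_snd w + dual_snd z * dual_fst w)"

instance
  by standard
    (auto simp: zero_dual_number_def one_dual_number_def plus_dual_number_def
      minus_dual_number_def uminus_dual_number_def times_dual_number_def algebra_simps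
      intro: dual_number.expand)

end

definition value_at_0 :: "K \<Rightarrow> K0 \<Rightarrow> bool" where
  "value_at_0 f g \<longleftrightarrow> (\<exists>p q. poly q 0 \<noteq> 0 \<and> f = Fract p q \<and> g = poly p 0 / poly q 0)"

text \<open>
  An isomorphism \<open>B \<otimes> \<complex>[t]/t\<^sup>2 \<rightarrow> A \<otimes> \<complex>[t]/t\<^sup>2\<close> over \<open>\<complex>[t]/t\<^sup>2\<close> which is the identity modulo \<open>t\<close>,
  given as a surjection from \<open>B\<close> with kernel \<open>t\<^sup>2 B\<close>. The special fibre of \<open>Spec B\<close> is identified
  with \<open>Spec A\<close> by putting \<open>t = 0\<close>.
\<close>

definition trivialization :: "K set \<Rightarrow> K0 set \<Rightarrow> (K \<Rightarrow> K0 dual_number) \<Rightarrow> bool" where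
  "trivialization B A \<theta> \<longleftrightarrow>
     (\<forall>f\<in>B. \<forall>g\<in>B. \<theta> (f + g) = \<theta> f + \<theta> g \<and> \<theta> (f * g) = \<theta> f * \<theta> g) \<and>
     (\<forall>c. \<theta> (incl (const0 c)) = Dual (const0 c) 0) \<and> \<theta> tvar = Dual 0 1 \<and>
     \<theta> ` B = {Dual a b | a b. a \<in> A \<and> b \<in> A} \<and>
     {f\<in>B. \<theta> f = 0} = {tvar ^ 2 * f | f. f \<in> B} \<and>
     (\<forall>f\<in>B. value_at_0 f (dual_fst (\<theta> f)))"

definition id_plus_t :: "(K0 \<Rightarrow> K0) \<Rightarrow> K0 dual_number \<Rightarrow> K0 dual_number" where
  "id_plus_t d z = Dual (dual_fst z) (dual_snd z + d (dual_fst z))"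

text \<open>
  \<open>d\<close> is the Cech cocycle of the deformation with charts \<open>At i\<close> with respect to trivializations
  \<open>\<theta> i\<close>. The overlap of two charts is \<open>Spec B\<close> for a common localization \<open>B\<close> whose special fibre is
  the intersection of the two charts of \<open>Y\<close>; other choices of \<open>B\<close> agree modulo \<open>t\<^sup>2\<close>.
\<close>

definition KS_cocycle ::
    "nat \<Rightarrow> (nat \<Rightarrow> cone) \<Rightarrow> (nat \<Rightarrow> K set) \<Rightarrow> (nat \<Rightarrow> K \<Rightarrow> K0 dual_number) \<Rightarrow> cochain \<Rightarrow> bool" where
  "KS_cocycle l \<sigma> At \<theta> d \<longleftrightarrow>
     (\<forall>i<l. trivialization (At i) (coord_ring (\<sigma> i)) (\<theta> i)) \<and>
     (\<forall>i j. \<not> (i < l \<and> j < l) \<longrightarrow> d i j = (\<lambda>f. 0)) \<and>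
     (\<forall>i<l. \<forall>j<l. d i j \<in> vector_fields (\<sigma> i \<inter> \<sigma> j) \<and>
        (\<exists>B \<theta>i \<theta>j. is_localization B (At i) \<and> is_localization B (At j) \<and>
           trivialization B (coord_ring (\<sigma> i \<inter> \<sigma> j)) \<theta>i \<and> (\<forall>f\<in>At i. \<theta>i f = \<theta> i f) \<and>
           trivialization B (coord_ring (\<sigma> i \<inter> \<sigma> j)) \<theta>j \<and> (\<forall>f\<in>At j. \<theta>j f = \<theta> j f) \<and>
           (\<forall>f\<in>B. \<theta>j f = id_plus_t (d i j) (\<theta>i f))))"

definition is_KS_class :: "nat \<Rightarrow> (nat \<Rightarrow> cone) \<Rightarrow> (nat \<Rightarrow> K set) \<Rightarrow> cochain set \<Rightarrow> bool" where
  "is_KS_class l \<sigma> At C \<longleftrightarrow> (\<exists>\<theta> d. KS_cocycle l \<sigma> At \<theta> d \<and> C = cohomology_class l \<sigma> d)"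

definition KS_class :: "nat \<Rightarrow> (nat \<Rightarrow> cone) \<Rightarrow> (nat \<Rightarrow> K set) \<Rightarrow> cochain set" where
  "KS_class l \<sigma> At = (THE C. is_KS_class l \<sigma> At C)"


section \<open>The deformations of degree \<open>-R\<close>\<close>

definition step_tuple :: "nat \<Rightarrow> nat \<Rightarrow> int" where
  "step_tuple i j = (if j < i then 1 else - 1)"

definition step_deformation ::
    "(nat \<Rightarrow> lattice) \<Rightarrow> nat \<Rightarrow> lattice \<Rightarrow> lattice \<Rightarrow> nat \<Rightarrow> nat \<Rightarrow> K set" where
  "step_deformation \<nu> m S R i = deformation \<nu> m S R 0 (step_tuple i)"

definition step_indices :: "(nat \<Rightarrow> lattice) \<Rightarrow> nat \<Rightarrow> lattice \<Rightarrow> nat set" where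
  "step_indices \<nu> m R = {i. 2 \<le> i \<and> i \<le> m \<and> pairing (\<nu> i) R = 1}"

end

theory Submission
  imports Defs "HOL-Library.Product_Plus"
begin

text \<open>
  Write \<open>h\<^sub>i\<close> for the value of \<open>R\<close> on \<open>\<nu>(\<rho>\<^sub>i)\<close> and \<open>\<partial>\<^sub>n\<close> for the torus-invariant vector field with
  \<open>\<partial>\<^sub>n(\<chi>\<^sup>w) = \<langle>n, w\<rangle> \<chi>\<^sup>w\<close>, where \<open>n\<close> lies in \<open>N \<otimes> \<complex>\<close>. Both sides of the statement reduce to linear
  algebra in \<open>N \<otimes> \<complex>\<close>.

  The Kodaira-Spencer classes. Put \<open>g = (y - t) / y\<close>. The charts of \<open>\<pi>(k)\<close> with index below \<open>k\<close> are generated by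
  \<open>t\<close> and the characters \<open>\<chi>\<^sup>u\<close>, those with index from \<open>k\<close> to \<open>m + 1\<close> by \<open>t\<close> and the twisted characters
  \<open>\<chi>\<^sup>u g\<^sup>j\<close> with \<open>j = \<langle>\<nu>(\<rho>\<^sub>k), u\<rangle>\<close>, and the remaining ones by \<open>t\<close>, the characters and \<open>1/g\<close>. Since
  \<open>g = 1 - t \<chi>\<^sup>-\<^sup>R\<close>, twisting is the automorphism \<open>1 - t \<chi>\<^sup>-\<^sup>R \<partial>\<^sub>n\<close> to first order, for \<open>n = \<nu>(\<rho>\<^sub>k)\<close>. So
  expansion modulo \<open>t\<^sup>2\<close>, followed on the twisted charts by \<open>1 + t \<chi>\<^sup>-\<^sup>R \<partial>\<^sub>n\<close>, trivializes all charts,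
  and the resulting cocycle is \<open>d\<^sub>i\<^sub>j = D\<^sub>j - D\<^sub>i\<close> with \<open>D\<^sub>i = \<chi>\<^sup>-\<^sup>R \<partial>\<^sub>n\<close> for \<open>k \<le> i \<le> m + 1\<close> and \<open>D\<^sub>i = 0\<close>
  otherwise (\<open>KS_cocycle_step\<close>). This needs a common localization of any two charts. If \<open>\<chi>\<^sup>-\<^sup>R\<close>
  is regular on the overlap, then \<open>g\<close> is invertible there after a further localization, and both kinds of
  charts acquire the same localization. Otherwise the cones meet in the half-plane \<open>R > 0\<close>, so they are equal
  or adjacent; the only adjacent pair of different kinds meets in \<open>\<rho>\<^sub>k\<close>, and there
  \<open>h\<^sub>k = 1\<close> makes both rings equal (\<open>char_ring_ray\<close>). The class does not depend on choices: two
  trivializations of a chart differ by \<open>1 + t D\<close> for a vector field \<open>D\<close> on the chart, hence two cocycles differ by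
  a coboundary (\<open>KS_cocycles_cohomologous\<close>).

  The target. A cocycle of degree \<open>-R\<close> is \<open>\<chi>\<^sup>-\<^sup>R \<partial>\<close> applied to differences \<open>P\<^sub>j - P\<^sub>i\<close> of vectors in
  \<open>N \<otimes> \<complex>\<close>. Such a field \<open>\<chi>\<^sup>-\<^sup>R \<partial>\<^sub>n\<close> is regular along \<open>\<rho>\<^sub>i\<close> for all \<open>n\<close> if \<open>h\<^sub>i \<le> 0\<close>, only for multiples
  of \<open>\<nu>(\<rho>\<^sub>i)\<close> if \<open>h\<^sub>i = 1\<close>, and only for \<open>n = 0\<close> if \<open>h\<^sub>i \<ge> 2\<close> (\<open>ray_section\<close>). The rays with \<open>h\<^sub>i > 0\<close> are
  \<open>\<rho>\<^sub>1, \<dots>, \<rho>\<^sub>m\<^sub>+\<^sub>1\<close>. Hence \<open>P\<close> jumps by \<open>c\<^sub>i \<nu>(\<rho>\<^sub>i)\<close> across these rays, with \<open>c\<^sub>i = 0\<close> unless \<open>h\<^sub>i = 1\<close>, and is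
  arbitrary on the charts beyond them. Coboundaries are the \<open>P\<close> with \<open>\<chi>\<^sup>-\<^sup>R \<partial>\<^sub>P\<close> regular on each chart: zero on
  the charts \<open>1, \<dots>, m\<close>, multiples of \<open>\<nu>(\<rho>\<^sub>1)\<close> and of \<open>\<nu>(\<rho>\<^sub>m\<^sub>+\<^sub>1)\<close> on the two end charts if these rays have
  height 1, everything beyond. Thus exactly the jumps \<open>c\<^sub>i\<close> with \<open>2 \<le> i \<le> m\<close> and \<open>h\<^sub>i = 1\<close> survive as
  coordinates, and \<open>\<pi>(k)\<close> is the class with the single jump \<open>c\<^sub>k = 1\<close>.
\<close>

section \<open>Characters and derivations of the function field\<close>

lemma const0_simps [simp]:
  "const0 0 = 0" "const0 1 = 1"
  "const0 (a + b) = const0 a + const0 b"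
  "const0 (a * b) = const0 a * const0 b"
  "const0 (- a) = - const0 a"
  "const0 (a - b) = const0 a - const0 b"
  by (simp_all add: const0_def One_fract_def Zero_fract_def one_pCons)

lemma const0_eq_iff [simp]: "const0 a = const0 b \<longleftrightarrow> a = b"
  by (simp add: const0_def eq_fract)

lemma const0_eq_0_iff [simp]: "const0 a = 0 \<longleftrightarrow> a = 0"
  using const0_eq_iff[of a 0] by (simp del: const0_eq_iff)

lemma const0_of_nat: "const0 (of_nat n) = of_nat n"
  by (induction n) simp_all

lemma const0_of_int: "const0 (of_int n) = of_int n"
  by (cases n rule: int_diff_cases) (simp add: const0_of_nat)

abbreviation X1 :: K0 where "X1 \<equiv> Fract [:[:0, 1:]:] 1"
abbreviation X2 :: K0 where "X2 \<equiv> Fract [:0, 1:] 1"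

lemma X1_nonzero [simp]: "X1 \<noteq> 0" and X2_nonzero [simp]: "X2 \<noteq> 0"
  by (simp_all add: Zero_fract_def eq_fract)

lemma chi_nonzero [simp]: "chi u \<noteq> 0"
  by (simp add: chi_def)

lemma chi_add: "chi (u + v) = chi u * chi v"
  by (simp add: chi_def power_int_add ac_simps)

lemma chi_0 [simp]: "chi 0 = 1"
  by (simp add: chi_def)

lemma chi_minus: "chi (- u) = inverse (chi u)"
  by (simp add: chi_def power_int_minus inverse_mult_distrib)

lemma chi_diff: "chi (u - v) = chi u / chi v"
  using chi_add[of u "- v"] by (simp add: chi_minus field_simps)

definition lscale :: "int \<Rightarrow> lattice \<Rightarrow> lattice" where
  "lscale k u = (k * fst u, k * snd u)"

lemma fst_lscale [simp]: "fst (lscale k u) = k * fst u"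
  and snd_lscale [simp]: "snd (lscale k u) = k * snd u"
  by (simp_all add: lscale_def)

lemma chi_lscale: "chi (lscale k u) = chi u powi k"
  by (simp add: chi_def power_int_mult_distrib mult.commute[of k] power_int_mult)

text \<open>
  After multiplication by the character \<open>(N, N)\<close> for large \<open>N\<close>, only nonnegative exponents occur, and a
  relation between distinct characters becomes a relation between distinct monomials.
\<close>

lemma chi_sum_eq_0_imp:
  assumes "finite U" and "(\<Sum>u\<in>U. const0 (c u) * chi u) = 0" and "v \<in> U"
  shows "c v = 0"
proof -
  define N where "N = Max ((\<lambda>u. max \<bar>fst u\<bar> \<bar>snd u\<bar>) ` U)"
  have N: "\<bar>fst u\<bar> \<le> N" "\<bar>snd u\<bar> \<le> N" if "u \<in> U" for u
  proof -
    have "max \<bar>fst u\<bar> \<bar>snd u\<bar> \<le> N"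
      unfolding N_def using assms(1) that by (intro Max_ge) auto
    then show "\<bar>fst u\<bar> \<le> N" "\<bar>snd u\<bar> \<le> N" by auto
  qed
  define e1 e2 where "e1 u = nat (fst u + N)" and "e2 u = nat (snd u + N)" for u :: lattice
  have inj: "e1 u = e1 v \<and> e2 u = e2 v \<longleftrightarrow> u = v" if "u \<in> U" for u
    using N[OF that] N[OF assms(3)] by (auto simp: e1_def e2_def prod_eq_iff)
  have X1p: "X1 ^ n = Fract [:monom 1 n:] 1" for n
  proof (induction n)
    case 0
    then show ?case by (simp add: One_fract_def one_pCons monom_0)
  next
    case (Suc n)
    then show ?case by (simp add: monom_Suc)
  qed
  have X2p: "X2 ^ n = Fract (monom 1 n) 1" for n
  proof (induction n)
    case 0
    then show ?case by (simp add: One_fract_def one_pCons monom_0)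
  next
    case (Suc n)
    then show ?case by (simp add: monom_Suc)
  qed
  have shifted: "chi (N, N) * chi u = Fract (monom (monom 1 (e1 u)) (e2 u)) 1" if "u \<in> U" for u
  proof -
    have "chi (N, N) * chi u = chi (int (e1 u), int (e2 u))"
    proof -
      have "0 \<le> fst u + N" "0 \<le> snd u + N"
        using N[OF that] by linarith+
      then have "(N, N) + u = (int (e1 u), int (e2 u))"
        by (simp add: e1_def e2_def prod_eq_iff)
      then show ?thesis by (simp flip: chi_add)
    qed
    also have "\<dots> = X1 ^ e1 u * X2 ^ e2 u"
      by (simp add: chi_def)
    also have "\<dots> = Fract (monom (monom 1 (e1 u)) (e2 u)) 1"
      by (simp add: X1p X2p smult_monom)
    finally show ?thesis .
  qed
  have sumF: "(\<Sum>u\<in>V. Fract (f u) 1) = Fract (\<Sum>u\<in>V. f u) 1" if "finite V"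
    for V :: "lattice set" and f :: "lattice \<Rightarrow> complex poly poly"
    using that by induction (simp_all add: fract_collapse)
  have "0 = chi (N, N) * (\<Sum>u\<in>U. const0 (c u) * chi u)"
    using assms(2) by simp
  also have "\<dots> = (\<Sum>u\<in>U. const0 (c u) * (chi (N, N) * chi u))"
    by (simp add: sum_distrib_left ac_simps)
  also have "\<dots> = (\<Sum>u\<in>U. Fract (monom (monom (c u) (e1 u)) (e2 u)) 1)"
    by (intro sum.cong refl) (simp add: shifted const0_def smult_monom)
  also have "\<dots> = Fract (\<Sum>u\<in>U. monom (monom (c u) (e1 u)) (e2 u)) 1"
    by (rule sumF[OF assms(1)])
  finally have "(\<Sum>u\<in>U. monom (monom (c u) (e1 u)) (e2 u)) = 0"
    by (simp add: Zero_fract_def eq_fract)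
  then have "0 = coeff (coeff (\<Sum>u\<in>U. monom (monom (c u) (e1 u)) (e2 u)) (e2 v)) (e1 v)"
    by simp
  also have "\<dots> = (\<Sum>u\<in>U. if u = v then c u else 0)"
    unfolding coeff_sum by (intro sum.cong refl) (use inj in \<open>auto simp: coeff_monom\<close>)
  also have "\<dots> = c v"
    using assms(1,3) by simp
  finally show ?thesis by simp
qed

lemma derivation_add: "is_derivation D \<Longrightarrow> D (f + g) = D f + D g"
  and derivation_mult: "is_derivation D \<Longrightarrow> D (f * g) = f * D g + g * D f"
  and derivation_const: "is_derivation D \<Longrightarrow> D (const0 c) = 0"
  by (simp_all add: is_derivation_def)

lemma derivation_0 [simp]: "is_derivation D \<Longrightarrow> D 0 = 0"
  and derivation_1 [simp]: "is_derivation D \<Longrightarrow> D 1 = 0"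
  using derivation_const[of D 0] derivation_const[of D 1] by simp_all

lemma derivation_sum: "is_derivation D \<Longrightarrow> D (\<Sum>u\<in>U. f u) = (\<Sum>u\<in>U. D (f u))"
  by (induction U rule: infinite_finite_induct) (simp_all add: derivation_add)

lemma derivation_const_mult: "is_derivation D \<Longrightarrow> D (const0 c * f) = const0 c * D f"
  by (simp add: derivation_mult derivation_const)

lemma derivation_divide:
  assumes "is_derivation D" and "g \<noteq> 0"
  shows "D (f / g) = (D f * g - f * D g) / g ^ 2"
proof -
  have "D f = D ((f / g) * g)" using assms(2) by simp
  also have "\<dots> = f / g * D g + g * D (f / g)"
    by (rule derivation_mult[OF assms(1)])
  finally show ?thesis using assms(2) by (simp add: field_simps power2_eq_square)
qed

lemma derivation_power_int:
  assumes "is_derivation D" and "f \<noteq> 0" and "D f = e * f"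
  shows "D (f powi n) = of_int n * e * f powi n"
proof -
  have pow: "D (f ^ k) = of_nat k * e * f ^ k" for k
    by (induction k) (simp_all add: assms derivation_mult algebra_simps)
  show ?thesis
  proof (cases n rule: int_cases4)
    case (neg k)
    have "D (f powi n) = D (1 / f ^ k)"
      using neg by (simp add: power_int_minus divide_inverse)
    also have "\<dots> = of_int n * e * f powi n"
      unfolding derivation_divide[OF assms(1) power_not_zero[OF assms(2)]]
      using neg assms(1,2) by (simp add: pow power_int_minus field_simps power2_eq_square)
    finally show ?thesis .
  qed (simp add: pow)
qed

lemma derivation_zero: "is_derivation (\<lambda>f. 0)"
  by (simp add: is_derivation_def)

lemma derivation_plus:
  "is_derivation D \<Longrightarrow> is_derivation E \<Longrightarrow> is_derivation (\<lambda>f. D f + E f)"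
  by (simp add: is_derivation_def algebra_simps)

lemma derivation_minus_fun:
  "is_derivation D \<Longrightarrow> is_derivation E \<Longrightarrow> is_derivation (\<lambda>f. D f - E f)"
  by (simp add: is_derivation_def algebra_simps)

lemma derivation_scale:
  "is_derivation D \<Longrightarrow> is_derivation (\<lambda>f. h * D f)"
  by (simp add: is_derivation_def algebra_simps)

text \<open>
  The Leibniz rule determines a derivation on polynomials, one variable after the other, by its values on the
  two variables, which are characters; the quotient rule extends this to fractions.
\<close>

lemma derivation_eqI:
  assumes D: "is_derivation D" and E: "is_derivation E"
    and eq: "\<And>v. D (chi v) = E (chi v)"
  shows "D = E"
proof
  fix f :: K0
  have X1: "D X1 = E X1" and X2: "D X2 = E X2"
    using eq[of "(1, 0)"] eq[of "(0, 1)"] by (simp_all add: chi_def)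
  have inner: "D (Fract [:p:] 1) = E (Fract [:p:] 1)" for p
  proof (induction p)
    case 0
    then show ?case using D E by (simp add: fract_collapse)
  next
    case (pCons a p)
    have "Fract [:pCons a p:] 1 = const0 a + X1 * Fract [:p:] 1"
      by (simp add: const0_def)
    then show ?case
      by (simp add: derivation_add[OF D] derivation_add[OF E] derivation_mult[OF D]
          derivation_mult[OF E] derivation_const[OF D] derivation_const[OF E] X1 pCons.IH
          del: mult_fract add_fract)
  qed
  have outer: "D (Fract q 1) = E (Fract q 1)" for q
  proof (induction q)
    case 0
    then show ?case using D E by (simp add: fract_collapse)
  next
    case (pCons p q)
    have "Fract (pCons p q) 1 = Fract [:p:] 1 + X2 * Fract q 1"
      by simp
    then show ?case
      by (simp add: derivation_add[OF D] derivation_add[OF E] derivation_mult[OF D]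
          derivation_mult[OF E] inner X2 pCons.IH del: add_fract mult_fract)
  qed
  obtain p q where f: "f = Fract p q" and q: "q \<noteq> 0"
    by (cases f)
  have "f = Fract p 1 / Fract q 1"
    by (simp add: f)
  moreover have "Fract q 1 \<noteq> 0"
    using q by (simp add: Zero_fract_def eq_fract)
  ultimately show "D f = E f"
    by (simp add: derivation_divide[OF D] derivation_divide[OF E] outer del: divide_fract)
qed

text \<open>
  The quotient rule. The value does not depend on the fraction that represents \<open>f\<close>, so the description is
  definite.
\<close>

definition fract_deriv :: "('a::idom \<Rightarrow> 'a) \<Rightarrow> 'a fract \<Rightarrow> 'a fract" where
  "fract_deriv d f =
     (THE g. \<exists>p q. q \<noteq> 0 \<and> f = Fract p q \<and> g = Fract (d p * q - p * d q) (q * q))"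

lemma fract_deriv_Fract:
  fixes d :: "'a::idom \<Rightarrow> 'a"
  assumes mult: "\<And>p q. d (p * q) = p * d q + q * d p" and "q \<noteq> 0"
  shows "fract_deriv d (Fract p q) = Fract (d p * q - p * d q) (q * q)"
  unfolding fract_deriv_def
proof (rule the_equality)
  show "\<exists>p' q'. q' \<noteq> 0 \<and> Fract p q = Fract p' q' \<and>
      Fract (d p * q - p * d q) (q * q) = Fract (d p' * q' - p' * d q') (q' * q')"
    using assms(2) by blast
next
  fix g
  assume "\<exists>p' q'. q' \<noteq> 0 \<and> Fract p q = Fract p' q' \<and>
      g = Fract (d p' * q' - p' * d q') (q' * q')"
  then obtain p' q' where q': "q' \<noteq> 0" and eq: "p * q' = p' * q"
    and g: "g = Fract (d p' * q' - p' * d q') (q' * q')"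
    using assms(2) by (auto simp: eq_fract)
  have "p * d q' + q' * d p = p' * d q + q * d p'"
    using arg_cong[OF eq, of d] by (simp add: mult)
  \<comment> \<open>The two fractions differ by a combination of the relation \<open>p q' = p' q\<close> and its derivative.\<close>
  moreover have "(d p' * q' - p' * d q') * (q * q) - (d p * q - p * d q) * (q' * q')
      = q * q' * (p' * d q + q * d p' - (p * d q' + q' * d p)) + (q * d q' + q' * d q) * (p * q' - p' * q)"
    by (simp add: algebra_simps)
  ultimately have "(d p' * q' - p' * d q') * (q * q) = (d p * q - p * d q) * (q' * q')"
    using eq by simp
  then show "g = Fract (d p * q - p * d q) (q * q)"
    using q' assms(2) by (simp add: g eq_fract)
qed

lemma derivation_fract_deriv:
  assumes add: "\<And>p q. d (p + q) = d p + d q"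
    and mult: "\<And>p q. d (p * q) = p * d q + q * d p"
    and const: "\<And>c. d [:[:c:]:] = 0"
  shows "is_derivation (fract_deriv d)"
  unfolding is_derivation_def
proof (intro conjI allI)
  have d1: "d 1 = 0"
    using const[of 1] by (simp add: pCons_one)
  note F = fract_deriv_Fract[of d, OF mult]
  show "fract_deriv d (const0 c) = 0" for c
    by (simp add: const0_def F const d1 Zero_fract_def)
  fix f g :: K0
  obtain p q p' q' where f: "f = Fract p q" "q \<noteq> 0" and g: "g = Fract p' q'" "q' \<noteq> 0"
    by (metis Fract_cases)
  show "fract_deriv d (f + g) = fract_deriv d f + fract_deriv d g"
    using f(2) g(2) by (simp add: f(1) g(1) F eq_fract add mult algebra_simps)
  show "fract_deriv d (f * g) = f * fract_deriv d g + g * fract_deriv d f"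
    using f(2) g(2) by (simp add: f(1) g(1) F eq_fract add mult algebra_simps)
qed

text \<open>
  The logarithmic derivations \<open>X\<^sub>i \<partial>/\<partial>X\<^sub>i\<close>: every character is an eigenvector of both.
\<close>

definition euler1 :: "K0 \<Rightarrow> K0" where
  "euler1 f = X1 * fract_deriv (map_poly pderiv) f"

definition euler2 :: "K0 \<Rightarrow> K0" where
  "euler2 f = X2 * fract_deriv pderiv f"

lemma map_poly_pderiv_add: "map_poly pderiv (p + q) = map_poly pderiv p + map_poly pderiv q"
  for p q :: "complex poly poly"
  by (intro poly_eqI) (simp add: coeff_map_poly pderiv_add)

lemma map_poly_pderiv_mult:
  "map_poly pderiv (p * q) = p * map_poly pderiv q + q * map_poly pderiv p"
  for p q :: "complex poly poly"
proof (rule poly_eqI)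
  fix n
  have "coeff (map_poly pderiv (p * q)) n = (\<Sum>i\<le>n. pderiv (coeff p i * coeff q (n - i)))"
    by (simp add: coeff_map_poly coeff_mult higher_pderiv_sum[of 1, simplified])
  also have "\<dots> = coeff (p * map_poly pderiv q) n + coeff (map_poly pderiv p * q) n"
    by (simp add: coeff_mult coeff_map_poly pderiv_mult sum.distrib mult.commute[of "coeff q _"])
  finally show "coeff (map_poly pderiv (p * q)) n
      = coeff (p * map_poly pderiv q + q * map_poly pderiv p) n"
    by (simp add: mult.commute)
qed

lemma derivation_euler1: "is_derivation euler1"
  unfolding euler1_def
  by (intro derivation_scale derivation_fract_deriv map_poly_pderiv_add map_poly_pderiv_mult)
    (simp add: map_poly_pCons)

lemma derivation_euler2: "is_derivation euler2"
  unfolding euler2_def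
  by (intro derivation_scale derivation_fract_deriv) (simp_all add: pderiv_add pderiv_mult pderiv_pCons)

lemma euler_X: "euler1 X1 = X1" "euler1 X2 = 0" "euler2 X1 = 0" "euler2 X2 = X2"
proof -
  have d1: "map_poly pderiv (1 :: complex poly poly) = 0"
    by (simp add: one_pCons map_poly_pCons pderiv_pCons)
  have F1: "fract_deriv (map_poly pderiv) (Fract p 1) = Fract (map_poly pderiv p) 1"
    for p :: "complex poly poly"
    by (subst fract_deriv_Fract) (simp_all add: map_poly_pderiv_mult d1)
  have F2: "fract_deriv pderiv (Fract p 1) = Fract (pderiv p) 1"
    for p :: "complex poly poly"
    by (subst fract_deriv_Fract) (simp_all add: pderiv_mult)
  have "map_poly pderiv [:[:0, 1:]:] = (1 :: complex poly poly)"
    "map_poly pderiv [:0, 1:] = (0 :: complex poly poly)"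
    "pderiv [:[:0, 1:]:] = (0 :: complex poly poly)" "pderiv [:0, 1:] = (1 :: complex poly poly)"
    by (simp_all add: map_poly_pCons pderiv_pCons one_pCons)
  then show "euler1 X1 = X1" "euler1 X2 = 0" "euler2 X1 = 0" "euler2 X2 = X2"
    unfolding euler1_def euler2_def F1 F2
    by (simp_all only: One_fract_def[symmetric] Zero_fract_def[symmetric] mult_1_right mult_zero_right)
qed

definition cpair :: "complex \<times> complex \<Rightarrow> lattice \<Rightarrow> complex" where
  "cpair n w = fst n * of_int (fst w) + snd n * of_int (snd w)"

lemma cpair_simps:
  "cpair n (v + w) = cpair n v + cpair n w" "cpair n (- v) = - cpair n v"
  "cpair n (v - w) = cpair n v - cpair n w" "cpair n (lscale k v) = of_int k * cpair n v"
  "cpair (n + n') v = cpair n v + cpair n' v" "cpair (n - n') v = cpair n v - cpair n' v"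
  "cpair 0 v = 0"
  by (simp_all add: cpair_def algebra_simps)

text \<open>
  The vector field \<open>\<chi>\<^sup>u \<partial>\<^sub>n\<close> for \<open>n \<in> N \<otimes> \<complex>\<close>, where \<open>\<partial>\<^sub>n\<close> multiplies \<open>\<chi>\<^sup>w\<close> by \<open>\<langle>n, w\<rangle>\<close>.
\<close>

definition vf :: "lattice \<Rightarrow> complex \<times> complex \<Rightarrow> K0 \<Rightarrow> K0" where
  "vf u n = (\<lambda>f. chi u * (const0 (fst n) * euler1 f + const0 (snd n) * euler2 f))"

lemma derivation_vf: "is_derivation (vf u n)"
  unfolding vf_def by (intro derivation_scale derivation_plus derivation_euler1 derivation_euler2)

lemma euler_chi:
  "euler1 (chi w) = of_int (fst w) * chi w" "euler2 (chi w) = of_int (snd w) * chi w"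
proof -
  have "euler1 (chi w) = X1 powi fst w * euler1 (X2 powi snd w) + X2 powi snd w * euler1 (X1 powi fst w)"
    unfolding chi_def by (rule derivation_mult[OF derivation_euler1])
  then show "euler1 (chi w) = of_int (fst w) * chi w"
    using derivation_power_int[OF derivation_euler1, of X1 1 "fst w"]
      derivation_power_int[OF derivation_euler1, of X2 0 "snd w"]
    by (simp add: euler_X chi_def)
  have "euler2 (chi w) = X1 powi fst w * euler2 (X2 powi snd w) + X2 powi snd w * euler2 (X1 powi fst w)"
    unfolding chi_def by (rule derivation_mult[OF derivation_euler2])
  then show "euler2 (chi w) = of_int (snd w) * chi w"
    using derivation_power_int[OF derivation_euler2, of X1 0 "fst w"]
      derivation_power_int[OF derivation_euler2, of X2 1 "snd w"]
    by (simp add: euler_X chi_def)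
qed

lemma vf_chi: "vf u n (chi w) = const0 (cpair n w) * chi (w + u)"
  by (simp add: vf_def euler_chi cpair_def chi_add const0_of_int algebra_simps)

lemma vf_add: "vf u (n + n') f = vf u n f + vf u n' f"
  and vf_diff: "vf u (n - n') f = vf u n f - vf u n' f"
  and vf_0: "vf u 0 f = 0"
  and vf_smult: "vf u (c * fst n, c * snd n) f = const0 c * vf u n f"
  by (simp_all add: vf_def algebra_simps)

lemma vf_sum: "vf u (\<Sum>k\<in>A. n k) f = (\<Sum>k\<in>A. vf u (n k) f)"
  by (induction A rule: infinite_finite_induct) (simp_all add: vf_0 vf_add)

text \<open>
  A torus-invariant field has every character as an eigenvector. By the Leibniz rule the eigenvalue is additive
  in the character, hence a linear form on \<open>M\<close>, that is, an element of \<open>N \<otimes> \<complex>\<close>.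
\<close>

lemma homogeneous_iff: "homogeneous u D \<longleftrightarrow> (\<exists>n. D = vf u n)"
proof
  assume "homogeneous u D"
  then obtain E where E: "torus_invariant E" "D = (\<lambda>f. chi u * E f)"
    unfolding homogeneous_def by blast
  then have der: "is_derivation E" and "\<forall>v. \<exists>c. E (chi v) = const0 c * chi v"
    unfolding torus_invariant_def by blast+
  then obtain c where c: "\<And>v. E (chi v) = const0 (c v) * chi v"
    by metis
  have add: "c (v + w) = c v + c w" for v w
  proof -
    have "E (chi (v + w)) = chi v * E (chi w) + chi w * E (chi v)"
      unfolding chi_add by (rule derivation_mult[OF der])
    then have "const0 (c (v + w)) * chi (v + w) = const0 (c v + c w) * chi (v + w)"
      unfolding c by (simp add: chi_add algebra_simps)
    then show ?thesis by (simp del: const0_simps)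
  qed
  have "E = (\<lambda>f. const0 (c (1, 0)) * euler1 f + const0 (c (0, 1)) * euler2 f)"
  proof (rule derivation_eqI[OF der])
    show E': "is_derivation (\<lambda>f. const0 (c (1, 0)) * euler1 f + const0 (c (0, 1)) * euler2 f)"
      by (intro derivation_plus derivation_scale derivation_euler1 derivation_euler2)
    fix v :: lattice
    have EX: "E X1 = const0 (c (1, 0)) * X1" "E X2 = const0 (c (0, 1)) * X2"
      using c[of "(1, 0)"] c[of "(0, 1)"] by (simp_all add: chi_def)
    have "E (chi v) = X1 powi fst v * E (X2 powi snd v) + X2 powi snd v * E (X1 powi fst v)"
      unfolding chi_def by (rule derivation_mult[OF der])
    then have "E (chi v) = (const0 (c (1, 0)) * of_int (fst v) + const0 (c (0, 1)) * of_int (snd v)) * chi v"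
      using derivation_power_int[OF der _ EX(1), of "fst v"] derivation_power_int[OF der _ EX(2), of "snd v"]
      by (simp add: chi_def algebra_simps)
    then show "E (chi v) = const0 (c (1, 0)) * euler1 (chi v) + const0 (c (0, 1)) * euler2 (chi v)"
      by (simp add: euler_chi algebra_simps)
  qed
  then have "D = vf u (c (1, 0), c (0, 1))"
    by (simp add: E(2) vf_def)
  then show "\<exists>n. D = vf u n" by blast
next
  assume "\<exists>n. D = vf u n"
  then obtain n where "D = vf u n" by blast
  moreover have "torus_invariant (vf 0 n)"
    by (auto simp: torus_invariant_def derivation_vf vf_chi)
  moreover have "vf u n = (\<lambda>f. chi u * vf 0 n f)"
    by (simp add: vf_def)
  ultimately show "homogeneous u D"
    unfolding homogeneous_def by blast
qed

section \<open>Algebras spanned by characters\<close>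

text \<open>
  The common pattern of the coordinate ring of a toric chart and of the part of a chart of the deformation that is spanned
  by twisted characters: scalars \<open>k\<close> and a multiplicative family \<open>\<phi>\<close> indexed by a monoid of lattice points.
\<close>

locale character_span =
  fixes k :: "complex \<Rightarrow> 'b::comm_ring_1" and \<phi> :: "lattice \<Rightarrow> 'b" and D :: "lattice set"
  assumes k_0 [simp]: "k 0 = 0" and k_1 [simp]: "k 1 = 1"
    and k_add: "k (a + b) = k a + k b" and k_mult: "k (a * b) = k a * k b"
    and \<phi>_0 [simp]: "\<phi> 0 = 1" and \<phi>_add: "\<phi> (u + v) = \<phi> u * \<phi> v"
    and zero_in [simp]: "0 \<in> D" and add_in: "u \<in> D \<Longrightarrow> v \<in> D \<Longrightarrow> u + v \<in> D"
begin

definition spanned :: "'b set" where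
  "spanned = {\<Sum>u\<in>U. k (c u) * \<phi> u | U c. finite U \<and> U \<subseteq> D}"

lemma spannedI: "finite U \<Longrightarrow> U \<subseteq> D \<Longrightarrow> (\<Sum>u\<in>U. k (c u) * \<phi> u) \<in> spanned"
  unfolding spanned_def by blast

lemma spannedE:
  assumes "f \<in> spanned"
  obtains U c where "finite U" "U \<subseteq> D" "f = (\<Sum>u\<in>U. k (c u) * \<phi> u)"
  using assms unfolding spanned_def by blast

lemma spanned_term: "u \<in> D \<Longrightarrow> k c * \<phi> u \<in> spanned"
  using spannedI[of "{u}" "\<lambda>_. c"] by simp

lemma spanned_char: "u \<in> D \<Longrightarrow> \<phi> u \<in> spanned"
  using spanned_term[of u 1] by simp

lemma spanned_const: "k c \<in> spanned"
  using spanned_term[of 0 c] by simp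

lemma spanned_0 [simp]: "0 \<in> spanned" and spanned_1 [simp]: "1 \<in> spanned"
  using spanned_const[of 0] spanned_const[of 1] by simp_all

lemma spanned_common:
  assumes "f \<in> spanned" and "g \<in> spanned"
  obtains U c d where "finite U" "U \<subseteq> D" "f = (\<Sum>u\<in>U. k (c u) * \<phi> u)" "g = (\<Sum>u\<in>U. k (d u) * \<phi> u)"
proof -
  obtain U c V d where U: "finite U" "U \<subseteq> D" "f = (\<Sum>u\<in>U. k (c u) * \<phi> u)"
    and V: "finite V" "V \<subseteq> D" "g = (\<Sum>u\<in>V. k (d u) * \<phi> u)"
    using assms by (elim spannedE) blast
  have "f = (\<Sum>u\<in>U \<union> V. k (if u \<in> U then c u else 0) * \<phi> u)"
    "g = (\<Sum>u\<in>U \<union> V. k (if u \<in> V then d u else 0) * \<phi> u)"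
    unfolding U(3) V(3) using U(1) V(1) by (auto intro!: sum.mono_neutral_cong_left)
  then show ?thesis
    using U V by (intro that[of "U \<union> V"]) auto
qed

lemma spanned_add:
  assumes "f \<in> spanned" and "g \<in> spanned"
  shows "f + g \<in> spanned"
proof -
  obtain U c d where U: "finite U" "U \<subseteq> D" "f = (\<Sum>u\<in>U. k (c u) * \<phi> u)" "g = (\<Sum>u\<in>U. k (d u) * \<phi> u)"
    using spanned_common[OF assms] .
  then have "f + g = (\<Sum>u\<in>U. k (c u + d u) * \<phi> u)"
    by (simp add: k_add sum.distrib distrib_right)
  then show ?thesis
    using spannedI U by simp
qed

lemma spanned_sum: "(\<And>x. x \<in> X \<Longrightarrow> f x \<in> spanned) \<Longrightarrow> (\<Sum>x\<in>X. f x) \<in> spanned"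
  by (induction X rule: infinite_finite_induct) (simp_all add: spanned_add)

lemma spanned_mult:
  assumes "f \<in> spanned" and "g \<in> spanned"
  shows "f * g \<in> spanned"
proof -
  obtain U c V d where U: "finite U" "U \<subseteq> D" "f = (\<Sum>u\<in>U. k (c u) * \<phi> u)"
    and V: "finite V" "V \<subseteq> D" "g = (\<Sum>u\<in>V. k (d u) * \<phi> u)"
    using assms by (elim spannedE) blast
  have "f * g = (\<Sum>u\<in>U. \<Sum>v\<in>V. k (c u * d v) * \<phi> (u + v))"
    by (simp add: U(3) V(3) sum_product k_mult \<phi>_add ac_simps)
  also have "\<dots> \<in> spanned"
    using U(2) V(2) by (intro spanned_sum spanned_term add_in) auto
  finally show ?thesis .
qed

lemma spanned_minus: "f \<in> spanned \<Longrightarrow> - f \<in> spanned"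
proof -
  assume f: "f \<in> spanned"
  have "k (- 1) = - 1"
    using k_add[of 1 "- 1"] by (simp add: eq_neg_iff_add_eq_0 add.commute)
  then show ?thesis
    using spanned_mult[OF spanned_const[of "- 1"] f] by simp
qed

lemma spanned_diff: "f \<in> spanned \<Longrightarrow> g \<in> spanned \<Longrightarrow> f - g \<in> spanned"
  using spanned_add[of f "- g"] by (simp add: spanned_minus)

end

lemma pairing_rat_lin:
  "pairing_rat v (u + w) = pairing_rat v u + pairing_rat v w"
  "pairing_rat v (u - w) = pairing_rat v u - pairing_rat v w"
  "pairing_rat v (- u) = - pairing_rat v u"
  "pairing_rat v 0 = 0"
  "pairing_rat v (lscale k u) = of_int k * pairing_rat v u"
  by (simp_all add: pairing_rat_def algebra_simps)

abbreviation dual :: "cone \<Rightarrow> lattice set" where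
  "dual \<equiv> dual_lattice_points"

lemma dual_0 [simp]: "0 \<in> dual \<tau>"
  and dual_add: "u \<in> dual \<tau> \<Longrightarrow> w \<in> dual \<tau> \<Longrightarrow> u + w \<in> dual \<tau>"
  by (simp_all add: dual_lattice_points_def pairing_rat_lin)

lemma dual_lscale: "0 \<le> k \<Longrightarrow> u \<in> dual \<tau> \<Longrightarrow> lscale k u \<in> dual \<tau>"
  by (simp add: dual_lattice_points_def pairing_rat_lin)

lemma dual_antimono: "\<tau> \<subseteq> \<tau>' \<Longrightarrow> dual \<tau>' \<subseteq> dual \<tau>"
  by (auto simp: dual_lattice_points_def)

global_interpretation coord: character_span const0 chi "dual \<tau>"
  rewrites "character_span.spanned const0 chi (dual \<tau>) = coord_ring \<tau>"
  for \<tau>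
proof -
  show "character_span const0 chi (dual \<tau>)" for \<tau>
    by unfold_locales (simp_all add: chi_add dual_add)
  then show "character_span.spanned const0 chi (dual \<tau>) = coord_ring \<tau>" for \<tau>
    by (simp add: character_span.spanned_def coord_ring_def)
qed

lemma coord_ring_antimono: "\<tau> \<subseteq> \<tau>' \<Longrightarrow> coord_ring \<tau>' \<subseteq> coord_ring \<tau>"
  unfolding coord_ring_def using dual_antimono[of \<tau> \<tau>'] by blast

text \<open>
  The dual of the empty cone is all of \<open>M\<close>, so this is \<open>\<complex>[M]\<close>.
\<close>

abbreviation laurent_ring :: "K0 set" where
  "laurent_ring \<equiv> coord_ring {}"

lemma dual_empty [simp]: "dual {} = UNIV"
  by (simp add: dual_lattice_points_def)

lemma chi_laurent [simp]: "chi u \<in> laurent_ring"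
  by (rule coord.spanned_char) simp

lemma coord_laurent: "f \<in> coord_ring \<tau> \<Longrightarrow> f \<in> laurent_ring"
  using coord_ring_antimono[of "{}" \<tau>] by blast

text \<open>
  The coefficient of \<open>\<chi>\<^sup>v\<close> in a Laurent polynomial; it is well defined because characters are linearly
  independent.
\<close>

definition coef :: "K0 \<Rightarrow> lattice \<Rightarrow> complex" where
  "coef f v = (THE z. \<exists>U c. finite U \<and> f = (\<Sum>u\<in>U. const0 (c u) * chi u)
                    \<and> z = (if v \<in> U then c v else 0))"

lemma coef_sum:
  assumes "finite U"
  shows "coef (\<Sum>u\<in>U. const0 (c u) * chi u) v = (if v \<in> U then c v else 0)"
  unfolding coef_def
proof (rule the_equality)
  show "\<exists>V d. finite V \<and> (\<Sum>u\<in>U. const0 (c u) * chi u) = (\<Sum>u\<in>V. const0 (d u) * chi u)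
      \<and> (if v \<in> U then c v else 0) = (if v \<in> V then d v else 0)"
    using assms by blast
next
  fix z
  assume "\<exists>V d. finite V \<and> (\<Sum>u\<in>U. const0 (c u) * chi u) = (\<Sum>u\<in>V. const0 (d u) * chi u)
      \<and> z = (if v \<in> V then d v else 0)"
  then obtain V d where V: "finite V" "(\<Sum>u\<in>U. const0 (c u) * chi u) = (\<Sum>u\<in>V. const0 (d u) * chi u)"
    and z: "z = (if v \<in> V then d v else 0)"
    by blast
  define c' d' where "c' u = (if u \<in> U then c u else 0)" and "d' u = (if u \<in> V then d u else 0)" for u
  have "(\<Sum>u\<in>U. const0 (c u) * chi u) = (\<Sum>u\<in>insert v (U \<union> V). const0 (c' u) * chi u)"
    using assms V(1) by (intro sum.mono_neutral_cong_left) (auto simp: c'_def)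
  moreover have "(\<Sum>u\<in>V. const0 (d u) * chi u) = (\<Sum>u\<in>insert v (U \<union> V). const0 (d' u) * chi u)"
    using assms V(1) by (intro sum.mono_neutral_cong_left) (auto simp: d'_def)
  ultimately have "(\<Sum>u\<in>insert v (U \<union> V). const0 (c' u - d' u) * chi u) = 0"
    using V(2) by (simp only: const0_simps left_diff_distrib sum_subtractf) simp
  then have "c' v - d' v = 0"
    by (rule chi_sum_eq_0_imp[rotated]) (use assms V(1) in auto)
  then show "z = (if v \<in> U then c v else 0)"
    by (simp add: z c'_def d'_def)
qed

lemma coef_term: "coef (const0 c * chi w) v = (if v = w then c else 0)"
  using coef_sum[of "{w}" "\<lambda>_. c" v] by simp

lemma coef_add:
  assumes "f \<in> laurent_ring" and "g \<in> laurent_ring"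
  shows "coef (f + g) v = coef f v + coef g v"
proof -
  obtain U c d where U: "finite U" "f = (\<Sum>u\<in>U. const0 (c u) * chi u)" "g = (\<Sum>u\<in>U. const0 (d u) * chi u)"
    using coord.spanned_common[OF assms] .
  have "f + g = (\<Sum>u\<in>U. const0 (c u + d u) * chi u)"
    by (simp add: U sum.distrib distrib_right)
  then have "coef (f + g) v = (if v \<in> U then c v + d v else 0)"
    by (simp only: coef_sum[OF U(1)])
  then show ?thesis
    unfolding U(2,3) coef_sum[OF U(1)] by simp
qed

lemma coef_chi_mult:
  assumes "f \<in> laurent_ring"
  shows "coef (chi w * f) v = coef f (v - w)"
proof -
  obtain U c where U: "finite U" "f = (\<Sum>u\<in>U. const0 (c u) * chi u)"
    using assms by (elim coord.spannedE) blast
  have "chi w * f = (\<Sum>u\<in>U. const0 (c u) * chi (u + w))"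
    by (simp add: U(2) sum_distrib_left chi_add ac_simps)
  also have "\<dots> = (\<Sum>u\<in>(\<lambda>u. u + w) ` U. const0 (c (u - w)) * chi u)"
    by (subst sum.reindex) (auto simp: inj_on_def)
  finally have "coef (chi w * f) v = (if v \<in> (\<lambda>u. u + w) ` U then c (v - w) else 0)"
    using U(1) by (simp only: coef_sum finite_imageI)
  moreover have "v \<in> (\<lambda>u. u + w) ` U \<longleftrightarrow> v - w \<in> U"
  proof
    assume "v - w \<in> U"
    then have "v - w + w \<in> (\<lambda>u. u + w) ` U" by blast
    then show "v \<in> (\<lambda>u. u + w) ` U" by simp
  qed auto
  ultimately show ?thesis
    using U(1) by (simp add: coef_sum U(2))
qed

lemma coef_nonzero_imp_dual:
  assumes "f \<in> coord_ring \<tau>" and "coef f v \<noteq> 0"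
  shows "v \<in> dual \<tau>"
proof -
  obtain U c where U: "finite U" "U \<subseteq> dual \<tau>" "f = (\<Sum>u\<in>U. const0 (c u) * chi u)"
    using assms(1) by (elim coord.spannedE) blast
  then show ?thesis
    using assms(2) by (auto simp: coef_sum split: if_splits)
qed

section \<open>Vector fields and their homogeneous components\<close>

lemma vector_fieldsI:
  assumes D: "is_derivation D" and "\<And>w. w \<in> dual \<tau> \<Longrightarrow> D (chi w) \<in> coord_ring \<tau>"
  shows "D \<in> vector_fields \<tau>"
proof -
  have "D f \<in> coord_ring \<tau>" if f: "f \<in> coord_ring \<tau>" for f
  proof -
    obtain U c where U: "finite U" "U \<subseteq> dual \<tau>" "f = (\<Sum>u\<in>U. const0 (c u) * chi u)"
      using f by (elim coord.spannedE) blast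
    have "D f = (\<Sum>u\<in>U. const0 (c u) * D (chi u))"
      by (simp add: U(3) derivation_sum[OF D] derivation_const_mult[OF D])
    also have "\<dots> \<in> coord_ring \<tau>"
      using U(2) assms(2) by (intro coord.spanned_sum coord.spanned_mult coord.spanned_const) auto
    finally show ?thesis .
  qed
  then show ?thesis
    using D unfolding vector_fields_def by blast
qed

lemma vector_fieldsD: "D \<in> vector_fields \<tau> \<Longrightarrow> is_derivation D"
  "D \<in> vector_fields \<tau> \<Longrightarrow> f \<in> coord_ring \<tau> \<Longrightarrow> D f \<in> coord_ring \<tau>"
  unfolding vector_fields_def by blast+

lemma vector_fields_0: "(\<lambda>f. 0) \<in> vector_fields \<tau>"
  by (rule vector_fieldsI) (simp_all add: derivation_zero)

lemma vector_fields_add: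
  assumes "D \<in> vector_fields \<tau>" and "E \<in> vector_fields \<tau>"
  shows "(\<lambda>f. D f + E f) \<in> vector_fields \<tau>"
  using assms by (auto simp: vector_fields_def derivation_plus intro!: coord.spanned_add)

lemma vector_fields_diff:
  assumes "D \<in> vector_fields \<tau>" and "E \<in> vector_fields \<tau>"
  shows "(\<lambda>f. D f - E f) \<in> vector_fields \<tau>"
  using assms by (auto simp: vector_fields_def derivation_minus_fun intro!: coord.spanned_diff)

lemma vector_fields_smult:
  assumes "D \<in> vector_fields \<tau>"
  shows "(\<lambda>f. const0 c * D f) \<in> vector_fields \<tau>"
  using assms
  by (auto simp: vector_fields_def derivation_scale intro!: coord.spanned_mult coord.spanned_const)

text \<open>
  The field maps \<open>\<chi>\<^sup>w\<close> to a multiple of \<open>\<chi>\<^sup>w\<^sup>+\<^sup>u\<close>, so it preserves the coordinate ring if and only if each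
  \<open>\<chi>\<^sup>w\<^sup>+\<^sup>u\<close> that occurs with nonzero coefficient lies in the ring.
\<close>

lemma vf_in_vector_fields_iff:
  "vf u n \<in> vector_fields \<tau> \<longleftrightarrow>
     (\<forall>w\<in>dual \<tau>. cpair n w = 0 \<or> w + u \<in> dual \<tau>)"
proof
  assume *: "vf u n \<in> vector_fields \<tau>"
  show "\<forall>w\<in>dual \<tau>. cpair n w = 0 \<or> w + u \<in> dual \<tau>"
  proof
    fix w assume "w \<in> dual \<tau>"
    then have "const0 (cpair n w) * chi (w + u) \<in> coord_ring \<tau>"
      using vector_fieldsD(2)[OF * coord.spanned_char] by (simp add: vf_chi)
    from coef_nonzero_imp_dual[OF this, of "w + u"]
    show "cpair n w = 0 \<or> w + u \<in> dual \<tau>"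
      by (auto simp: coef_term)
  qed
next
  assume *: "\<forall>w\<in>dual \<tau>. cpair n w = 0 \<or> w + u \<in> dual \<tau>"
  show "vf u n \<in> vector_fields \<tau>"
  proof (rule vector_fieldsI[OF derivation_vf])
    fix w assume "w \<in> dual \<tau>"
    then show "vf u n (chi w) \<in> coord_ring \<tau>"
      using * by (cases "cpair n w = 0") (auto simp: vf_chi intro: coord.spanned_term)
  qed
qed

lemma additive_eq_cpair:
  fixes N :: "lattice \<Rightarrow> complex"
  assumes add: "\<And>v w. N (v + w) = N v + N w"
  shows "N w = cpair (N (1, 0), N (0, 1)) w"
proof -
  have N0: "N 0 = 0"
    using add[of 0 0] by simp
  have Nm: "N (- v) = - N v" for v
    using add[of v "- v"] N0 by (simp add: eq_neg_iff_add_eq_0 add.commute)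
  have nat: "N (lscale (int j) v) = of_nat j * N v" for j v
  proof (induction j)
    case 0
    then show ?case by (simp add: lscale_def N0 flip: zero_prod_def)
  next
    case (Suc j)
    have "lscale (int (Suc j)) v = v + lscale (int j) v"
      by (simp add: prod_eq_iff algebra_simps)
    then show ?case using Suc by (simp add: add algebra_simps)
  qed
  have int: "N (lscale j v) = of_int j * N v" for j v
  proof (cases j rule: int_cases2)
    case (nonpos i)
    have "lscale j v = - lscale (int i) v"
      by (simp add: nonpos prod_eq_iff)
    then show ?thesis by (simp add: Nm nat nonpos)
  qed (simp add: nat)
  have "w = lscale (fst w) (1, 0) + lscale (snd w) (0, 1)"
    by (simp add: prod_eq_iff)
  then have "N w = N (lscale (fst w) (1, 0)) + N (lscale (snd w) (0, 1))"
    by (metis add)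
  then show ?thesis
    by (simp add: int cpair_def mult.commute)
qed

text \<open>
  If every lattice point is a difference of points of the dual cone, then every character is a quotient of characters in
  the coordinate ring, and the quotient rule has only characters in its denominators.
\<close>

lemma vector_field_laurent:
  assumes D: "D \<in> vector_fields \<tau>"
    and full: "\<And>v. \<exists>u\<in>dual \<tau>. v + u \<in> dual \<tau>"
  shows "D (chi w) \<in> laurent_ring"
proof -
  note der = vector_fieldsD(1)[OF D]
  obtain u where u: "u \<in> dual \<tau>" "w + u \<in> dual \<tau>"
    using full by blast
  have *: "D (chi u) \<in> laurent_ring" "D (chi (w + u)) \<in> laurent_ring"
    using u by (auto intro!: coord_laurent[OF vector_fieldsD(2)[OF D]] coord.spanned_char)
  have "D (chi (w + u)) = chi w * D (chi u) + chi u * D (chi w)"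
    unfolding chi_add by (rule derivation_mult[OF der])
  then have "D (chi w) = chi (- u) * (D (chi (w + u)) - chi w * D (chi u))"
    by (simp add: chi_minus)
  also have "\<dots> \<in> laurent_ring"
    by (intro coord.spanned_mult coord.spanned_diff chi_laurent *)
  finally show ?thesis .
qed

text \<open>
  The coefficient of \<open>\<chi>\<^sup>w\<^sup>+\<^sup>u\<close> in \<open>D(\<chi>\<^sup>w)\<close> is additive in \<open>w\<close> by the Leibniz rule, hence linear in \<open>w\<close>; it is the
  degree \<open>u\<close> part of \<open>D\<close>. Where it does not vanish, \<open>\<chi>\<^sup>w\<^sup>+\<^sup>u\<close> occurs in \<open>D(\<chi>\<^sup>w)\<close>, so the part is
  regular whenever \<open>D\<close> is. This allows coboundaries to be studied degree by degree.
\<close>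

lemma homogeneous_component:
  assumes D: "D \<in> vector_fields \<tau>"
    and full: "\<And>v. \<exists>u\<in>dual \<tau>. v + u \<in> dual \<tau>"
  obtains n where "vf u n \<in> vector_fields \<tau>" "\<And>w. coef (D (chi w)) (w + u) = cpair n w"
proof -
  define N where "N w = coef (D (chi w)) (w + u)" for w
  note L = vector_field_laurent[OF assms]
  have "N (v + w) = N v + N w" for v w
  proof -
    have "D (chi (v + w)) = chi v * D (chi w) + chi w * D (chi v)"
      unfolding chi_add by (rule derivation_mult[OF vector_fieldsD(1)[OF D]])
    then show ?thesis
      unfolding N_def
      by (simp add: coef_add coef_chi_mult L coord.spanned_mult algebra_simps)
  qed
  from additive_eq_cpair[OF this]
  have N: "N w = cpair (N (1, 0), N (0, 1)) w" for w .
  have "vf u (N (1, 0), N (0, 1)) \<in> vector_fields \<tau>"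
    unfolding vf_in_vector_fields_iff
  proof
    fix w assume w: "w \<in> dual \<tau>"
    then have "D (chi w) \<in> coord_ring \<tau>"
      by (intro vector_fieldsD(2)[OF D] coord.spanned_char)
    then have "N w \<noteq> 0 \<Longrightarrow> w + u \<in> dual \<tau>"
      unfolding N_def by (rule coef_nonzero_imp_dual)
    then show "cpair (N (1, 0), N (0, 1)) w = 0 \<or> w + u \<in> dual \<tau>"
      using N[of w] by auto
  qed
  then show ?thesis
    using that N unfolding N_def by blast
qed

section \<open>Expansion to first order in the deformation parameter\<close>

lemma incl_simps [simp]:
  "incl 0 = 0" "incl 1 = 1"
  "incl (f + g) = incl f + incl g" "incl (f * g) = incl f * incl g"
  "incl (- f) = - incl f" "incl (f - g) = incl f - incl g"
  by (simp_all add: incl_def fract_collapse mult.commute flip: one_pCons)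

lemma incl_eq_0_iff [simp]: "incl f = 0 \<longleftrightarrow> f = 0"
  by (simp add: incl_def Zero_fract_def eq_fract)

lemma incl_inverse: "incl (inverse f) = inverse (incl f)"
proof (cases "f = 0")
  case False
  then have "incl (inverse f) * incl f = 1"
    by (simp flip: incl_simps)
  then show ?thesis
    using False by (simp add: field_simps)
qed simp

lemma incl_divide: "incl (f / g) = incl f / incl g"
  by (simp add: divide_inverse incl_inverse)

lemma incl_power_int: "incl (f powi n) = incl f powi n"
proof -
  have "incl (g ^ j) = incl g ^ j" for g j
    by (induction j) simp_all
  then show ?thesis
    by (simp add: power_int_def incl_inverse)
qed

lemma tvar_nonzero [simp]: "tvar \<noteq> 0"
proof -
  have "tvar \<noteq> Fract 0 1"
    unfolding tvar_def by (simp add: eq_fract)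
  then show ?thesis by (simp add: fract_collapse)
qed

lemma dual_number_simps [simp]:
  "Dual a b + Dual c d = Dual (a + c) (b + d)"
  "Dual a b - Dual c d = Dual (a - c) (b - d)"
  "- Dual a b = Dual (- a) (- b)"
  "Dual a b * Dual c d = Dual (a * c) (a * d + b * c)"
  by (simp_all add: plus_dual_number_def minus_dual_number_def uminus_dual_number_def
      times_dual_number_def)

lemma dual_number_0: "0 = Dual 0 0" and dual_number_1: "1 = Dual 1 0"
  by (simp_all add: zero_dual_number_def one_dual_number_def)

text \<open>
  Dual numbers with nonzero constant term are units.
\<close>

lemma dual_number_cancel:
  fixes z w u :: "'a::field dual_number"
  assumes "z * u = w * u" and "dual_fst u \<noteq> 0"
  shows "z = w"
proof -
  obtain a b c d e f where "z = Dual a b" "w = Dual c d" "u = Dual e f"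
    by (meson dual_number.exhaust)
  then show ?thesis using assms by auto
qed

text \<open>
  Reduction of a polynomial in \<open>t\<close> modulo \<open>t\<^sup>2\<close>.
\<close>

definition jet :: "K0 poly \<Rightarrow> K0 dual_number" where
  "jet p = Dual (coeff p 0) (coeff p 1)"

lemma jet_add: "jet (p + q) = jet p + jet q" and jet_mult: "jet (p * q) = jet p * jet q"
  and jet_const: "jet [:a:] = Dual a 0" and jet_1: "jet 1 = 1"
  and jet_var: "jet [:0, 1:] = Dual 0 1"
  by (simp_all add: jet_def coeff_mult dual_number_1)

text \<open>
  The expansion of \<open>f\<close> modulo \<open>t\<^sup>2\<close> is \<open>z\<close>. Clearing the denominator avoids inverses of dual numbers.
\<close>

definition first_order :: "K \<Rightarrow> K0 dual_number \<Rightarrow> bool" where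
  "first_order f z \<longleftrightarrow> (\<exists>p q. poly q 0 \<noteq> 0 \<and> f = Fract p q \<and> z * jet q = jet p)"

lemma first_order_unique:
  assumes "first_order f z" and "first_order f w"
  shows "z = w"
proof -
  obtain p q p' q' where q: "poly q 0 \<noteq> 0" "f = Fract p q" "z * jet q = jet p"
    and q': "poly q' 0 \<noteq> 0" "f = Fract p' q'" "w * jet q' = jet p'"
    using assms unfolding first_order_def by blast
  then have "q \<noteq> 0" "q' \<noteq> 0" by auto
  then have "p * q' = p' * q"
    using q(2) q'(2) by (simp add: eq_fract)
  then have "jet p * jet q' = jet p' * jet q"
    by (simp flip: jet_mult)
  then have "z * (jet q * jet q') = w * (jet q * jet q')"
    by (simp flip: q(3) q'(3)) (simp add: ac_simps)
  moreover have "dual_fst (jet q * jet q') \<noteq> 0"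
    using q(1) q'(1) by (simp add: jet_def poly_0_coeff_0)
  ultimately show ?thesis
    by (rule dual_number_cancel)
qed

lemma first_order_add:
  assumes "first_order f z" and "first_order g w"
  shows "first_order (f + g) (z + w)"
proof -
  obtain p q p' q' where q: "poly q 0 \<noteq> 0" "f = Fract p q" "z * jet q = jet p"
    and q': "poly q' 0 \<noteq> 0" "g = Fract p' q'" "w * jet q' = jet p'"
    using assms unfolding first_order_def by blast
  then have "q \<noteq> 0" "q' \<noteq> 0" by auto
  then have "f + g = Fract (p * q' + p' * q) (q * q')"
    by (simp add: q(2) q'(2))
  moreover have "(z + w) * jet (q * q') = jet (p * q' + p' * q)"
    by (simp add: jet_add jet_mult flip: q(3) q'(3)) (simp add: algebra_simps)
  moreover have "poly (q * q') 0 \<noteq> 0"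
    using q(1) q'(1) by simp
  ultimately show ?thesis
    unfolding first_order_def by blast
qed

lemma first_order_mult:
  assumes "first_order f z" and "first_order g w"
  shows "first_order (f * g) (z * w)"
proof -
  obtain p q p' q' where q: "poly q 0 \<noteq> 0" "f = Fract p q" "z * jet q = jet p"
    and q': "poly q' 0 \<noteq> 0" "g = Fract p' q'" "w * jet q' = jet p'"
    using assms unfolding first_order_def by blast
  have "f * g = Fract (p * p') (q * q')"
    by (simp add: q(2) q'(2))
  moreover have "(z * w) * jet (q * q') = jet (p * p')"
    by (simp add: jet_mult ac_simps flip: q(3) q'(3))
  moreover have "poly (q * q') 0 \<noteq> 0"
    using q(1) q'(1) by simp
  ultimately show ?thesis
    unfolding first_order_def by blast
qed

lemma first_order_incl: "first_order (incl a) (Dual a 0)"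
  unfolding first_order_def incl_def
  by (intro exI[of _ "[:a:]"] exI[of _ 1]) (simp add: jet_const jet_1)

lemma first_order_1: "first_order 1 1"
  using first_order_incl[of 1] by (simp add: dual_number_1)

lemma first_order_tvar: "first_order tvar (Dual 0 1)"
  unfolding first_order_def tvar_def
  by (intro exI[of _ "[:0, 1:]"] exI[of _ 1]) (simp add: jet_var jet_1)

lemma first_order_inverse:
  assumes "first_order f z" and "z * w = 1"
  shows "first_order (inverse f) w"
proof -
  obtain p q where q: "poly q 0 \<noteq> 0" "f = Fract p q" "z * jet q = jet p"
    using assms(1) unfolding first_order_def by blast
  have "w * jet p = jet q"
    using assms(2) by (simp flip: q(3)) (metis mult.assoc mult.commute mult_1)
  moreover from this have "poly p 0 \<noteq> 0"
    using q(1) by (auto simp: jet_def times_dual_number_def poly_0_coeff_0)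
  moreover have "inverse f = Fract q p"
    by (simp add: q(2))
  ultimately show ?thesis
    unfolding first_order_def by blast
qed

lemma first_order_imp_value_at_0:
  assumes "first_order f z"
  shows "value_at_0 f (dual_fst z)"
proof -
  obtain p q where q: "poly q 0 \<noteq> 0" "f = Fract p q" "z * jet q = jet p"
    using assms unfolding first_order_def by blast
  have "dual_fst z = poly p 0 / poly q 0"
    using arg_cong[OF q(3), of dual_fst] q(1)
    by (simp add: jet_def times_dual_number_def poly_0_coeff_0 field_simps)
  then show ?thesis
    using q unfolding value_at_0_def by blast
qed

lemma value_at_0_unique:
  assumes "value_at_0 f a" and "value_at_0 f b"
  shows "a = b"
proof -
  obtain p q p' q' where q: "poly q 0 \<noteq> 0" "f = Fract p q" "a = poly p 0 / poly q 0"
    and q': "poly q' 0 \<noteq> 0" "f = Fract p' q'" "b = poly p' 0 / poly q' 0"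
    using assms unfolding value_at_0_def by blast
  then have "q \<noteq> 0" "q' \<noteq> 0" by auto
  then have "p * q' = p' * q"
    using q(2) q'(2) by (simp add: eq_fract)
  then have "poly p 0 * poly q' 0 = poly p' 0 * poly q 0"
    by (metis poly_mult)
  then show ?thesis
    using q q' by (simp add: frac_eq_eq)
qed

lemma id_plus_t_Dual [simp]: "id_plus_t d (Dual a b) = Dual a (b + d a)"
  by (simp add: id_plus_t_def)

lemma id_plus_t_add: "is_derivation d \<Longrightarrow> id_plus_t d (z + w) = id_plus_t d z + id_plus_t d w"
  by (cases z; cases w) (simp add: derivation_add)

lemma id_plus_t_mult: "is_derivation d \<Longrightarrow> id_plus_t d (z * w) = id_plus_t d z * id_plus_t d w"
  by (cases z; cases w) (simp add: derivation_mult algebra_simps)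

lemma id_plus_t_1: "is_derivation d \<Longrightarrow> id_plus_t d 1 = 1"
  by (simp add: dual_number_1)

lemma id_plus_t_comp: "id_plus_t d (id_plus_t e z) = id_plus_t (\<lambda>f. e f + d f) z"
  by (cases z) (simp add: add.assoc)

lemma id_plus_t_zero: "id_plus_t (\<lambda>f. 0) z = z"
  by (cases z) simp

lemma dual_fst_id_plus_t [simp]: "dual_fst (id_plus_t d z) = dual_fst z"
  by (simp add: id_plus_t_def)

definition regular :: "K \<Rightarrow> bool" where
  "regular f \<longleftrightarrow> (\<exists>z. first_order f z)"

text \<open>
  Expansion modulo \<open>t\<^sup>2\<close> followed by the infinitesimal automorphism \<open>1 + t d\<close>. All trivializations that are
  constructed below have this form.
\<close>

definition taylor :: "(K0 \<Rightarrow> K0) \<Rightarrow> K \<Rightarrow> K0 dual_number" where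
  "taylor d f = id_plus_t d (THE z. first_order f z)"

lemma taylor_eq: "first_order f z \<Longrightarrow> taylor d f = id_plus_t d z"
  unfolding taylor_def using first_order_unique by (metis the_equality)

lemma regular_add: "regular f \<Longrightarrow> regular g \<Longrightarrow> regular (f + g)"
  and regular_mult: "regular f \<Longrightarrow> regular g \<Longrightarrow> regular (f * g)"
  and regular_incl: "regular (incl a)" and regular_tvar: "regular tvar"
  unfolding regular_def
  using first_order_add first_order_mult first_order_incl first_order_tvar by blast+

lemma taylor_hom:
  assumes "is_derivation d" and "regular f" and "regular g"
  shows "taylor d (f + g) = taylor d f + taylor d g"
    and "taylor d (f * g) = taylor d f * taylor d g"
proof -
  obtain z w where *: "first_order f z" "first_order g w"
    using assms unfolding regular_def by blast
  show "taylor d (f + g) = taylor d f + taylor d g"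
    using taylor_eq[OF first_order_add[OF *]] by (simp add: taylor_eq[OF *(1)] taylor_eq[OF *(2)] id_plus_t_add assms)
  show "taylor d (f * g) = taylor d f * taylor d g"
    using taylor_eq[OF first_order_mult[OF *]] by (simp add: taylor_eq[OF *(1)] taylor_eq[OF *(2)] id_plus_t_mult assms)
qed

lemma taylor_incl: "taylor d (incl a) = Dual a (d a)"
  by (simp add: taylor_eq[OF first_order_incl])

lemma taylor_tvar: "is_derivation d \<Longrightarrow> taylor d tvar = Dual 0 1"
  by (simp add: taylor_eq[OF first_order_tvar])

section \<open>Algebras over the constants and their localizations\<close>

lemma adjoin_0 [simp]: "0 \<in> adjoin G" and adjoin_1 [simp]: "1 \<in> adjoin G"
  using adjoin.const[of 0 G] adjoin.const[of 1 G] by simp_all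

lemma adjoin_minus: "f \<in> adjoin G \<Longrightarrow> - f \<in> adjoin G"
  using adjoin.mult[OF adjoin.const[of "- 1"], of f G] by simp

lemma adjoin_diff: "f \<in> adjoin G \<Longrightarrow> g \<in> adjoin G \<Longrightarrow> f - g \<in> adjoin G"
  using adjoin.add[of f G "- g"] by (simp add: adjoin_minus)

lemma adjoin_power: "f \<in> adjoin G \<Longrightarrow> f ^ n \<in> adjoin G"
  by (induction n) (simp_all add: adjoin.mult)

lemma adjoin_sum: "(\<And>x. x \<in> X \<Longrightarrow> f x \<in> adjoin G) \<Longrightarrow> (\<Sum>x\<in>X. f x) \<in> adjoin G"
  by (induction X rule: infinite_finite_induct) (simp_all add: adjoin.add)

lemma adjoin_power_int:
  "f \<in> adjoin G \<Longrightarrow> inverse f \<in> adjoin G \<Longrightarrow> f powi n \<in> adjoin G"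
  by (simp add: power_int_def adjoin_power)

lemma adjoin_subset:
  assumes "G \<subseteq> adjoin H"
  shows "adjoin G \<subseteq> adjoin H"
proof
  fix f assume "f \<in> adjoin G"
  then show "f \<in> adjoin H"
    by induction (use assms in \<open>auto intro: adjoin.intros\<close>)
qed

lemma adjoin_eqI: "G \<subseteq> adjoin H \<Longrightarrow> H \<subseteq> adjoin G \<Longrightarrow> adjoin G = adjoin H"
  using adjoin_subset by blast

text \<open>
  The fractions \<open>f / h\<^sup>n\<close> form a ring, so it suffices to represent the generators by such fractions.
\<close>

lemma adjoin_localization_eq:
  assumes h: "h \<in> adjoin G" "h \<noteq> 0" and "G \<subseteq> adjoin H" and inv: "inverse h \<in> adjoin H"
    and gen: "\<And>x. x \<in> H \<Longrightarrow> \<exists>f\<in>adjoin G. \<exists>n. x = f / h ^ n"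
  shows "adjoin H = {f / h ^ n | f n. f \<in> adjoin G}"
proof (intro equalityI subsetI)
  fix x assume "x \<in> adjoin H"
  then show "x \<in> {f / h ^ n | f n. f \<in> adjoin G}"
  proof induction
    case (const c)
    have "incl (const0 c) = incl (const0 c) / h ^ 0" by simp
    then show ?case using adjoin.const by blast
  next
    case (gen x)
    then show ?case using assms(5) by blast
  next
    case (add x y)
    then obtain f n f' n' where *: "x = f / h ^ n" "f \<in> adjoin G" "y = f' / h ^ n'" "f' \<in> adjoin G"
      by blast
    then have "x + y = (f * h ^ n' + f' * h ^ n) / h ^ (n + n')"
      using h(2) by (simp add: add_divide_distrib power_add)
    then show ?case
      using * h(1) by (blast intro: adjoin.intros adjoin_power)
  next
    case (mult x y)
    then obtain f n f' n' where *: "x = f / h ^ n" "f \<in> adjoin G" "y = f' / h ^ n'" "f' \<in> adjoin G"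
      by blast
    then have "x * y = (f * f') / h ^ (n + n')"
      by (simp add: power_add)
    then show ?case
      using * by (blast intro: adjoin.intros)
  qed
next
  fix x assume "x \<in> {f / h ^ n | f n. f \<in> adjoin G}"
  then obtain f n where x: "x = f / h ^ n" "f \<in> adjoin G" by blast
  have "f * inverse h ^ n \<in> adjoin H"
    using x(2) adjoin_subset[OF assms(3)] inv by (intro adjoin.mult adjoin_power) auto
  then show "x \<in> adjoin H"
    by (simp add: x(1) divide_inverse power_inverse)
qed

lemma is_localization_adjoinI:
  assumes "h \<in> adjoin G" "h \<noteq> 0" and "G \<subseteq> adjoin H" and "inverse h \<in> adjoin H"
    and "\<And>x. x \<in> H \<Longrightarrow> \<exists>f\<in>adjoin G. \<exists>n. x = f / h ^ n"
  shows "is_localization (adjoin H) (adjoin G)"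
  using adjoin_localization_eq[OF assms] assms(1,2) unfolding is_localization_def by blast

lemma is_localization_trans:
  assumes "is_localization B (adjoin G)" and "is_localization C B"
  shows "is_localization C (adjoin G)"
proof -
  let ?A = "adjoin G"
  obtain s where s: "s \<in> ?A" "s \<noteq> 0" "B = {f / s ^ n | f n. f \<in> ?A}"
    using assms(1) unfolding is_localization_def by blast
  obtain b where b: "b \<in> B" "b \<noteq> 0" "C = {f / b ^ n | f n. f \<in> B}"
    using assms(2) unfolding is_localization_def by blast
  obtain a k where a: "b = a / s ^ k" "a \<in> ?A"
    using b(1) s(3) by blast
  have a0: "a \<noteq> 0" using b(2) a(1) by auto
  have "C = {f / (s * a) ^ n | f n. f \<in> ?A}"
  proof (intro equalityI subsetI)
    fix x assume "x \<in> C"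
    then obtain f m n where x: "f \<in> ?A" "x = (f / s ^ m) / b ^ n"
      using b(3) s(3) by blast
    have "x = (f * s ^ (k * n) * s ^ n * a ^ m) / (s * a) ^ (m + n)"
      using s(2) a0 by (simp add: x(2) a(1) field_simps power_add power_mult power_mult_distrib)
    then show "x \<in> {f / (s * a) ^ n | f n. f \<in> ?A}"
      using x(1) s(1) a(2) by (blast intro: adjoin.mult adjoin_power)
  next
    fix x assume "x \<in> {f / (s * a) ^ n | f n. f \<in> ?A}"
    then obtain f n where x: "f \<in> ?A" "x = f / (s * a) ^ n" by blast
    have "x = (f / s ^ (n + k * n)) / b ^ n"
      using s(2) a0 by (simp add: x(2) a(1) field_simps power_add power_mult power_mult_distrib)
    then show "x \<in> C"
      using x(1) b(3) s(3) by blast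
  qed
  moreover have "s * a \<in> ?A" "s * a \<noteq> 0"
    using s a(2) a0 by (auto intro: adjoin.mult)
  ultimately show ?thesis
    unfolding is_localization_def by blast
qed

section \<open>Trivializations over the dual numbers\<close>

abbreviation duals :: "'a set \<Rightarrow> 'a dual_number set" where
  "duals A \<equiv> {Dual a b | a b. a \<in> A \<and> b \<in> A}"

lemma regular_adjoin:
  assumes "\<And>g. g \<in> G \<Longrightarrow> regular g" and "f \<in> adjoin G"
  shows "regular f"
  using assms(2) by induction (auto intro: assms(1) regular_incl regular_add regular_mult)

text \<open>
  An expansion is multiplicative, fixes constants and \<open>t\<close>, and has the value at \<open>t = 0\<close> as constant term; it
  kills the multiples of \<open>t\<^sup>2\<close>. Only the image and the converse for the kernel depend on the ring.
\<close>

lemma trivialization_taylorI: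
  assumes d: "is_derivation d" and t: "tvar \<in> adjoin G" and reg: "\<And>f. f \<in> G \<Longrightarrow> regular f"
    and into: "\<And>f. f \<in> adjoin G \<Longrightarrow> taylor d f \<in> duals A"
    and onto: "\<And>a b. a \<in> A \<Longrightarrow> b \<in> A \<Longrightarrow> Dual a b \<in> taylor d ` adjoin G"
    and kernel: "\<And>f. f \<in> adjoin G \<Longrightarrow> taylor d f = 0 \<Longrightarrow> \<exists>g\<in>adjoin G. f = tvar ^ 2 * g"
  shows "trivialization (adjoin G) A (taylor d)"
proof -
  have regular: "regular f" if "f \<in> adjoin G" for f
    using reg that by (rule regular_adjoin)
  have t2: "tvar ^ 2 * f \<in> adjoin G \<and> taylor d (tvar ^ 2 * f) = 0" if f: "f \<in> adjoin G" for f
  proof -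
    obtain a b where "taylor d f = Dual a b"
      using dual_number.exhaust by blast
    then show ?thesis
      using t f regular[OF f] d
      by (simp add: adjoin.mult adjoin_power power2_eq_square taylor_hom regular_mult regular_tvar
          taylor_tvar dual_number_0)
  qed
  show ?thesis
    unfolding trivialization_def
  proof (intro conjI ballI allI)
    fix f assume "f \<in> adjoin G"
    then obtain z where "first_order f z"
      using regular unfolding regular_def by blast
    then show "value_at_0 f (dual_fst (taylor d f))"
      using first_order_imp_value_at_0 taylor_eq by fastforce
  next
    show "taylor d ` adjoin G = duals A"
      using into onto by blast
    show "{f \<in> adjoin G. taylor d f = 0} = {tvar ^ 2 * f | f. f \<in> adjoin G}"
      using t2 kernel by blast
  qed (use d regular in \<open>auto simp: taylor_hom taylor_incl taylor_tvar derivation_const\<close>)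
qed

lemma taylor_power:
  assumes "is_derivation d" and "regular f"
  shows "taylor d (f ^ n) = taylor d f ^ n" and "regular (f ^ n)"
proof -
  have "regular (f ^ n) \<and> taylor d (f ^ n) = taylor d f ^ n"
    using regular_incl[of 1] taylor_incl[of d 1] assms
    by (induction n) (simp_all add: regular_mult taylor_hom dual_number_1)
  then show "taylor d (f ^ n) = taylor d f ^ n" "regular (f ^ n)" by auto
qed

text \<open>
  Modulo \<open>t\<^sup>2\<close>, the ring generated by \<open>t\<close> and a multiplicative family \<open>\<phi>\<close> consists of the \<open>p + t q\<close> with \<open>p, q\<close>
  in the span of \<open>\<phi>\<close>. If the expansion maps each \<open>\<phi> u\<close> to the character of \<open>u\<close>, without a term in \<open>t\<close>, then
  \<open>p\<close> and \<open>q\<close> can be read off from the image of \<open>p + t q\<close>, because characters are linearly independent.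
\<close>

lemma trivialization_characters:
  assumes d: "is_derivation d"
    and \<phi>_0: "\<phi> 0 = 1" and \<phi>_add: "\<And>u v. \<phi> (u + v) = \<phi> u * \<phi> v"
    and reg: "\<And>u. u \<in> dual \<tau> \<Longrightarrow> regular (\<phi> u)"
    and \<phi>: "\<And>u. u \<in> dual \<tau> \<Longrightarrow> taylor d (\<phi> u) = Dual (chi u) 0"
  defines "B \<equiv> adjoin (insert tvar (\<phi> ` dual \<tau>))"
  shows "trivialization B (coord_ring \<tau>) (taylor d)"
proof -
  interpret K: character_span "\<lambda>c. incl (const0 c)" \<phi> "dual \<tau>"
    by unfold_locales (simp_all add: \<phi>_0 \<phi>_add dual_add)
  have regB: "regular f" if "f \<in> B" for f
    using that unfolding B_def
    by (elim regular_adjoin[rotated]) (auto intro: reg regular_tvar)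
  have tB: "tvar \<in> B"
    unfolding B_def by (auto intro: adjoin.gen)
  have termB: "incl (const0 c) * \<phi> u \<in> B" if "u \<in> dual \<tau>" for c u
    using that unfolding B_def by (auto intro: adjoin.intros)
  have KB: "f \<in> B" if "f \<in> K.spanned" for f
    using that termB unfolding B_def by (elim K.spannedE) (auto intro!: adjoin_sum)
  have taylor_sum: "taylor d (\<Sum>u\<in>U. incl (const0 (c u)) * \<phi> u) = Dual (\<Sum>u\<in>U. const0 (c u) * chi u) 0"
    if "finite U" "U \<subseteq> dual \<tau>" for U c
    using that
  proof (induction U rule: finite_induct)
    case empty
    then show ?case using taylor_incl[of d 0] d by simp
  next
    case (insert u U)
    have "regular (\<Sum>u\<in>U. incl (const0 (c u)) * \<phi> u)"
      using insert.prems by (intro regB KB K.spannedI insert.hyps(1)) auto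
    moreover have "regular (incl (const0 (c u)) * \<phi> u)"
      using insert.prems by (intro regB termB) auto
    ultimately show ?case
      using insert d \<phi>[of u] reg[of u]
      by (simp add: taylor_hom regular_incl taylor_incl derivation_const)
  qed
  have decompose: "\<exists>p\<in>K.spanned. \<exists>q\<in>K.spanned. \<exists>g\<in>B. f = p + tvar * q + tvar ^ 2 * g"
    if "f \<in> B" for f
    using that unfolding B_def
  proof induction
    case (const c)
    show ?case
      by (rule bexI[OF _ K.spanned_const], rule bexI[OF _ K.spanned_0], rule bexI[of _ 0]) auto
  next
    case (gen f)
    then consider "f = tvar" | u where "u \<in> dual \<tau>" "f = \<phi> u" by blast
    then show ?case
    proof cases
      case 1
      show ?thesis
        by (rule bexI[OF _ K.spanned_0], rule bexI[OF _ K.spanned_1], rule bexI[of _ 0]) (auto simp: 1)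
    next
      case 2
      show ?thesis
        by (rule bexI[OF _ K.spanned_char[OF 2(1)]], rule bexI[OF _ K.spanned_0], rule bexI[of _ 0])
          (auto simp: 2)
    qed
  next
    case (add f f')
    then obtain p q g p' q' g' where
      f: "f = p + tvar * q + tvar ^ 2 * g" "p \<in> K.spanned" "q \<in> K.spanned" and g: "g \<in> B"
      and f': "f' = p' + tvar * q' + tvar ^ 2 * g'" "p' \<in> K.spanned" "q' \<in> K.spanned" and g': "g' \<in> B"
      unfolding B_def by blast
    have "f + f' = (p + p') + tvar * (q + q') + tvar ^ 2 * (g + g')"
      by (simp add: f(1) f'(1) algebra_simps)
    moreover have "g + g' \<in> B" using g g' unfolding B_def by (rule adjoin.add)
    ultimately show ?case
      using K.spanned_add[OF f(2) f'(2)] K.spanned_add[OF f(3) f'(3)] unfolding B_def by blast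
  next
    case (mult f f')
    then obtain p q g p' q' g' where
      f: "f = p + tvar * q + tvar ^ 2 * g" "p \<in> K.spanned" "q \<in> K.spanned" and g: "g \<in> B"
      and f': "f' = p' + tvar * q' + tvar ^ 2 * g'" "p' \<in> K.spanned" "q' \<in> K.spanned" and g': "g' \<in> B"
      unfolding B_def by blast
    have "f * f' = p * p' + tvar * (p * q' + q * p') +
        tvar ^ 2 * (q * q' + (p + tvar * q) * g' + g * f')"
      by (simp add: f(1) f'(1) algebra_simps power2_eq_square)
    moreover have "q * q' + (p + tvar * q) * g' + g * f' \<in> B"
      using mult.hyps g g' KB[OF f(2)] KB[OF f(3)] KB[OF f'(3)] tB unfolding B_def
      by (intro adjoin.add adjoin.mult)
    moreover have "p * p' \<in> K.spanned" "p * q' + q * p' \<in> K.spanned"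
      using f f' by (auto intro: K.spanned_add K.spanned_mult)
    ultimately show ?case
      unfolding B_def by blast
  qed
  have expand: "\<exists>U c V e g. finite U \<and> U \<subseteq> dual \<tau> \<and> finite V \<and> V \<subseteq> dual \<tau> \<and> g \<in> B \<and>
      f = (\<Sum>u\<in>U. incl (const0 (c u)) * \<phi> u) + tvar * (\<Sum>u\<in>V. incl (const0 (e u)) * \<phi> u) + tvar ^ 2 * g \<and>
      taylor d f = Dual (\<Sum>u\<in>U. const0 (c u) * chi u) (\<Sum>u\<in>V. const0 (e u) * chi u)"
    if f: "f \<in> B" for f
  proof -
    obtain p q g where pqg: "p \<in> K.spanned" "q \<in> K.spanned" "g \<in> B" "f = p + tvar * q + tvar ^ 2 * g"
      using decompose[OF f] by blast
    obtain U c where U: "finite U" "U \<subseteq> dual \<tau>" "p = (\<Sum>u\<in>U. incl (const0 (c u)) * \<phi> u)"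
      using pqg(1) by (elim K.spannedE) blast
    obtain V e where V: "finite V" "V \<subseteq> dual \<tau>" "q = (\<Sum>u\<in>V. incl (const0 (e u)) * \<phi> u)"
      using pqg(2) by (elim K.spannedE) blast
    obtain a b where ab: "taylor d g = Dual a b"
      using dual_number.exhaust by blast
    have "taylor d f = taylor d p + taylor d tvar * taylor d q + taylor d tvar ^ 2 * taylor d g"
      using regB[OF KB[OF pqg(1)]] regB[OF KB[OF pqg(2)]] regB[OF pqg(3)] d
      by (simp add: pqg(4) taylor_hom regular_add regular_mult regular_tvar power2_eq_square)
    then have "taylor d f = Dual (\<Sum>u\<in>U. const0 (c u) * chi u) (\<Sum>u\<in>V. const0 (e u) * chi u)"
      by (simp add: U V taylor_sum taylor_tvar[OF d] ab power2_eq_square)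
    then show ?thesis
      using U V pqg by blast
  qed
  show ?thesis
    unfolding B_def
  proof (rule trivialization_taylorI[OF d], fold B_def)
    show "tvar \<in> B" by (rule tB)
    show "regular f" if "f \<in> insert tvar (\<phi> ` dual \<tau>)" for f
      using that reg regular_tvar by auto
    show "taylor d f \<in> duals (coord_ring \<tau>)" if "f \<in> B" for f
      using expand[OF that] coord.spannedI by fastforce
    show "Dual a b \<in> taylor d ` B" if ab: "a \<in> coord_ring \<tau>" "b \<in> coord_ring \<tau>" for a b
    proof -
      obtain U c where U: "finite U" "U \<subseteq> dual \<tau>" "a = (\<Sum>u\<in>U. const0 (c u) * chi u)"
        using ab(1) by (elim coord.spannedE) blast
      obtain V e where V: "finite V" "V \<subseteq> dual \<tau>" "b = (\<Sum>u\<in>V. const0 (e u) * chi u)"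
        using ab(2) by (elim coord.spannedE) blast
      let ?p = "\<Sum>u\<in>U. incl (const0 (c u)) * \<phi> u" and ?q = "\<Sum>u\<in>V. incl (const0 (e u)) * \<phi> u"
      have B: "?p \<in> B" "?q \<in> B"
        using U V by (auto intro!: KB K.spannedI)
      then have "?p + tvar * ?q \<in> B"
        using tB unfolding B_def by (intro adjoin.add adjoin.mult)
      moreover have "Dual a b = taylor d (?p + tvar * ?q)"
        using regB[OF B(1)] regB[OF B(2)] d
        by (simp add: taylor_hom regular_mult regular_tvar taylor_sum U V taylor_tvar)
      ultimately show ?thesis by blast
    qed
    show "\<exists>g\<in>B. f = tvar ^ 2 * g" if f: "f \<in> B" "taylor d f = 0" for f
    proof -
      obtain U c V e g where U: "finite U" and V: "finite V" and g: "g \<in> B"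
        and feq: "f = (\<Sum>u\<in>U. incl (const0 (c u)) * \<phi> u) + tvar * (\<Sum>u\<in>V. incl (const0 (e u)) * \<phi> u) + tvar ^ 2 * g"
        and tf: "taylor d f = Dual (\<Sum>u\<in>U. const0 (c u) * chi u) (\<Sum>u\<in>V. const0 (e u) * chi u)"
        using expand[OF f(1)] by blast
      have "(\<Sum>u\<in>U. const0 (c u) * chi u) = 0" "(\<Sum>u\<in>V. const0 (e u) * chi u) = 0"
        using tf f(2) by (simp_all add: dual_number_0)
      then have "\<forall>u\<in>U. c u = 0" "\<forall>u\<in>V. e u = 0"
        using chi_sum_eq_0_imp U V by blast+
      then have "f = tvar ^ 2 * g"
        by (simp add: feq)
      then show ?thesis using g by blast
    qed
  qed
qed

lemma dual_number_power_one: "Dual 1 c ^ n = Dual 1 (of_nat n * c)"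
  for c :: "'a::comm_ring_1"
  by (induction n) (simp_all add: dual_number_1 algebra_simps)

text \<open>
  Inverting an element \<open>g\<close> that is 1 at \<open>t = 0\<close> changes nothing modulo \<open>t\<^sup>2\<close>, where \<open>g\<close> is already a unit.
\<close>

lemma trivialization_localize:
  assumes triv: "trivialization (adjoin G) (coord_ring \<tau>) (taylor d)"
    and d: "is_derivation d" and t: "tvar \<in> adjoin G"
    and regH: "\<And>f. f \<in> H \<Longrightarrow> regular f"
    and g: "g \<in> adjoin G" "g \<noteq> 0" and B: "adjoin H = {f / g ^ n | f n. f \<in> adjoin G}"
    and tg: "taylor d g = Dual 1 c" and c: "c \<in> coord_ring \<tau>"
  shows "trivialization (adjoin H) (coord_ring \<tau>) (taylor d)"
proof -
  have reg: "regular f" if "f \<in> adjoin H" for f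
    using regH that by (rule regular_adjoin)
  have image: "taylor d ` adjoin G = duals (coord_ring \<tau>)"
    and kernel: "{f\<in>adjoin G. taylor d f = 0} = {tvar ^ 2 * f | f. f \<in> adjoin G}"
    using triv unfolding trivialization_def by blast+
  have sub: "adjoin G \<subseteq> adjoin H"
  proof
    fix f assume "f \<in> adjoin G"
    then have "f / g ^ 0 \<in> adjoin H" unfolding B by blast
    then show "f \<in> adjoin H" by simp
  qed
  have quotient: "taylor d f = taylor d (f / g ^ n) * Dual 1 (of_nat n * c)"
    if "f / g ^ n \<in> adjoin H" for f n
  proof -
    have gH: "regular g" using reg sub g(1) by blast
    have "f = (f / g ^ n) * g ^ n" using g(2) by simp
    then have "taylor d f = taylor d (f / g ^ n) * taylor d (g ^ n)"
      using taylor_hom(2)[OF d reg[OF that] taylor_power(2)[OF d gH, of n]] by simp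
    then show ?thesis
      by (simp add: taylor_power(1)[OF d gH] tg dual_number_power_one)
  qed
  show ?thesis
  proof (rule trivialization_taylorI[OF d _ regH])
    show "tvar \<in> adjoin H" using t sub by blast
    show "Dual a b \<in> taylor d ` adjoin H" if "a \<in> coord_ring \<tau>" "b \<in> coord_ring \<tau>" for a b
      using image sub that by blast
  next
    fix x assume x: "x \<in> adjoin H"
    then obtain f n where f: "f \<in> adjoin G" "x = f / g ^ n"
      unfolding B by blast
    obtain a b where ab: "taylor d f = Dual a b" "a \<in> coord_ring \<tau>" "b \<in> coord_ring \<tau>"
      using image f(1) by blast
    obtain a' b' where z: "taylor d x = Dual a' b'"
      using dual_number.exhaust by blast
    have quot: "taylor d f = taylor d x * Dual 1 (of_nat n * c)"
      using quotient[of f n] x f(2) by simp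
    then have "a' = a" "b' = b - a * (const0 (of_nat n) * c)"
      using ab(1) z by (simp_all add: const0_of_nat)
    moreover have "b - a * (const0 (of_nat n) * c) \<in> coord_ring \<tau>"
      using ab c by (intro coord.spanned_diff coord.spanned_mult coord.spanned_const)
    ultimately show "taylor d x \<in> duals (coord_ring \<tau>)"
      using z ab by blast
    assume "taylor d x = 0"
    then have "taylor d f = 0"
      by (simp add: quot)
    then have "f \<in> {tvar ^ 2 * f | f. f \<in> adjoin G}"
      using kernel f(1) by blast
    then obtain f' where f': "f' \<in> adjoin G" "f = tvar ^ 2 * f'"
      by blast
    then have "x = tvar ^ 2 * (f' / g ^ n)"
      by (simp add: f(2))
    moreover have "f' / g ^ n \<in> adjoin H"
      unfolding B using f'(1) by blast
    ultimately show "\<exists>y\<in>adjoin H. x = tvar ^ 2 * y" by blast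
  qed
qed

text \<open>
  A vector field \<open>d\<close> on the special fibre yields the automorphism \<open>1 + t d\<close> of the trivial deformation.
\<close>

lemma trivialization_twist:
  assumes triv: "trivialization (adjoin G) (coord_ring \<tau>) (taylor (\<lambda>f. 0))"
    and d: "d \<in> vector_fields \<tau>" and t: "tvar \<in> adjoin G" and reg: "\<And>f. f \<in> G \<Longrightarrow> regular f"
  shows "trivialization (adjoin G) (coord_ring \<tau>) (taylor d)"
proof (rule trivialization_taylorI[OF vector_fieldsD(1)[OF d] t reg])
  have image: "taylor (\<lambda>f. 0) ` adjoin G = duals (coord_ring \<tau>)"
    and kernel: "{f \<in> adjoin G. taylor (\<lambda>f. 0) f = 0} = {tvar ^ 2 * f | f. f \<in> adjoin G}"
    using triv unfolding trivialization_def by blast+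
  have td: "taylor d f = id_plus_t d (taylor (\<lambda>f. 0) f)" for f
    by (simp add: taylor_def id_plus_t_zero)
  note closed = vector_fieldsD(2)[OF d]
  show "Dual a b \<in> taylor d ` adjoin G" if ab: "a \<in> coord_ring \<tau>" "b \<in> coord_ring \<tau>" for a b
  proof -
    have "Dual a (b - d a) \<in> taylor (\<lambda>f. 0) ` adjoin G"
      unfolding image using ab coord.spanned_diff[OF ab(2) closed[OF ab(1)]] by blast
    then obtain f where f: "f \<in> adjoin G" "Dual a (b - d a) = taylor (\<lambda>f. 0) f"
      by (rule imageE)
    have "Dual a b = taylor d f" by (simp add: td flip: f(2))
    then show ?thesis using f(1) by (rule image_eqI)
  qed
  fix f assume f: "f \<in> adjoin G"
  then have "taylor (\<lambda>f. 0) f \<in> duals (coord_ring \<tau>)"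
    using image by blast
  then obtain a b where ab: "taylor (\<lambda>f. 0) f = Dual a b" "a \<in> coord_ring \<tau>" "b \<in> coord_ring \<tau>"
    by blast
  then show "taylor d f \<in> duals (coord_ring \<tau>)"
    using closed by (auto simp: td intro!: coord.spanned_add)
  assume "taylor d f = 0"
  then have "taylor (\<lambda>f. 0) f = 0"
    using vector_fieldsD(1)[OF d] by (auto simp: td ab(1) dual_number_0)
  then show "\<exists>g\<in>adjoin G. f = tvar ^ 2 * g"
    using kernel f by blast
qed

section \<open>Independence of the trivializations\<close>

lemma cramer:
  assumes "det2 w w' = 1"
  shows "v = lscale (det2 v w') w + lscale (det2 w v) w'"
proof -
  have "fst v * (fst w * snd w' - snd w * fst w') = fst v" "snd v * (fst w * snd w' - snd w * fst w') = snd v"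
    using assms by (simp_all add: det2_def)
  then show ?thesis
    by (simp add: prod_eq_iff det2_def algebra_simps)
qed

lemma dual_full:
  assumes "w \<in> dual \<tau>" and "w' \<in> dual \<tau>" and "det2 w w' = 1"
  shows "\<exists>u\<in>dual \<tau>. v + u \<in> dual \<tau>"
proof -
  define u where "u = lscale \<bar>det2 v w'\<bar> w + lscale \<bar>det2 w v\<bar> w'"
  have "v + u = lscale (det2 v w' + \<bar>det2 v w'\<bar>) w + lscale (det2 w v + \<bar>det2 w v\<bar>) w'"
    by (subst cramer[OF assms(3), of v]) (simp add: u_def prod_eq_iff algebra_simps)
  also have "\<dots> \<in> dual \<tau>"
    by (intro dual_add dual_lscale assms) auto
  finally have "v + u \<in> dual \<tau>" .
  moreover have "u \<in> dual \<tau>"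
    unfolding u_def by (intro dual_add dual_lscale assms) auto
  ultimately show ?thesis by blast
qed

lemma derivation_eq_if_full:
  assumes D: "is_derivation D" and E: "is_derivation E"
    and eq: "\<And>u. u \<in> dual \<tau> \<Longrightarrow> D (chi u) = E (chi u)"
    and full: "\<And>v. \<exists>u\<in>dual \<tau>. v + u \<in> dual \<tau>"
  shows "D = E"
proof (rule derivation_eqI[OF D E])
  fix v
  obtain u where u: "u \<in> dual \<tau>" "v + u \<in> dual \<tau>"
    using full by blast
  have "D (chi (v + u)) = chi v * D (chi u) + chi u * D (chi v)"
    "E (chi (v + u)) = chi v * E (chi u) + chi u * E (chi v)"
    unfolding chi_add by (rule derivation_mult[OF D], rule derivation_mult[OF E])
  then show "D (chi v) = E (chi v)"
    using eq[OF u(1)] eq[OF u(2)] by simp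
qed

text \<open>
  The two logarithmic fields dual to the basis \<open>w, w'\<close> of \<open>M\<close> can be rescaled by arbitrary functions.
\<close>

lemma derivation_with_values:
  assumes "det2 w w' = 1"
  obtains D where "is_derivation D" "D (chi w) = a" "D (chi w') = b"
proof -
  define n n' where "n = (of_int (snd w') :: complex, - of_int (fst w') :: complex)"
    and "n' = (- of_int (snd w) :: complex, of_int (fst w) :: complex)"
  have "of_int (det2 w w') = (1 :: complex)"
    using assms by simp
  then have n: "cpair n w = 1" "cpair n w' = 0" "cpair n' w = 0" "cpair n' w' = 1"
    by (simp_all add: cpair_def n_def n'_def det2_def algebra_simps)
  define D where "D = (\<lambda>f. (a / chi w) * vf 0 n f + (b / chi w') * vf 0 n' f)"
  have "is_derivation D"
    unfolding D_def by (intro derivation_plus derivation_scale derivation_vf)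
  moreover have "D (chi w) = a" "D (chi w') = b"
    by (simp_all add: D_def vf_chi n)
  ultimately show ?thesis using that by blast
qed

lemma vector_field_if_on_generators:
  assumes D: "is_derivation D"
    and w: "w \<in> dual \<tau>" "w' \<in> dual \<tau>"
    and gen: "\<And>u. u \<in> dual \<tau> \<Longrightarrow> \<exists>i j. u = lscale (int i) w + lscale (int j) w'"
    and val: "D (chi w) \<in> coord_ring \<tau>" "D (chi w') \<in> coord_ring \<tau>"
  shows "D \<in> vector_fields \<tau>"
proof (rule vector_fieldsI[OF D])
  fix u assume "u \<in> dual \<tau>"
  then obtain i j where u: "u = lscale (int i) w + lscale (int j) w'"
    using gen by blast
  have pow: "f ^ k \<in> coord_ring \<tau> \<and> D (f ^ k) \<in> coord_ring \<tau>"
    if "f \<in> coord_ring \<tau>" "D f \<in> coord_ring \<tau>" for f k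
    using that D by (induction k)
      (auto simp: derivation_mult[OF D] intro!: coord.spanned_add coord.spanned_mult)
  have "chi w \<in> coord_ring \<tau>" "chi w' \<in> coord_ring \<tau>"
    using w by (auto intro: coord.spanned_char)
  then show "D (chi u) \<in> coord_ring \<tau>"
    using pow[of "chi w" i] pow[of "chi w'" j] val
    by (auto simp: u chi_add chi_lscale derivation_mult[OF D] intro!: coord.spanned_add coord.spanned_mult)
qed

text \<open>
  At each of the two generators the trivializations differ by a multiple of \<open>t\<close>, and the derivation with
  these differences as values at \<open>chi w\<close> and \<open>chi w'\<close> accounts for both. Elements with a multiplicative inverse among
  the polynomials in \<open>t, Z\<^sub>1, Z\<^sub>2\<close> follow, since the two sides are multiplicative.
\<close>

lemma trivializations_differ_by_vector_field:
  assumes triv: "trivialization (adjoin G) (coord_ring \<tau>) \<theta>"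
    and triv': "trivialization (adjoin G) (coord_ring \<tau>) \<theta>'"
    and w: "w \<in> dual \<tau>" "w' \<in> dual \<tau>" and det: "det2 w w' = 1"
    and gen: "\<And>u. u \<in> dual \<tau> \<Longrightarrow> \<exists>i j. u = lscale (int i) w + lscale (int j) w'"
    and Z: "Z1 \<in> G" "value_at_0 Z1 (chi w)" "Z2 \<in> G" "value_at_0 Z2 (chi w')" and t: "tvar \<in> G"
    and G: "\<And>g. g \<in> G \<Longrightarrow> g \<in> {tvar, Z1, Z2} \<or> (\<exists>h\<in>adjoin {tvar, Z1, Z2}. g * h = 1)"
  obtains D where "D \<in> vector_fields \<tau>" "\<And>f. f \<in> adjoin G \<Longrightarrow> \<theta>' f = id_plus_t D (\<theta> f)"
proof -
  have hom: "\<And>f g. f \<in> adjoin G \<Longrightarrow> g \<in> adjoin G \<Longrightarrow> \<theta> (f + g) = \<theta> f + \<theta> g \<and> \<theta> (f * g) = \<theta> f * \<theta> g"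
    and cst: "\<And>c. \<theta> (incl (const0 c)) = Dual (const0 c) 0" and tv: "\<theta> tvar = Dual 0 1"
    and image: "\<theta> ` adjoin G = duals (coord_ring \<tau>)"
    and val: "\<And>f. f \<in> adjoin G \<Longrightarrow> value_at_0 f (dual_fst (\<theta> f))"
    using triv unfolding trivialization_def by blast+
  have hom': "\<And>f g. f \<in> adjoin G \<Longrightarrow> g \<in> adjoin G \<Longrightarrow> \<theta>' (f + g) = \<theta>' f + \<theta>' g \<and> \<theta>' (f * g) = \<theta>' f * \<theta>' g"
    and cst': "\<And>c. \<theta>' (incl (const0 c)) = Dual (const0 c) 0" and tv': "\<theta>' tvar = Dual 0 1"
    and image': "\<theta>' ` adjoin G = duals (coord_ring \<tau>)"
    and val': "\<And>f. f \<in> adjoin G \<Longrightarrow> value_at_0 f (dual_fst (\<theta>' f))"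
    using triv' unfolding trivialization_def by blast+
  have ZG: "Z1 \<in> adjoin G" "Z2 \<in> adjoin G"
    using Z by (auto intro: adjoin.gen)
  have snd_in: "dual_snd (\<theta> f) \<in> coord_ring \<tau>" "dual_snd (\<theta>' f) \<in> coord_ring \<tau>" if f: "f \<in> adjoin G" for f
  proof -
    have "\<theta> f \<in> duals (coord_ring \<tau>)"
      "\<theta>' f \<in> duals (coord_ring \<tau>)"
      using imageI[OF f, of \<theta>] imageI[OF f, of \<theta>'] unfolding image image' .
    then show "dual_snd (\<theta> f) \<in> coord_ring \<tau>" "dual_snd (\<theta>' f) \<in> coord_ring \<tau>"
      by auto
  qed
  define e where "e f = dual_snd (\<theta>' f) - dual_snd (\<theta> f)" for f
  obtain D where D: "is_derivation D" "D (chi w) = e Z1" "D (chi w') = e Z2"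
    using derivation_with_values[OF det] .
  have "D \<in> vector_fields \<tau>"
    using snd_in ZG by (intro vector_field_if_on_generators[OF D(1) w gen])
      (auto simp: D e_def intro: coord.spanned_diff)
  moreover have eqZ: "\<theta>' f = id_plus_t D (\<theta> f)"
    if f: "f \<in> adjoin G" and v: "value_at_0 f (chi u)" and Du: "D (chi u) = e f" for f u
  proof -
    have "dual_fst (\<theta> f) = chi u" "dual_fst (\<theta>' f) = chi u"
      using val[OF f] val'[OF f] v value_at_0_unique by blast+
    then show ?thesis
      using Du by (cases "\<theta> f"; cases "\<theta>' f") (simp add: e_def)
  qed
  have base: "f \<in> adjoin G \<and> \<theta>' f = id_plus_t D (\<theta> f)" if "f \<in> adjoin {tvar, Z1, Z2}" for f
    using that
  proof induction
    case (const c)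
    then show ?case
      by (simp add: cst cst' derivation_const[OF D(1)] adjoin.const)
  next
    case (gen f)
    then consider "f = tvar" | "f = Z1" | "f = Z2" by blast
    then show ?case
    proof cases
      case 1
      then show ?thesis using t by (simp add: tv tv' adjoin.gen D(1))
    next
      case 2
      then show ?thesis using eqZ[OF ZG(1) Z(2) D(2)] ZG by simp
    next
      case 3
      then show ?thesis using eqZ[OF ZG(2) Z(4) D(3)] ZG by simp
    qed
  next
    case (add f g)
    then show ?case by (simp add: hom hom' id_plus_t_add D(1) adjoin.add)
  next
    case (mult f g)
    then show ?case by (simp add: hom hom' id_plus_t_mult D(1) adjoin.mult)
  qed
  have one: "\<theta> 1 = 1" "\<theta>' 1 = 1"
    using cst[of 1] cst'[of 1] by (simp_all add: dual_number_1)
  have "\<theta>' f = id_plus_t D (\<theta> f)" if "f \<in> adjoin G" for f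
    using that
  proof induction
    case (const c)
    then show ?case
      by (simp add: cst cst' derivation_const[OF D(1)])
  next
    case (gen g)
    show ?case
    proof (cases "g \<in> {tvar, Z1, Z2}")
      case True
      then show ?thesis using base[OF adjoin.gen[OF True]] by simp
    next
      case False
      then obtain h where h: "h \<in> adjoin {tvar, Z1, Z2}" "g * h = 1"
        using G[OF gen] by blast
      have g: "g \<in> adjoin G" using gen by (rule adjoin.gen)
      have hG: "h \<in> adjoin G" and eh: "\<theta>' h = id_plus_t D (\<theta> h)"
        using base[OF h(1)] by simp_all
      have "\<theta>' g * \<theta>' h = 1" "\<theta> g * \<theta> h = 1"
        using hom[OF g hG] hom'[OF g hG] by (simp_all add: h(2) one)
      moreover from this(2) have "id_plus_t D (\<theta> g) * id_plus_t D (\<theta> h) = 1"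
        by (simp add: id_plus_t_1 D(1) flip: id_plus_t_mult[OF D(1)])
      ultimately have "\<theta>' g * \<theta>' h = id_plus_t D (\<theta> g) * \<theta>' h" "\<theta>' g * \<theta>' h = 1"
        by (simp_all only: eh)
      moreover from this(2) have "dual_fst (\<theta>' h) \<noteq> 0"
        by (cases "\<theta>' h"; cases "\<theta>' g") (auto simp: dual_number_1)
      ultimately show ?thesis
        by (intro dual_number_cancel[of "\<theta>' g" "\<theta>' h"])
    qed
  next
    case (add f g)
    then show ?case by (simp add: hom hom' id_plus_t_add D(1))
  next
    case (mult f g)
    then show ?case by (simp add: hom hom' id_plus_t_mult D(1))
  qed
  ultimately show ?thesis
    using that by blast
qed

text \<open>
  Values on a localization are quotients of values on the ring, so that a trivialization extends to a
  localization in only one way.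
\<close>

lemma localization_value:
  assumes "is_localization B (adjoin G)"
    and hom: "\<And>f g. f \<in> B \<Longrightarrow> g \<in> B \<Longrightarrow> \<theta> (f * g) = \<theta> f * \<theta> g" and one: "\<theta> 1 = (1 :: K0 dual_number)"
    and f: "f \<in> B"
  obtains g h n where "g \<in> adjoin G" "h \<in> adjoin G" "h \<noteq> 0" "f = g / h ^ n" "\<theta> f * \<theta> (h ^ n) = \<theta> g"
    "dual_fst (\<theta> (h ^ n)) \<noteq> 0"
proof -
  obtain h where h: "h \<in> adjoin G" "h \<noteq> 0" "B = {f / h ^ n | f n. f \<in> adjoin G}"
    using assms(1) unfolding is_localization_def by blast
  have sub: "g / h ^ n \<in> B" if "g \<in> adjoin G" for g n
    using that h(3) by blast
  obtain g n where g: "g \<in> adjoin G" "f = g / h ^ n"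
    using f h(3) by blast
  have hn: "h ^ n \<in> B"
    using sub[OF adjoin_power[OF h(1), of n], of 0] by simp
  have "\<theta> f * \<theta> (h ^ n) = \<theta> (f * h ^ n)"
    using hom[OF f hn] by simp
  then have 1: "\<theta> f * \<theta> (h ^ n) = \<theta> g"
    using g(2) h(2) by simp
  have "\<theta> (h ^ n) * \<theta> (1 / h ^ n) = \<theta> (h ^ n * (1 / h ^ n))"
    using hom[OF hn sub[OF adjoin_1, of n]] by simp
  then have "\<theta> (h ^ n) * \<theta> (1 / h ^ n) = 1"
    using h(2) one by simp
  then have "dual_fst (\<theta> (h ^ n)) \<noteq> 0"
    by (cases "\<theta> (h ^ n)"; cases "\<theta> (1 / h ^ n)") (auto simp: dual_number_1)
  then show ?thesis
    using that g h(1,2) 1 by blast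
qed

lemma KS_cocycle_overlap:
  assumes "KS_cocycle l \<sigma> At \<theta> d" and "i < l" and "j < l"
  obtains B \<theta>i \<theta>j where
    "is_derivation (d i j)" "is_localization B (At i)" "is_localization B (At j)"
    "\<forall>f\<in>At i. \<theta>i f = \<theta> i f"
    "trivialization B (coord_ring (\<sigma> i \<inter> \<sigma> j)) \<theta>j" "\<forall>f\<in>At j. \<theta>j f = \<theta> j f"
    "\<forall>f\<in>B. \<theta>j f = id_plus_t (d i j) (\<theta>i f)"
proof -
  have "\<forall>i<l. \<forall>j<l. d i j \<in> vector_fields (\<sigma> i \<inter> \<sigma> j) \<and>
        (\<exists>B \<theta>i \<theta>j. is_localization B (At i) \<and> is_localization B (At j) \<and>
           trivialization B (coord_ring (\<sigma> i \<inter> \<sigma> j)) \<theta>i \<and> (\<forall>f\<in>At i. \<theta>i f = \<theta> i f) \<and>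
           trivialization B (coord_ring (\<sigma> i \<inter> \<sigma> j)) \<theta>j \<and> (\<forall>f\<in>At j. \<theta>j f = \<theta> j f) \<and>
           (\<forall>f\<in>B. \<theta>j f = id_plus_t (d i j) (\<theta>i f)))"
    using assms(1) unfolding KS_cocycle_def by (elim conjE)
  from this[rule_format, OF assms(2,3)] that show ?thesis
    using vector_fieldsD(1) by (elim conjE exE) metis
qed

text \<open>
  If \<open>D\<^sub>i\<close> is the vector field by which the trivializations of chart \<open>i\<close> differ, then
  \<open>(1 + t d'\<^sub>i\<^sub>j)(1 + t D\<^sub>i) = (1 + t D\<^sub>j)(1 + t d\<^sub>i\<^sub>j)\<close>. The two cocycles may use different overlaps \<open>B\<close> and \<open>B'\<close>,
  therefore this is checked on chart \<open>i\<close>, which is contained in both; that determines a derivation, because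
  every character is a quotient of characters on the chart.
\<close>

lemma KS_cocycles_cohomologous:
  assumes KS: "KS_cocycle l \<sigma> At \<theta> d" and KS': "KS_cocycle l \<sigma> At \<theta>' d'"
    and At: "\<And>i. i < l \<Longrightarrow> \<exists>G. At i = adjoin G"
    and diff: "\<And>i. i < l \<Longrightarrow> \<exists>D\<in>vector_fields (\<sigma> i). \<forall>f\<in>At i. \<theta>' i f = id_plus_t D (\<theta> i f)"
    and full: "\<And>i v. i < l \<Longrightarrow> \<exists>u\<in>dual (\<sigma> i). v + u \<in> dual (\<sigma> i)"
  shows "(\<lambda>i j f. d' i j f - d i j f) \<in> coboundaries l \<sigma>"
proof -
  obtain D where D: "\<And>i. i < l \<Longrightarrow> D i \<in> vector_fields (\<sigma> i)"
    and \<theta>': "\<And>i f. i < l \<Longrightarrow> f \<in> At i \<Longrightarrow> \<theta>' i f = id_plus_t (D i) (\<theta> i f)"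
    using diff by metis
  have triv: "trivialization (At i) (coord_ring (\<sigma> i)) (\<theta> i)" if "i < l" for i
    using KS that unfolding KS_cocycle_def by simp
  have main: "d' i j = (\<lambda>f. d i j f + D j f - D i f)" if i: "i < l" and j: "j < l" for i j
  proof -
    obtain B \<theta>i \<theta>j where der: "is_derivation (d i j)"
      and B: "is_localization B (At i)" "is_localization B (At j)"
      and \<theta>i: "\<forall>f\<in>At i. \<theta>i f = \<theta> i f"
      and tj: "trivialization B (coord_ring (\<sigma> i \<inter> \<sigma> j)) \<theta>j" and \<theta>j: "\<forall>f\<in>At j. \<theta>j f = \<theta> j f"
      and dij: "\<forall>f\<in>B. \<theta>j f = id_plus_t (d i j) (\<theta>i f)"
      using KS_cocycle_overlap[OF KS i j] .
    note \<theta>i = \<theta>i[rule_format] and \<theta>j = \<theta>j[rule_format] and dij = dij[rule_format]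
    obtain B' \<theta>i' \<theta>j' where der': "is_derivation (d' i j)"
      and B': "is_localization B' (At i)" "is_localization B' (At j)"
      and \<theta>i': "\<forall>f\<in>At i. \<theta>i' f = \<theta>' i f"
      and tj': "trivialization B' (coord_ring (\<sigma> i \<inter> \<sigma> j)) \<theta>j'" and \<theta>j': "\<forall>f\<in>At j. \<theta>j' f = \<theta>' j f"
      and dij': "\<forall>f\<in>B'. \<theta>j' f = id_plus_t (d' i j) (\<theta>i' f)"
      using KS_cocycle_overlap[OF KS' i j] .
    note \<theta>i' = \<theta>i'[rule_format] and \<theta>j' = \<theta>j'[rule_format] and dij' = dij'[rule_format]
    obtain G where G: "At j = adjoin G" using At[OF j] by blast
    have sub: "f \<in> B" "f \<in> B'" if "f \<in> At i" for f
    proof -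
      have "f / h ^ 0 = f" for h by simp
      then show "f \<in> B" "f \<in> B'"
        using B(1) B'(1) that unfolding is_localization_def by (metis (mono_tags, lifting) mem_Collect_eq)+
    qed
    have hom: "\<And>f g. f \<in> B \<Longrightarrow> g \<in> B \<Longrightarrow> \<theta>j (f * g) = \<theta>j f * \<theta>j g" and "\<theta>j (incl (const0 1)) = Dual (const0 1) 0"
      using tj unfolding trivialization_def by blast+
    then have one: "\<theta>j 1 = 1" by (simp add: dual_number_1)
    have hom': "\<And>f g. f \<in> B' \<Longrightarrow> g \<in> B' \<Longrightarrow> \<theta>j' (f * g) = \<theta>j' f * \<theta>j' g" and "\<theta>j' (incl (const0 1)) = Dual (const0 1) 0"
      using tj' unfolding trivialization_def by blast+
    then have one': "\<theta>j' 1 = 1" by (simp add: dual_number_1)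
    have homj: "\<And>f g. f \<in> At j \<Longrightarrow> g \<in> At j \<Longrightarrow> \<theta> j (f * g) = \<theta> j f * \<theta> j g"
      using triv[OF j] unfolding trivialization_def by blast
    have derj: "is_derivation (D j)" and deri: "is_derivation (D i)"
      using D i j vector_fieldsD(1) by blast+
    \<comment> \<open>On chart \<open>i\<close>, the extensions of the trivializations of chart \<open>j\<close> to \<open>B\<close> and \<open>B'\<close> are both determined by
      quotients of elements of chart \<open>j\<close>, so they still differ by \<open>D j\<close>.\<close>
    have transfer: "\<theta>j' f = id_plus_t (D j) (\<theta>j f)" if f: "f \<in> At i" for f
    proof -
      obtain g h n where gh: "g \<in> At j" "h \<in> At j" "h \<noteq> 0" "f = g / h ^ n" "\<theta>j f * \<theta>j (h ^ n) = \<theta>j g"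
        and nz: "dual_fst (\<theta>j (h ^ n)) \<noteq> 0"
        using localization_value[OF B(2)[unfolded G] hom one sub(1)[OF f]] unfolding G by metis
      obtain g' h' n' where gh': "g' \<in> At j" "h' \<in> At j" "h' \<noteq> 0" "f = g' / h' ^ n'" "\<theta>j' f * \<theta>j' (h' ^ n') = \<theta>j' g'"
        and nz': "dual_fst (\<theta>j' (h' ^ n')) \<noteq> 0"
        using localization_value[OF B'(2)[unfolded G] hom' one' sub(2)[OF f]] unfolding G by metis
      have pow: "h ^ n \<in> At j" "h' ^ n' \<in> At j"
        using gh(2) gh'(2) by (simp_all add: G adjoin_power)
      have cross: "g * h' ^ n' = g' * h ^ n"
        using gh(3,4) gh'(3,4) by (simp add: field_simps)
      let ?e = "id_plus_t (D j)"
      have e: "?e (\<theta> j x) = \<theta>' j x" if "x \<in> At j" for x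
        using \<theta>'[OF j that] by simp
      have mult': "\<theta>' j (x * y) = \<theta>' j x * \<theta>' j y" if "x \<in> At j" "y \<in> At j" for x y
        using that G homj[OF that] by (simp add: \<theta>'[OF j] adjoin.mult id_plus_t_mult[OF derj])
      have "?e (\<theta>j f) * \<theta>' j (h ^ n) = \<theta>' j g"
        using arg_cong[OF gh(5), of ?e] gh(1) pow(1)
        by (simp add: id_plus_t_mult[OF derj] \<theta>j e)
      then have "?e (\<theta>j f) * (\<theta>' j (h ^ n) * \<theta>' j (h' ^ n')) = \<theta>' j (g * h' ^ n')"
        using mult'[OF gh(1) pow(2)] by (simp add: mult.assoc[symmetric])
      moreover have "\<theta>j' f * \<theta>' j (h' ^ n') = \<theta>' j g'"
        using gh'(5) gh'(1) pow(2) by (simp add: \<theta>j')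
      then have "\<theta>j' f * \<theta>' j (h' ^ n') * \<theta>' j (h ^ n) = \<theta>' j (g' * h ^ n)"
        using mult'[OF gh'(1) pow(1)] by simp
      then have "\<theta>j' f * (\<theta>' j (h ^ n) * \<theta>' j (h' ^ n')) = \<theta>' j (g' * h ^ n)"
        by (simp add: mult.assoc mult.commute[of "\<theta>' j (h ^ n)"])
      ultimately have "\<theta>j' f * (\<theta>' j (h ^ n) * \<theta>' j (h' ^ n')) = ?e (\<theta>j f) * (\<theta>' j (h ^ n) * \<theta>' j (h' ^ n'))"
        using cross by simp
      moreover have "dual_fst (\<theta>' j (h ^ n) * \<theta>' j (h' ^ n')) \<noteq> 0"
        using nz nz' pow by (simp add: times_dual_number_def \<theta>j \<theta>j' \<theta>'[OF j])
      ultimately show ?thesis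
        by (rule dual_number_cancel)
    qed
    show ?thesis
    proof (rule derivation_eq_if_full[OF der' _ _ full[OF i]])
      show "is_derivation (\<lambda>f. d i j f + D j f - D i f)"
        by (intro derivation_minus_fun derivation_plus der derj deri)
      fix u assume u: "u \<in> dual (\<sigma> i)"
      have "\<theta> i ` At i = duals (coord_ring (\<sigma> i))"
        using triv[OF i] unfolding trivialization_def by blast
      moreover have "Dual (chi u) 0 \<in> duals (coord_ring (\<sigma> i))"
        using coord.spanned_char[OF u] coord.spanned_0 by blast
      ultimately obtain f where f: "f \<in> At i" "\<theta> i f = Dual (chi u) 0"
        by (metis (no_types, lifting) imageE)
      have "\<theta>j' f = id_plus_t (d' i j) (id_plus_t (D i) (Dual (chi u) 0))"
        using dij'[OF sub(2)[OF f(1)]] \<theta>i'[OF f(1)] \<theta>'[OF i f(1)] f(2) by simp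
      moreover have "\<theta>j f = id_plus_t (d i j) (Dual (chi u) 0)"
        using dij[OF sub(1)[OF f(1)]] \<theta>i[OF f(1)] f(2) by simp
      ultimately show "d' i j (chi u) = d i j (chi u) + D j (chi u) - D i (chi u)"
        using transfer[OF f(1)] by (simp add: algebra_simps)
    qed
  qed
  have outside: "d i j = (\<lambda>f. 0)" "d' i j = (\<lambda>f. 0)" if "\<not> (i < l \<and> j < l)" for i j
    using KS KS' that unfolding KS_cocycle_def by blast+
  have "(\<lambda>i j f. d' i j f - d i j f) = (\<lambda>i j f. if i < l \<and> j < l then D j f - D i f else 0)"
    by (intro ext) (simp add: main outside)
  then show ?thesis
    unfolding coboundaries_def using D by blast
qed

section \<open>Plane cones\<close>

lemma cone_single_iff:
  "x \<in> cone_of {v} \<longleftrightarrow> (\<exists>c\<ge>0. x = (c * of_int (fst v), c * of_int (snd v)))"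
  unfolding cone_of_def by auto

lemma cone_pair_iff_sum:
  assumes "u \<noteq> v"
  shows "x \<in> cone_of {u, v} \<longleftrightarrow> (\<exists>a\<ge>0. \<exists>b\<ge>0. x = (a * of_int (fst u) + b * of_int (fst v),
    a * of_int (snd u) + b * of_int (snd v)))"
proof
  assume "x \<in> cone_of {u, v}"
  then show "\<exists>a\<ge>0. \<exists>b\<ge>0. x = (a * of_int (fst u) + b * of_int (fst v),
    a * of_int (snd u) + b * of_int (snd v))"
    using assms unfolding cone_of_def by auto
next
  assume "\<exists>a\<ge>0. \<exists>b\<ge>0. x = (a * of_int (fst u) + b * of_int (fst v),
    a * of_int (snd u) + b * of_int (snd v))"
  then obtain a b where ab: "0 \<le> a" "0 \<le> b" "x = (a * of_int (fst u) + b * of_int (fst v),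
    a * of_int (snd u) + b * of_int (snd v))"
    by blast
  define c where "c = (\<lambda>w. if w = u then a else b)"
  have "x = (\<Sum>w\<in>{u, v}. c w * of_int (fst w), \<Sum>w\<in>{u, v}. c w * of_int (snd w))"
    using assms by (simp add: ab(3) c_def)
  moreover have "\<forall>w\<in>{u, v}. 0 \<le> c w"
    using ab by (simp add: c_def)
  ultimately show "x \<in> cone_of {u, v}"
    unfolding cone_of_def by blast
qed

text \<open>
  Cramer's rule: up to the positive determinant, the two expressions are the coefficients of \<open>x\<close> at \<open>u\<close> and \<open>v\<close>.
\<close>

lemma cone_pair_iff:
  assumes D: "det2 u v > 0"
  shows "x \<in> cone_of {u, v} \<longleftrightarrow>
    0 \<le> fst x * of_int (snd v) - snd x * of_int (fst v) \<and>
    0 \<le> of_int (fst u) * snd x - of_int (snd u) * fst x"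
proof -
  have ne: "u \<noteq> v"
    using D by (auto simp: det2_def algebra_simps)
  define d :: rat where "d = of_int (det2 u v)"
  have d: "d > 0" "d = of_int (fst u) * of_int (snd v) - of_int (snd u) * of_int (fst v)"
    using D by (simp only: d_def of_int_0_less_iff) (simp add: d_def det2_def)
  show ?thesis
  proof
    assume "x \<in> cone_of {u, v}"
    then obtain a b where ab: "0 \<le> a" "0 \<le> b" "x = (a * of_int (fst u) + b * of_int (fst v),
      a * of_int (snd u) + b * of_int (snd v))"
      unfolding cone_pair_iff_sum[OF ne] by blast
    have "fst x * of_int (snd v) - snd x * of_int (fst v) = a * d"
      "of_int (fst u) * snd x - of_int (snd u) * fst x = b * d"
      by (simp_all add: ab(3) d(2) algebra_simps)
    then show "0 \<le> fst x * of_int (snd v) - snd x * of_int (fst v) \<and>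
      0 \<le> of_int (fst u) * snd x - of_int (snd u) * fst x"
      using ab d by simp
  next
    assume *: "0 \<le> fst x * of_int (snd v) - snd x * of_int (fst v) \<and>
      0 \<le> of_int (fst u) * snd x - of_int (snd u) * fst x"
    define a b where "a = (fst x * of_int (snd v) - snd x * of_int (fst v)) / d"
      and "b = (of_int (fst u) * snd x - of_int (snd u) * fst x) / d"
    have "0 \<le> a" "0 \<le> b"
      using * d by (simp_all add: a_def b_def)
    moreover have "d * fst x = d * (a * of_int (fst u) + b * of_int (fst v))"
      "d * snd x = d * (a * of_int (snd u) + b * of_int (snd v))"
      using d(1) by (simp_all add: a_def b_def field_simps) (simp_all add: d(2) algebra_simps)
    then have "x = (a * of_int (fst u) + b * of_int (fst v), a * of_int (snd u) + b * of_int (snd v))"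
      using d(1) by (simp add: prod_eq_iff)
    ultimately show "x \<in> cone_of {u, v}"
      unfolding cone_pair_iff_sum[OF ne] by blast
  qed
qed

definition rat_point :: "lattice \<Rightarrow> rat \<times> rat" where
  "rat_point w = (of_int (fst w), of_int (snd w))"

lemma rat_point_in_cone_pair_iff:
  assumes "det2 u v > 0"
  shows "rat_point w \<in> cone_of {u, v} \<longleftrightarrow> 0 \<le> det2 w v \<and> 0 \<le> det2 u w"
  unfolding cone_pair_iff[OF assms] rat_point_def det2_def
  by (simp flip: of_int_mult of_int_diff add: mult.commute)

lemma pairing_rat_point: "pairing_rat (rat_point v) u = of_int (pairing v u)"
  by (simp add: pairing_rat_def rat_point_def pairing_def)

lemma generator_in_cone: "finite G \<Longrightarrow> v \<in> G \<Longrightarrow> rat_point v \<in> cone_of G"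
proof -
  assume G: "finite G" "v \<in> G"
  have "(\<Sum>w\<in>G. (if w = v then 1 else 0) * of_int (f w)) = (of_int (f v) :: rat)" for f :: "lattice \<Rightarrow> int"
    using G by (simp add: if_distrib[of "\<lambda>x. x * _"] cong: if_cong)
  then have "rat_point v = (\<Sum>w\<in>G. (if w = v then 1 else 0) * of_int (fst w), \<Sum>w\<in>G. (if w = v then 1 else 0) * of_int (snd w))"
    by (simp add: rat_point_def)
  then show ?thesis
    unfolding cone_of_def by fastforce
qed

lemma dual_cone_of:
  assumes "finite G"
  shows "dual (cone_of G) = {w. \<forall>v\<in>G. 0 \<le> pairing v w}"
proof (intro equalityI subsetI)
  fix w assume "w \<in> dual (cone_of G)"
  then have "0 \<le> pairing_rat (rat_point v) w" if "v \<in> G" for v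
    using generator_in_cone[OF assms that] unfolding dual_lattice_points_def by blast
  then show "w \<in> {w. \<forall>v\<in>G. 0 \<le> pairing v w}"
    by (simp add: pairing_rat_point)
next
  fix w assume w: "w \<in> {w. \<forall>v\<in>G. 0 \<le> pairing v w}"
  have "0 \<le> pairing_rat x w" if x: "x \<in> cone_of G" for x
  proof -
    obtain c where c: "\<forall>v\<in>G. 0 \<le> c v" "x = (\<Sum>v\<in>G. c v * of_int (fst v), \<Sum>v\<in>G. c v * of_int (snd v))"
      using x unfolding cone_of_def by blast
    have "pairing_rat x w = (\<Sum>v\<in>G. c v * of_int (pairing v w))"
      by (simp add: c(2) pairing_rat_def pairing_def sum_distrib_right sum.distrib distrib_left mult.assoc)
    also have "\<dots> \<ge> 0"
      using c(1) w by (intro sum_nonneg mult_nonneg_nonneg) auto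
    finally show ?thesis .
  qed
  then show "w \<in> dual (cone_of G)"
    by (simp add: dual_lattice_points_def)
qed

lemma primitive_multiple_eq:
  assumes "primitive u" and "u = lscale k b" and "0 \<le> k"
  shows "u = b"
proof -
  have "is_unit k"
    using assms(1,2) unfolding primitive_def by (metis coprime_common_divisor dvd_triv_left fst_lscale snd_lscale)
  then have "k = 1"
    using assms(3) by (simp add: zdvd1_eq)
  then show ?thesis
    using assms(2) by (simp add: lscale_def)
qed

text \<open>
  Each pair of generators lies in the cone of the other pair; the resulting inequalities force the first
  generators to be parallel, and likewise the second ones.
\<close>

lemma cone_pair_generators:
  assumes uv: "det2 u v > 0" and prim: "primitive u" "primitive v"
    and bb: "det2 b b' = 1" and eq: "cone_of {u, v} = cone_of {b, b'}"
  shows "u = b" and "v = b'"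
proof -
  have mem: "rat_point w \<in> cone_of {u, v} \<longleftrightarrow> rat_point w \<in> cone_of {b, b'}" for w
    by (simp add: eq)
  have bb': "det2 b b' > 0" using bb by simp
  have gen: "rat_point u \<in> cone_of {u, v}" "rat_point v \<in> cone_of {u, v}"
    "rat_point b \<in> cone_of {b, b'}" "rat_point b' \<in> cone_of {b, b'}"
    by (auto intro: generator_in_cone)
  have skew: "det2 x y = - det2 y x" for x y
    by (simp add: det2_def)
  have "0 \<le> det2 u b'" "0 \<le> det2 b u" "0 \<le> det2 v b'" "0 \<le> det2 b v"
    using gen(1,2) unfolding mem rat_point_in_cone_pair_iff[OF bb'] by auto
  moreover have "0 \<le> det2 u b" "0 \<le> det2 b' v"
    using gen(3,4) unfolding mem[symmetric] rat_point_in_cone_pair_iff[OF uv] by auto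
  ultimately have "det2 b u = 0" "det2 v b' = 0" "0 \<le> det2 u b'" "0 \<le> det2 b v"
    using skew[of u b] skew[of b' v] by auto
  then have "u = lscale (det2 u b') b" "v = lscale (det2 b v) b'"
    using cramer[OF bb, of u] cramer[OF bb, of v] by (simp_all add: prod_eq_iff)
  then show "u = b" "v = b'"
    using prim \<open>0 \<le> det2 u b'\<close> \<open>0 \<le> det2 b v\<close> by (blast intro: primitive_multiple_eq)+
qed

text \<open>
  A one-dimensional cone contains no two independent vectors, so the cone is spanned by the whole lattice basis
  \<open>b, b'\<close>, whose members are then the primitive generators \<open>u, v\<close>.
\<close>

lemma smooth_cone_det:
  assumes uv: "det2 u v > 0" and prim: "primitive u" "primitive v"
    and G: "G \<subseteq> {b, b'}" and bb: "\<bar>det2 b b'\<bar> = 1" and eq: "cone_of {u, v} = cone_of G"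
  shows "det2 u v = 1"
proof -
  have "G = {b, b'}"
  proof (rule ccontr)
    assume "G \<noteq> {b, b'}"
    then obtain c where "G \<subseteq> {c}" using G by blast
    have line: "\<exists>t. x = (t * of_int (fst c), t * of_int (snd c))" if "x \<in> cone_of G" for x
    proof (cases "G = {}")
      case True
      then have "x = (0 * of_int (fst c), 0 * of_int (snd c))"
        using that by (simp add: cone_of_def)
      then show ?thesis by blast
    next
      case False
      then have "G = {c}" using \<open>G \<subseteq> {c}\<close> by blast
      then show ?thesis using that by (auto simp: cone_single_iff)
    qed
    have "rat_point u \<in> cone_of G" "rat_point v \<in> cone_of G"
      unfolding eq[symmetric] by (auto intro: generator_in_cone)
    then obtain s t where "rat_point u = (s * of_int (fst c), s * of_int (snd c))"
      "rat_point v = (t * of_int (fst c), t * of_int (snd c))"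
      using line by meson
    then have "(of_int (det2 u v) :: rat) = 0"
      by (simp add: rat_point_def det2_def)
    then show False using uv by simp
  qed
  then have eq': "cone_of {u, v} = cone_of {b, b'}" "cone_of {u, v} = cone_of {b', b}"
    using eq by (simp_all add: insert_commute)
  have "det2 b b' = 1 \<or> det2 b' b = 1"
    using bb by (auto simp: det2_def abs_if algebra_simps split: if_splits)
  then show ?thesis
    using cone_pair_generators[OF uv prim _ eq'(1)] cone_pair_generators[OF uv prim _ eq'(2)] by auto
qed

section \<open>The slice of the fan\<close>

locale sliced_fan =
  fixes F :: "cone set" and \<nu> :: "nat \<Rightarrow> lattice" and l m :: nat and S R :: lattice
  assumes fan: "is_fan F" and smooth: "smooth_fan F" and SR: "det2 S R = 1"
    and rays: "ray_numbering F \<nu> l" and slices: "slice_numbering F \<nu> l m S R"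
begin

abbreviation \<sigma> :: "nat \<Rightarrow> cone" where "\<sigma> \<equiv> max_cone \<nu>"

text \<open>
  In the coordinates given by \<open>S\<close> and \<open>R\<close>, the generator \<open>\<nu> i\<close> is \<open>(x i, h i)\<close>; a ray with \<open>h i > 0\<close> meets the slice in
  \<open>x i / h i\<close>.
\<close>

definition h :: "nat \<Rightarrow> int" where "h i = pairing (\<nu> i) R"
definition x :: "nat \<Rightarrow> int" where "x i = pairing (\<nu> i) S"

lemma cone_in_fan: "i < l \<Longrightarrow> \<sigma> i \<in> F"
  and det_pos: "i < l \<Longrightarrow> det2 (\<nu> i) (\<nu> (Suc i)) > 0"
  and ray_primitive: "i \<le> l \<Longrightarrow> primitive (\<nu> i)"
  and ray_l: "\<nu> 0 = \<nu> l"
  and rays_inj: "inj_on (\<lambda>i. cone_of {\<nu> i}) {1..l}"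
  using rays unfolding ray_numbering_def by (auto dest: bij_betw_imp_inj_on)

lemma m_less: "m + 1 < l"
  and segs_bij: "bij_betw (seg S R \<nu>) {0..m+1} {P \<in> slice S R ` F. infinite P}"
  and seg_step: "i \<le> m \<Longrightarrow> p \<in> seg S R \<nu> i \<Longrightarrow> q \<in> seg S R \<nu> (Suc i) \<Longrightarrow> p \<ge> q"
  using slices unfolding slice_numbering_def by auto

lemma det_1: "i < l \<Longrightarrow> det2 (\<nu> i) (\<nu> (Suc i)) = 1"
proof -
  assume i: "i < l"
  have "\<exists>b b' G. \<bar>det2 b b'\<bar> = 1 \<and> G \<subseteq> {b, b'} \<and> \<sigma> i = cone_of G"
    using smooth cone_in_fan[OF i] unfolding smooth_fan_def by simp
  then obtain b b' G where *: "\<bar>det2 b b'\<bar> = 1" "G \<subseteq> {b, b'}" "cone_of {\<nu> i, \<nu> (Suc i)} = cone_of G"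
    unfolding max_cone_def by blast
  show ?thesis
    using i by (intro smooth_cone_det[OF det_pos[OF i] _ _ *(2,1,3)] ray_primitive) auto
qed

lemma det_slice: "det2 (\<nu> i) (\<nu> j) = x i * h j - h i * x j"
proof -
  have "x i * h j - h i * x j = det2 (\<nu> i) (\<nu> j) * det2 S R"
    by (simp add: x_def h_def pairing_def det2_def algebra_simps)
  then show ?thesis using SR by simp
qed

lemma xh_1: "i < l \<Longrightarrow> x i * h (Suc i) - h i * x (Suc i) = 1"
  using det_1 det_slice by simp

definition slice_point :: "rat \<Rightarrow> rat \<times> rat" where
  "slice_point p = (p * of_int (snd R) - of_int (snd S), of_int (fst S) - p * of_int (fst R))"

lemma SR_rat: "(of_int (fst S) * of_int (snd R) - of_int (snd S) * of_int (fst R) :: rat) = 1"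
proof -
  have "(of_int (det2 S R) :: rat) = 1" using SR by simp
  then show ?thesis by (simp add: det2_def)
qed

lemma slice_point_pairing: "pairing_rat (slice_point p) S = p" "pairing_rat (slice_point p) R = 1"
proof -
  have "pairing_rat (slice_point p) S = p * (of_int (fst S) * of_int (snd R) - of_int (snd S) * of_int (fst R))"
    "pairing_rat (slice_point p) R = of_int (fst S) * of_int (snd R) - of_int (snd S) * of_int (fst R)"
    by (simp_all add: pairing_rat_def slice_point_def algebra_simps)
  then show "pairing_rat (slice_point p) S = p" "pairing_rat (slice_point p) R = 1"
    by (simp_all add: SR_rat)
qed

lemma point_from_pairings:
  "fst v = pairing_rat v S * of_int (snd R) - pairing_rat v R * of_int (snd S)"
  "snd v = pairing_rat v R * of_int (fst S) - pairing_rat v S * of_int (fst R)"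
proof -
  have "fst v * (of_int (fst S) * of_int (snd R) - of_int (snd S) * of_int (fst R)) = pairing_rat v S * of_int (snd R) - pairing_rat v R * of_int (snd S)"
    "snd v * (of_int (fst S) * of_int (snd R) - of_int (snd S) * of_int (fst R)) = pairing_rat v R * of_int (fst S) - pairing_rat v S * of_int (fst R)"
    by (simp_all add: pairing_rat_def algebra_simps)
  then show "fst v = pairing_rat v S * of_int (snd R) - pairing_rat v R * of_int (snd S)"
    "snd v = pairing_rat v R * of_int (fst S) - pairing_rat v S * of_int (fst R)"
    by (simp_all add: SR_rat)
qed

lemma slice_iff: "p \<in> slice S R \<tau> \<longleftrightarrow> slice_point p \<in> \<tau>"
proof
  assume "p \<in> slice S R \<tau>"
  then obtain v where v: "v \<in> \<tau>" "pairing_rat v S = p" "pairing_rat v R = 1"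
    unfolding slice_def by blast
  have "v = slice_point p"
    using point_from_pairings[of v] by (simp add: v slice_point_def prod_eq_iff)
  then show "slice_point p \<in> \<tau>" using v by simp
next
  assume "slice_point p \<in> \<tau>"
  then show "p \<in> slice S R \<tau>"
    unfolding slice_def
    by (intro CollectI exI[of _ "slice_point p"]) (simp add: slice_point_pairing)
qed

text \<open>
  The two conditions are the inequalities of \<open>cone_pair_iff\<close> for the point of the slice with coordinate \<open>p\<close>.
\<close>

lemma seg_iff:
  assumes "i < l"
  shows "p \<in> seg S R \<nu> i \<longleftrightarrow> p * of_int (h i) \<le> of_int (x i) \<and> of_int (x (Suc i)) \<le> p * of_int (h (Suc i))"
  unfolding seg_def slice_iff max_cone_def cone_pair_iff[OF det_pos[OF assms]]
  by (auto simp: slice_point_def h_def x_def pairing_def algebra_simps)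

text \<open>
  A cone with two generators of nonpositive height misses the slice. If a generator has positive height, then the slice
  contains an interval next to the vertex that this generator cuts out.
\<close>

lemma seg_infinite_iff:
  assumes i: "i < l"
  shows "infinite (seg S R \<nu> i) \<longleftrightarrow> h i > 0 \<or> h (Suc i) > 0"
proof -
  define a b c d :: rat where "a = of_int (x i)" and "b = of_int (h i)"
    and "c = of_int (x (Suc i))" and "d = of_int (h (Suc i))"
  have "(of_int (x i * h (Suc i) - h i * x (Suc i)) :: rat) = 1"
    using xh_1[OF i] by simp
  then have D: "a * d - b * c = 1"
    by (simp add: a_def b_def c_def d_def)
  have mem: "p \<in> seg S R \<nu> i \<longleftrightarrow> p * b \<le> a \<and> c \<le> p * d" for p
    unfolding seg_iff[OF i] by (simp add: a_def b_def c_def d_def)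
  have pos: "h i > 0 \<longleftrightarrow> b > 0" "h (Suc i) > 0 \<longleftrightarrow> d > 0"
    by (simp_all add: b_def d_def)
  have interval: "infinite (seg S R \<nu> i)" if "p < q" "{p..q} \<subseteq> seg S R \<nu> i" for p q
    using that infinite_Icc infinite_super by blast
  show ?thesis
  proof (cases "b > 0 \<or> d > 0")
    case True
    then have "infinite (seg S R \<nu> i)"
    proof
      assume b: "b > 0"
      \<comment> \<open>The slice contains a small interval to the left of its vertex \<open>a / b\<close>.\<close>
      define r where "r = 1 / (b * (1 + \<bar>d\<bar>))"
      have small: "\<bar>d\<bar> / (1 + \<bar>d\<bar>) < 1"
        using abs_add_one_gt_zero[of d] by simp
      have r: "r > 0" "r * \<bar>d\<bar> < 1 / b"
        using b abs_add_one_gt_zero[of d] divide_strict_right_mono[OF small b]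
        by (simp_all add: r_def mult.commute)
      have "p \<in> seg S R \<nu> i" if p: "a / b - r \<le> p" "p \<le> a / b" for p
      proof -
        have "(a / b - p) * d \<le> r * \<bar>d\<bar>"
          using p by (intro order_trans[OF mult_left_mono[OF abs_ge_self] mult_right_mono]) auto
        also have "\<dots> < a * d / b - c"
          using r(2) b D by (simp add: field_simps)
        finally show ?thesis
          using p b by (simp add: mem field_simps)
      qed
      then show ?thesis
        using r by (intro interval[of "a / b - r" "a / b"]) auto
    next
      assume d: "d > 0"
      define r where "r = 1 / (d * (1 + \<bar>b\<bar>))"
      have small: "\<bar>b\<bar> / (1 + \<bar>b\<bar>) < 1"
        using abs_add_one_gt_zero[of b] by simp
      have r: "r > 0" "r * \<bar>b\<bar> < 1 / d"
        using d abs_add_one_gt_zero[of b] divide_strict_right_mono[OF small d]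
        by (simp_all add: r_def mult.commute)
      have "p \<in> seg S R \<nu> i" if p: "c / d \<le> p" "p \<le> c / d + r" for p
      proof -
        have "(p - c / d) * b \<le> r * \<bar>b\<bar>"
          using p by (intro order_trans[OF mult_left_mono[OF abs_ge_self] mult_right_mono]) auto
        also have "\<dots> < a - c * b / d"
          using r(2) d D by (simp add: field_simps)
        finally show ?thesis
          using p d by (simp add: mem field_simps)
      qed
      then show ?thesis
        using r by (intro interval[of "c / d" "c / d + r"]) auto
    qed
    then show ?thesis using True pos by simp
  next
    case False
    have "p \<notin> seg S R \<nu> i" for p
    proof
      assume "p \<in> seg S R \<nu> i"
      then have "(p * b) * d \<ge> a * d" "(p * d) * b \<le> c * b"
        using False by (auto simp: mem intro: mult_right_mono_neg)
      then show False using D by (simp add: algebra_simps)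
    qed
    then have "seg S R \<nu> i = {}" by blast
    then show ?thesis using False by (simp add: pos)
  qed
qed

lemma max_cone_inj:
  assumes "i < l" and "j < l" and "\<sigma> i = \<sigma> j"
  shows "i = j"
proof -
  have eq: "\<nu> i = \<nu> j"
    using cone_pair_generators(1)[OF det_pos[OF assms(1)] _ _ det_1[OF assms(2)]] assms ray_primitive
    unfolding max_cone_def by simp
  define wrap where "wrap k = (if k = 0 then l else k)" for k
  have "\<nu> (wrap i) = \<nu> (wrap j)" "wrap i \<in> {1..l}" "wrap j \<in> {1..l}"
    using eq assms ray_l by (auto simp: wrap_def)
  then have "wrap i = wrap j"
    using inj_onD[OF rays_inj] by simp
  then show ?thesis
    using assms by (auto simp: wrap_def split: if_splits)
qed

lemma face_vector:
  assumes "i < l" and "j < l"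
  obtains u where "u \<in> dual (\<sigma> i)" "\<sigma> i \<inter> \<sigma> j = {v \<in> \<sigma> i. pairing_rat v u = 0}"
proof -
  have "face_of_cone (\<sigma> i \<inter> \<sigma> j) (\<sigma> i)"
    using fan cone_in_fan[OF assms(1)] cone_in_fan[OF assms(2)] unfolding is_fan_def by simp
  then show ?thesis
    using that unfolding face_of_cone_def by blast
qed

text \<open>
  Two points of the slice are independent, so a linear form that vanishes on both is zero.
\<close>

lemma face_with_two_slice_points:
  assumes i: "i < l" and j: "j < l" and pq: "p \<noteq> q"
    and mem: "slice_point p \<in> \<sigma> i \<inter> \<sigma> j" "slice_point q \<in> \<sigma> i \<inter> \<sigma> j"
  shows "\<sigma> i \<inter> \<sigma> j = \<sigma> i"
proof -
  obtain u where u: "\<sigma> i \<inter> \<sigma> j = {v \<in> \<sigma> i. pairing_rat v u = 0}"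
    using face_vector[OF i j] by blast
  then have zero: "pairing_rat (slice_point p) u = 0" "pairing_rat (slice_point q) u = 0"
    using mem by blast+
  define k n where "k = of_int (snd R) * of_int (fst u) - of_int (fst R) * (of_int (snd u) :: rat)"
    and "n = of_int (fst S) * of_int (snd u) - of_int (snd S) * (of_int (fst u) :: rat)"
  have expand: "pairing_rat (slice_point r) u = r * k + n" for r
    by (simp add: pairing_rat_def slice_point_def k_def n_def algebra_simps)
  have "(p - q) * k = (p * k + n) - (q * k + n)"
    by (simp add: algebra_simps)
  also have "\<dots> = 0"
    using zero unfolding expand by simp
  finally have "(p - q) * k = 0" .
  then have k: "k = 0" using pq by simp
  then have n: "n = 0" using zero unfolding expand by simp
  have "of_int (fst u) * (of_int (fst S) * of_int (snd R) - of_int (snd S) * of_int (fst R)) = of_int (fst S) * k + of_int (fst R) * n"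
    "of_int (snd u) * (of_int (fst S) * of_int (snd R) - of_int (snd S) * of_int (fst R)) = of_int (snd S) * k + of_int (snd R) * n"
    by (simp_all add: k_def n_def algebra_simps)
  then have "(of_int (fst u) :: rat) = 0" "(of_int (snd u) :: rat) = 0"
    by (simp_all only: SR_rat k n)
  then show ?thesis
    unfolding u by (auto simp: pairing_rat_def)
qed

lemma infinite_seg_inj:
  assumes i: "i < l" and j: "j < l" and inf: "infinite (seg S R \<nu> i)" and eq: "seg S R \<nu> i = seg S R \<nu> j"
  shows "i = j"
proof -
  obtain p where p: "p \<in> seg S R \<nu> i"
    using inf by (metis finite.emptyI ex_in_conv)
  obtain q where q: "q \<in> seg S R \<nu> i" "q \<noteq> p"
    using inf by (metis finite.simps finite_subset insertCI subsetI)
  have "slice_point p \<in> \<sigma> i \<inter> \<sigma> j" "slice_point q \<in> \<sigma> i \<inter> \<sigma> j"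
    using p q(1) eq unfolding seg_def by (auto simp flip: slice_iff)
  then have "\<sigma> i \<inter> \<sigma> j = \<sigma> i" "\<sigma> j \<inter> \<sigma> i = \<sigma> j"
    using face_with_two_slice_points[OF i j q(2)] face_with_two_slice_points[OF j i q(2)] by (auto simp: Int_commute)
  then have "\<sigma> i = \<sigma> j" by blast
  then show ?thesis
    using max_cone_inj i j by blast
qed

text \<open>
  Two cones with the same infinite slice share a two-dimensional face, hence are equal; so no cone of index above
  \<open>m + 1\<close> has an infinite slice.
\<close>

lemma seg_infinite_iff_index:
  assumes "i < l"
  shows "infinite (seg S R \<nu> i) \<longleftrightarrow> i \<le> m + 1"
proof
  assume "i \<le> m + 1"
  then show "infinite (seg S R \<nu> i)"
    using bij_betwE[OF segs_bij] by auto
next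
  assume inf: "infinite (seg S R \<nu> i)"
  then have "seg S R \<nu> i \<in> {P \<in> slice S R ` F. infinite P}"
    using cone_in_fan[OF assms] unfolding seg_def by blast
  then obtain j where j: "j \<le> m + 1" "seg S R \<nu> i = seg S R \<nu> j"
    using segs_bij unfolding bij_betw_def by (metis (no_types, lifting) atLeastAtMost_iff imageE)
  then have "i = j"
    using infinite_seg_inj[OF assms _ inf] m_less by simp
  then show "i \<le> m + 1" using j by simp
qed

lemma height_nonpos:
  assumes "m + 1 < i" and "i < l"
  shows "h i \<le> 0" and "h (Suc i) \<le> 0"
  using seg_infinite_iff[OF assms(2)] seg_infinite_iff_index[OF assms(2)] assms by auto

text \<open>
  If \<open>\<rho>\<^sub>i\<close> did not meet the slice, then \<open>\<sigma>\<^sub>i\<^sub>-\<^sub>1\<close> would cut out a half-line to the left and \<open>\<sigma>\<^sub>i\<close> one to the right, against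
  the order from right to left.
\<close>

lemma height_pos:
  assumes "1 \<le> i" and "i \<le> m + 1"
  shows "h i > 0"
proof (rule ccontr)
  assume neg: "\<not> h i > 0"
  obtain k where k: "i = Suc k" using assms(1) by (cases i) auto
  have kl: "k < l" "Suc k < l" using k assms m_less by auto
  have inf: "infinite (seg S R \<nu> k)" "infinite (seg S R \<nu> (Suc k))"
    using seg_infinite_iff_index kl k assms by auto
  define a b c d e f :: rat where "a = of_int (x k)" and "b = of_int (h k)"
    and "c = of_int (x (Suc k))" and "d = of_int (h (Suc k))"
    and "e = of_int (x (Suc (Suc k)))" and "f = of_int (h (Suc (Suc k)))"
  have "b > 0" "f > 0" and d: "d \<le> 0"
    using inf neg k seg_infinite_iff[OF kl(1)] seg_infinite_iff[OF kl(2)] by (auto simp: b_def f_def d_def)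
  have "(of_int (x k * h (Suc k) - h k * x (Suc k)) :: rat) = 1"
    "(of_int (x (Suc k) * h (Suc (Suc k)) - h (Suc k) * x (Suc (Suc k))) :: rat) = 1"
    using xh_1[OF kl(1)] xh_1[OF kl(2)] by simp_all
  then have D: "a * d - b * c = 1" "c * f - d * e = 1"
    by (simp_all add: a_def b_def c_def d_def e_def f_def)
  have mem: "p \<in> seg S R \<nu> k \<longleftrightarrow> p * b \<le> a \<and> c \<le> p * d" "p \<in> seg S R \<nu> (Suc k) \<longleftrightarrow> p * d \<le> c \<and> e \<le> p * f" for p
    unfolding seg_iff[OF kl(1)] seg_iff[OF kl(2)] by (simp_all add: a_def b_def c_def d_def e_def f_def)
  have "d \<noteq> 0"
  proof
    assume "d = 0"
    then have "b * c < 0" "c * f > 0" using D by auto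
    then show False using \<open>b > 0\<close> \<open>f > 0\<close> by (simp add: mult_less_0_iff zero_less_mult_iff)
  qed
  then have "d < 0" using d by simp
  define p where "p = min (a / b) (min (c / d) (e / f)) - 1"
  define q where "q = max (e / f) (c / d)"
  have "p \<le> a / b" "p \<le> c / d" "q \<ge> e / f" "q \<ge> c / d"
    by (auto simp: p_def q_def)
  then have "p \<in> seg S R \<nu> k" "q \<in> seg S R \<nu> (Suc k)"
    using \<open>b > 0\<close> \<open>f > 0\<close> \<open>d < 0\<close> by (simp_all add: mem field_simps)
  then have "p \<ge> q"
    using seg_step[of k] k assms by simp
  then show False
    unfolding p_def q_def by linarith
qed

text \<open>
  If \<open>h 0 > 0\<close>, then the cone before \<open>\<rho>\<^sub>0 = \<rho>\<^sub>l\<close> has an infinite slice as well, so \<open>l = m + 2\<close> and all rays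
  meet the slice. But the points of intersection move to the left from each ray to the next, and the last ray is the
  first one.
\<close>

lemma height_ends: "h 0 \<le> 0" "h (m + 2) \<le> 0"
proof -
  have hl: "h 0 = h l" "x 0 = x l"
    using ray_l by (simp_all add: h_def x_def)
  show h0: "h 0 \<le> 0"
  proof (rule ccontr)
    assume h0: "\<not> h 0 \<le> 0"
    obtain k where k: "l = Suc k" using m_less by (cases l) auto
    then have "infinite (seg S R \<nu> k)"
      using seg_infinite_iff[of k] h0 hl by simp
    then have "k \<le> m + 1"
      using seg_infinite_iff_index k by simp
    then have l: "l = m + 2" using k m_less by simp
    have pos: "h i > 0" if "i \<le> l" for i
      using that height_pos[of i] h0 hl l by (cases "i = 0"; cases "i = l") auto
    define r :: "nat \<Rightarrow> rat" where "r i = of_int (x i) / of_int (h i)" for i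
    have dec: "r (Suc i) < r i" if "i < l" for i
    proof -
      have "h i * x (Suc i) < x i * h (Suc i)"
        using xh_1[OF that] by simp
      then have "(of_int (h i * x (Suc i)) :: rat) < of_int (x i * h (Suc i))"
        by (simp only: of_int_less_iff)
      then show ?thesis
        using pos[of i] pos[of "Suc i"] that by (simp add: r_def field_simps)
    qed
    have "r n < r 0" if "0 < n" "n \<le> l" for n
      using that
    proof (induction n)
      case (Suc n)
      then show ?case using dec[of n] by (cases "n = 0") auto
    qed simp
    then have "r l < r 0" using l by simp
    then show False using hl by (simp add: r_def)
  qed
  show "h (m + 2) \<le> 0"
  proof (cases "m + 2 < l")
    case True
    then show ?thesis using height_nonpos(1) by simp
  next
    case False
    then have "m + 2 = l" using m_less by simp
    then show ?thesis using h0 hl by simp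
  qed
qed

lemma adjacent_cones_inter:
  assumes "Suc i < l"
  shows "\<sigma> i \<inter> \<sigma> (Suc i) = cone_of {\<nu> (Suc i)}"
proof (intro equalityI subsetI)
  fix v assume v: "v \<in> \<sigma> i \<inter> \<sigma> (Suc i)"
  have i: "i < l" using assms by simp
  let ?a = "of_int (fst (\<nu> (Suc i))) :: rat" and ?b = "of_int (snd (\<nu> (Suc i))) :: rat"
  have ne: "\<nu> i \<noteq> \<nu> (Suc i)"
  proof
    assume eq: "\<nu> i = \<nu> (Suc i)"
    have "det2 (\<nu> i) (\<nu> (Suc i)) = 0" unfolding eq by (simp add: det2_def)
    then show False using det_pos[OF i] by simp
  qed
  have "v \<in> cone_of {\<nu> i, \<nu> (Suc i)}" using v by (simp add: max_cone_def)
  then obtain c d where cd: "0 \<le> c" "0 \<le> d" "v = (c * of_int (fst (\<nu> i)) + d * ?a, c * of_int (snd (\<nu> i)) + d * ?b)"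
    unfolding cone_pair_iff_sum[OF ne] by blast
  have "0 \<le> ?a * snd v - ?b * fst v"
    using v cone_pair_iff[OF det_pos[OF assms]] by (simp add: max_cone_def)
  also have "?a * snd v - ?b * fst v = - c * of_int (det2 (\<nu> i) (\<nu> (Suc i)))"
    by (simp add: cd(3) det2_def algebra_simps)
  finally have "c = 0" using det_1[OF i] cd(1) by simp
  then show "v \<in> cone_of {\<nu> (Suc i)}"
    using cd by (auto simp: cone_single_iff)
next
  fix v assume "v \<in> cone_of {\<nu> (Suc i)}"
  then obtain c where c: "0 \<le> c" "v = (c * of_int (fst (\<nu> (Suc i))), c * of_int (snd (\<nu> (Suc i))))"
    by (auto simp: cone_single_iff)
  have d: "(of_int (det2 (\<nu> i) (\<nu> (Suc i))) :: rat) = 1" "(of_int (det2 (\<nu> (Suc i)) (\<nu> (Suc (Suc i)))) :: rat) = 1"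
    using det_1 assms by simp_all
  have "0 \<le> c * of_int (det2 (\<nu> i) (\<nu> (Suc i)))" "0 \<le> c * of_int (det2 (\<nu> (Suc i)) (\<nu> (Suc (Suc i))))"
    unfolding d using c(1) by simp_all
  then show "v \<in> \<sigma> i \<inter> \<sigma> (Suc i)"
    using assms det_pos[of i] det_pos[of "Suc i"]
    by (simp add: max_cone_def cone_pair_iff c(2)) (simp add: det2_def algebra_simps)
qed

lemma seg_ordered:
  assumes "i < j" and "j \<le> m + 1" and "p \<in> seg S R \<nu> i" and "q \<in> seg S R \<nu> j"
  shows "p \<ge> q"
  using assms
proof (induction j arbitrary: q)
  case (Suc j)
  show ?case
  proof (cases "i = j")
    case True
    then show ?thesis using Suc.prems seg_step by simp
  next
    case False
    have "infinite (seg S R \<nu> j)"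
      using seg_infinite_iff_index[of j] Suc.prems m_less by simp
    then obtain r where "r \<in> seg S R \<nu> j"
      by (metis finite.emptyI ex_in_conv)
    then have "p \<ge> r" "r \<ge> q"
      using Suc False seg_step[of j r q] by auto
    then show ?thesis by simp
  qed
qed simp

lemma cone_scale:
  assumes "i < l" and "v \<in> \<sigma> i" and "0 \<le> c"
  shows "(c * fst v, c * snd v) \<in> \<sigma> i"
proof -
  have *: "0 \<le> fst v * of_int (snd (\<nu> (Suc i))) - snd v * of_int (fst (\<nu> (Suc i)))"
    "0 \<le> of_int (fst (\<nu> i)) * snd v - of_int (snd (\<nu> i)) * fst v"
    using assms cone_pair_iff[OF det_pos[OF assms(1)]] by (simp_all add: max_cone_def)
  have "0 \<le> c * (fst v * of_int (snd (\<nu> (Suc i))) - snd v * of_int (fst (\<nu> (Suc i))))"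
    "0 \<le> c * (of_int (fst (\<nu> i)) * snd v - of_int (snd (\<nu> i)) * fst v)"
    using * assms(3) by simp_all
  then show ?thesis
    using cone_pair_iff[OF det_pos[OF assms(1)]] by (simp add: max_cone_def algebra_simps)
qed

text \<open>
  If \<open>\<sigma>\<^sub>i\<close> and \<open>\<sigma>\<^sub>j\<close> have a common point of the slice and another segment lies between theirs, then this segment is
  squeezed into a single point.
\<close>

lemma inter_above_imp_adjacent:
  assumes ij: "i < j" "j \<le> m + 1" and v: "v \<in> \<sigma> i \<inter> \<sigma> j" and pos: "pairing_rat v R > 0"
  shows "j = Suc i"
proof (rule ccontr)
  assume ne: "j \<noteq> Suc i"
  have l: "i < l" "j < l" "Suc i < l" using ij m_less by auto
  define c where "c = 1 / pairing_rat v R"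
  define p where "p = c * pairing_rat v S"
  have "slice_point p = (c * fst v, c * snd v)"
    using pos point_from_pairings[of v]
    by (simp add: slice_point_def p_def c_def prod_eq_iff field_simps)
  then have "p \<in> seg S R \<nu> i" "p \<in> seg S R \<nu> j"
    using cone_scale[OF l(1), of v c] cone_scale[OF l(2), of v c] v pos
    unfolding seg_def slice_iff by (simp_all add: c_def)
  then have "r = p" if "r \<in> seg S R \<nu> (Suc i)" for r
    using seg_step[of i p r] seg_ordered[of "Suc i" j r p] that ij ne by force
  then have "seg S R \<nu> (Suc i) \<subseteq> {p}" by blast
  then show False
    using seg_infinite_iff_index[OF l(3)] ij finite_subset by auto
qed

end

section \<open>Twisted characters\<close>

text \<open>
  This is \<open>g = (y - t) / y\<close> for \<open>y = \<chi>\<^sup>R\<close>.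
\<close>

definition twist_unit :: "lattice \<Rightarrow> K" where
  "twist_unit R = 1 - tvar * incl (chi (- R))"

definition twisted_char :: "lattice \<Rightarrow> lattice \<Rightarrow> lattice \<Rightarrow> K" where
  "twisted_char R n u = incl (chi u) * twist_unit R powi pairing n u"

definition degree_field :: "lattice \<Rightarrow> lattice \<Rightarrow> K0 \<Rightarrow> K0" where
  "degree_field R n = vf (- R) (of_int (fst n), of_int (snd n))"

text \<open>
  For \<open>n = 0\<close> this is the trivial deformation of the chart of \<open>\<tau>\<close>.
\<close>

definition char_ring :: "lattice \<Rightarrow> lattice \<Rightarrow> cone \<Rightarrow> K set" where
  "char_ring R n \<tau> = adjoin (insert tvar (twisted_char R n ` dual \<tau>))"

definition unit_ring :: "lattice \<Rightarrow> cone \<Rightarrow> K set" where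
  "unit_ring R \<tau> =
     adjoin (insert (inverse (twist_unit R)) (insert tvar (twisted_char R 0 ` dual \<tau>)))"

lemma pairing_lin:
  "pairing v (u + w) = pairing v u + pairing v w" "pairing v (u - w) = pairing v u - pairing v w"
  "pairing v (- u) = - pairing v u" "pairing v 0 = 0" "pairing 0 u = 0"
  "pairing v (lscale k u) = k * pairing v u"
  by (simp_all add: pairing_def algebra_simps)

lemma first_order_twist_unit: "first_order (twist_unit R) (Dual 1 (- chi (- R)))"
proof -
  have "first_order (1 + tvar * incl (- chi (- R))) (1 + Dual 0 1 * Dual (- chi (- R)) 0)"
    by (intro first_order_add first_order_mult first_order_1 first_order_tvar first_order_incl)
  then show ?thesis
    by (simp add: twist_unit_def dual_number_1)
qed

lemma twist_unit_nonzero [simp]: "twist_unit R \<noteq> 0"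
proof
  assume "twist_unit R = 0"
  then show False
    using first_order_unique[OF first_order_twist_unit, of R "Dual 0 0"] first_order_incl[of 0] by simp
qed

lemma first_order_power: "first_order f z \<Longrightarrow> first_order (f ^ n) (z ^ n)"
  by (induction n) (auto intro: first_order_1 first_order_mult)

lemma first_order_unit_power_int:
  assumes "first_order f (Dual 1 c)"
  shows "first_order (f powi k) (Dual 1 (of_int k * c))"
proof (cases k rule: int_cases2)
  case (nonneg n)
  then show ?thesis
    using first_order_power[OF assms, of n] by (simp add: dual_number_power_one)
next
  case (nonpos n)
  have "first_order (f ^ n) (Dual 1 (of_nat n * c))"
    using first_order_power[OF assms, of n] by (simp add: dual_number_power_one)
  then have "first_order (inverse (f ^ n)) (Dual 1 (- (of_nat n * c)))"
    by (rule first_order_inverse) (simp add: dual_number_1)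
  then show ?thesis
    by (simp add: nonpos power_int_minus)
qed

lemma derivation_degree_field: "is_derivation (degree_field R n)"
  unfolding degree_field_def by (rule derivation_vf)

lemma degree_field_chi: "degree_field R n (chi w) = of_int (pairing n w) * chi (w - R)"
  by (simp add: degree_field_def vf_chi cpair_def pairing_def const0_of_int)

lemma degree_field_0: "degree_field R 0 f = 0"
  using vf_0[of "- R" f] by (simp add: degree_field_def zero_prod_def)

lemma twisted_char_0 [simp]: "twisted_char R n 0 = 1"
  by (simp add: twisted_char_def pairing_lin)

lemma untwisted_char: "twisted_char R 0 u = incl (chi u)"
  by (simp add: twisted_char_def pairing_lin)

lemma twisted_char_add: "twisted_char R n (u + v) = twisted_char R n u * twisted_char R n v"
  by (simp add: twisted_char_def chi_add pairing_lin power_int_add ac_simps)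

lemma twisted_char_minus: "twisted_char R n (- u) = inverse (twisted_char R n u)"
  by (simp add: twisted_char_def chi_minus incl_inverse pairing_lin power_int_minus)

lemma twisted_char_nonzero [simp]: "twisted_char R n u \<noteq> 0"
  by (simp add: twisted_char_def)

lemma twisted_char_lscale: "twisted_char R n (lscale (int i) u) = twisted_char R n u ^ i"
  by (simp add: twisted_char_def chi_lscale pairing_lin power_int_mult power_mult_distrib incl_power_int
      mult.commute[of "int i"]) (simp flip: incl_power_int power_int_of_nat)

lemma first_order_twisted_char:
  "first_order (twisted_char R n u) (Dual (chi u) (- of_int (pairing n u) * chi (u - R)))"
proof -
  have "first_order (twisted_char R n u) (Dual (chi u) 0 * Dual 1 (of_int (pairing n u) * - chi (- R)))"
    unfolding twisted_char_def
    by (intro first_order_mult first_order_incl first_order_unit_power_int first_order_twist_unit)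
  then show ?thesis
    by (simp add: chi_add[of u "- R", simplified] ac_simps)
qed

lemma regular_twisted_char: "regular (twisted_char R n u)"
  unfolding regular_def using first_order_twisted_char by blast

lemma regular_twist_unit: "regular (twist_unit R)" "regular (inverse (twist_unit R))"
  unfolding regular_def using first_order_twist_unit[of R]
    first_order_unit_power_int[OF first_order_twist_unit, of R "- 1"] by (auto simp: power_int_minus)

text \<open>
  The twist contributes \<open>-\<langle>n, u\<rangle> t \<chi>\<^sup>u\<^sup>-\<^sup>R\<close> in first order, which \<open>1 + t \<chi>\<^sup>-\<^sup>R \<partial>\<^sub>n\<close> cancels.
\<close>

lemma taylor_twisted_char: "taylor (degree_field R n) (twisted_char R n u) = Dual (chi u) 0"
  by (simp add: taylor_eq[OF first_order_twisted_char] degree_field_chi)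

lemma trivialization_char_ring:
  "trivialization (char_ring R n \<tau>) (coord_ring \<tau>) (taylor (degree_field R n))"
  unfolding char_ring_def
  by (intro trivialization_characters derivation_degree_field twisted_char_0 twisted_char_add
      regular_twisted_char taylor_twisted_char)

lemma twist_unit_in_char_ring:
  assumes "- R \<in> dual \<tau>"
  shows "twist_unit R \<in> char_ring R 0 \<tau>"
proof -
  have "twisted_char R 0 (- R) \<in> char_ring R 0 \<tau>" "tvar \<in> char_ring R 0 \<tau>"
    unfolding char_ring_def using assms by (auto intro: adjoin.gen)
  then show ?thesis
    unfolding twist_unit_def untwisted_char char_ring_def by (intro adjoin_diff adjoin.mult) auto
qed

lemma fraction_trivial: "f \<in> adjoin G \<Longrightarrow> \<exists>f'\<in>adjoin G. \<exists>n. f = f' / h ^ n"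
  by (rule bexI[of _ f], rule exI[of _ 0]) auto

lemma unit_ring_eq:
  assumes "- R \<in> dual \<tau>"
  shows "unit_ring R \<tau> = {f / twist_unit R ^ n | f n. f \<in> char_ring R 0 \<tau>}"
  unfolding unit_ring_def char_ring_def
proof (rule adjoin_localization_eq)
  let ?G = "insert tvar (twisted_char R 0 ` dual \<tau>)"
  show g: "twist_unit R \<in> adjoin ?G"
    using twist_unit_in_char_ring[OF assms] unfolding char_ring_def .
  fix f assume f: "f \<in> insert (inverse (twist_unit R)) ?G"
  show "\<exists>f'\<in>adjoin ?G. \<exists>n. f = f' / twist_unit R ^ n"
  proof (cases "f \<in> ?G")
    case True
    then show ?thesis by (intro fraction_trivial adjoin.gen)
  next
    case False
    then have "f = 1 / twist_unit R ^ 1" using f by (simp add: divide_inverse)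
    then show ?thesis using adjoin_1 by blast
  qed
qed (auto intro: adjoin.gen)

lemma unit_ring_localizes_untwisted:
  assumes "- R \<in> dual \<tau>"
  shows "is_localization (unit_ring R \<tau>) (char_ring R 0 \<tau>)"
  unfolding is_localization_def
  using twist_unit_in_char_ring[OF assms] unit_ring_eq[OF assms] twist_unit_nonzero by blast

text \<open>
  The inverse of \<open>g\<close> is \<open>1 + t \<phi>\<close> for the twisted character \<open>\<phi> = \<chi>\<^sup>-\<^sup>R / g\<close>. Once \<open>g\<close> and \<open>1/g\<close> are both available, twisted
  and untwisted characters generate the same ring.
\<close>

lemma unit_ring_localizes_twisted:
  assumes neg: "- R \<in> dual \<tau>" and nR: "pairing n R = 1"
  shows "is_localization (unit_ring R \<tau>) (char_ring R n \<tau>)"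
  unfolding unit_ring_def char_ring_def
proof (rule is_localization_adjoinI)
  let ?g = "twist_unit R"
  let ?G = "insert tvar (twisted_char R n ` dual \<tau>)"
  let ?H = "insert (inverse ?g) (insert tvar (twisted_char R 0 ` dual \<tau>))"
  have "inverse ?g = 1 + tvar * twisted_char R n (- R)"
  proof -
    have "?g * (1 + tvar * twisted_char R n (- R)) = ?g + tvar * incl (chi (- R))"
      by (simp add: twisted_char_def pairing_lin nR power_int_minus distrib_left)
    also have "\<dots> = 1"
      by (simp add: twist_unit_def)
    finally show ?thesis by (metis inverse_unique)
  qed
  moreover have "1 + tvar * twisted_char R n (- R) \<in> adjoin ?G"
    using neg by (intro adjoin.add adjoin.mult adjoin_1 adjoin.gen) auto
  ultimately show inv: "inverse ?g \<in> adjoin ?G" by simp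
  show "inverse ?g \<noteq> 0" by simp
  have g: "?g \<in> adjoin ?H"
    using twist_unit_in_char_ring[OF neg] adjoin_subset[of _ ?H] unfolding char_ring_def
    by (auto intro: adjoin.gen)
  then show "inverse (inverse ?g) \<in> adjoin ?H" by simp
  have "incl (chi u) * ?g powi j \<in> adjoin ?H" if "u \<in> dual \<tau>" for u j
    using that by (intro adjoin.mult adjoin_power_int g adjoin.gen) (auto simp flip: untwisted_char[of R])
  then show "?G \<subseteq> adjoin ?H"
    by (auto simp: twisted_char_def intro: adjoin.gen)
  fix f assume "f \<in> ?H"
  then consider "f = inverse ?g" | "f = tvar" | u where "u \<in> dual \<tau>" "f = twisted_char R 0 u"
    by blast
  then show "\<exists>f'\<in>adjoin ?G. \<exists>j. f = f' / inverse ?g ^ j"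
  proof cases
    case 1
    then show ?thesis using inv by (simp add: fraction_trivial)
  next
    case 2
    then show ?thesis by (intro fraction_trivial adjoin.gen) simp
  next
    case 3
    have \<phi>: "twisted_char R n u \<in> adjoin ?G"
      using 3(1) by (intro adjoin.gen) simp
    show ?thesis
    proof (cases "pairing n u" rule: int_cases2)
      case (nonneg j)
      have "f = twisted_char R n u * inverse ?g ^ j"
        by (simp add: 3(2) pairing_lin twisted_char_def nonneg power_inverse)
      then show ?thesis
        using \<phi> inv by (simp add: fraction_trivial adjoin.mult adjoin_power)
    next
      case (nonpos j)
      have "f = twisted_char R n u / inverse ?g ^ j"
        by (simp add: 3(2) pairing_lin twisted_char_def nonpos power_int_minus power_inverse)
      then show ?thesis using \<phi> by blast
    qed
  qed
qed

text \<open>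
  Adding a large multiple of \<open>u\<close> makes \<open>w\<close> nonnegative on the generators outside the face; on the generators in the face \<open>u\<close> vanishes and
  \<open>w\<close> is nonnegative already.
\<close>

lemma face_dual:
  assumes G: "finite G" and u: "u \<in> dual (cone_of G)"
    and \<tau>: "\<tau> = {v \<in> cone_of G. pairing_rat v u = 0}"
  shows "w \<in> dual \<tau> \<Longrightarrow> \<exists>N. w + lscale (int N) u \<in> dual (cone_of G)"
    and "- u \<in> dual \<tau>"
    and "dual (cone_of G) \<subseteq> dual \<tau>"
proof -
  assume w: "w \<in> dual \<tau>"
  define N where "N = (\<Sum>v\<in>G. nat \<bar>pairing v w\<bar>)"
  have "0 \<le> pairing v (w + lscale (int N) u)" if v: "v \<in> G" for v
  proof (cases "pairing v u = 0")
    case True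
    then have "rat_point v \<in> \<tau>"
      using generator_in_cone[OF G v] by (simp add: \<tau> pairing_rat_point)
    then have "0 \<le> pairing_rat (rat_point v) w"
      using w unfolding dual_lattice_points_def by blast
    then show ?thesis
      using True by (simp add: pairing_rat_point pairing_lin)
  next
    case False
    moreover have "0 \<le> pairing v u"
      using u v unfolding dual_cone_of[OF G] by simp
    ultimately have "1 \<le> pairing v u" by simp
    moreover have "nat \<bar>pairing v w\<bar> \<le> N"
      unfolding N_def using G v by (intro member_le_sum) auto
    then have "- pairing v w \<le> int N" by linarith
    ultimately have "- pairing v w \<le> int N * pairing v u"
      by (smt (verit) mult_left_mono mult_cancel_left1 of_nat_0_le_iff)
    then show ?thesis by (simp add: pairing_lin)
  qed
  then show "\<exists>N. w + lscale (int N) u \<in> dual (cone_of G)"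
    unfolding dual_cone_of[OF G] by blast
next
  show "- u \<in> dual \<tau>"
    by (simp add: dual_lattice_points_def \<tau> pairing_rat_lin)
  show "dual (cone_of G) \<subseteq> dual \<tau>"
    by (rule dual_antimono) (auto simp: \<tau>)
qed

lemma face_localization:
  assumes G: "finite G" and u: "u \<in> dual (cone_of G)"
    and \<tau>: "\<tau> = {v \<in> cone_of G. pairing_rat v u = 0}"
  shows "is_localization (adjoin (E \<union> twisted_char R n ` dual \<tau>))
    (adjoin (E \<union> twisted_char R n ` dual (cone_of G)))"
proof (rule is_localization_adjoinI)
  let ?G = "E \<union> twisted_char R n ` dual (cone_of G)"
  let ?H = "E \<union> twisted_char R n ` dual \<tau>"
  show "twisted_char R n u \<in> adjoin ?G"
    using u by (auto intro: adjoin.gen)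
  show "twisted_char R n u \<noteq> 0" by simp
  show "?G \<subseteq> adjoin ?H"
    using face_dual(3)[OF G u \<tau>] by (auto intro: adjoin.gen)
  show "inverse (twisted_char R n u) \<in> adjoin ?H"
    using face_dual(2)[OF G u \<tau>] unfolding twisted_char_minus[symmetric] by (auto intro: adjoin.gen)
  fix f assume "f \<in> ?H"
  then consider "f \<in> E" | w where "w \<in> dual \<tau>" "f = twisted_char R n w" by blast
  then show "\<exists>f'\<in>adjoin ?G. \<exists>j. f = f' / twisted_char R n u ^ j"
  proof cases
    case 1
    then show ?thesis by (intro fraction_trivial adjoin.gen) simp
  next
    case 2
    obtain N where N: "w + lscale (int N) u \<in> dual (cone_of G)"
      using face_dual(1)[OF G u \<tau> 2(1)] by blast
    have "f = twisted_char R n (w + lscale (int N) u) / twisted_char R n u ^ N"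
      by (simp add: 2(2) twisted_char_add twisted_char_lscale)
    moreover have "twisted_char R n (w + lscale (int N) u) \<in> adjoin ?G"
      using N by (auto intro: adjoin.gen)
    ultimately show ?thesis by blast
  qed
qed

lemma char_ring_localization:
  assumes "finite G" and "u \<in> dual (cone_of G)"
    and "\<tau> = {v \<in> cone_of G. pairing_rat v u = 0}"
  shows "is_localization (char_ring R n \<tau>) (char_ring R n (cone_of G))"
  using face_localization[OF assms, of "{tvar}"] by (simp add: char_ring_def)

lemma unit_ring_localization:
  assumes "finite G" and "u \<in> dual (cone_of G)"
    and "\<tau> = {v \<in> cone_of G. pairing_rat v u = 0}"
  shows "is_localization (unit_ring R \<tau>) (unit_ring R (cone_of G))"
  using face_localization[OF assms, of "{inverse (twist_unit R), tvar}"] by (simp add: unit_ring_def)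

lemma trivialization_unit_ring:
  assumes neg: "- R \<in> dual \<tau>" and d: "d \<in> vector_fields \<tau>"
  shows "trivialization (unit_ring R \<tau>) (coord_ring \<tau>) (taylor d)"
  unfolding unit_ring_def
proof (rule trivialization_twist[OF _ d])
  let ?G = "insert tvar (twisted_char R 0 ` dual \<tau>)"
  show reg: "regular f" if "f \<in> insert (inverse (twist_unit R)) ?G" for f
    using that by (auto intro: regular_twist_unit regular_tvar regular_twisted_char)
  show "tvar \<in> adjoin (insert (inverse (twist_unit R)) ?G)"
    by (intro adjoin.gen) simp
  have zero: "degree_field R 0 = (\<lambda>f. 0)"
    by (simp add: fun_eq_iff degree_field_0)
  show "trivialization (adjoin (insert (inverse (twist_unit R)) ?G)) (coord_ring \<tau>) (taylor (\<lambda>f. 0))"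
  proof (rule trivialization_localize)
    show "trivialization (adjoin ?G) (coord_ring \<tau>) (taylor (\<lambda>f. 0))"
      using trivialization_char_ring[of R 0 \<tau>] unfolding zero char_ring_def .
    show "is_derivation (\<lambda>f. 0)" by (rule derivation_zero)
    show "tvar \<in> adjoin ?G" by (intro adjoin.gen) simp
    show "twist_unit R \<in> adjoin ?G"
      using twist_unit_in_char_ring[OF neg] unfolding char_ring_def .
    show "twist_unit R \<noteq> 0" by simp
    show "adjoin (insert (inverse (twist_unit R)) ?G) = {f / twist_unit R ^ n | f n. f \<in> adjoin ?G}"
      using unit_ring_eq[OF neg] unfolding unit_ring_def char_ring_def .
    show "taylor (\<lambda>f. 0) (twist_unit R) = Dual 1 (- chi (- R))"
      by (simp add: taylor_eq[OF first_order_twist_unit])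
    show "- chi (- R) \<in> coord_ring \<tau>"
      using neg by (intro coord.spanned_minus coord.spanned_char)
  qed (rule reg)
qed

text \<open>
  Each lattice point \<open>u\<close> with \<open>\<langle>n, u\<rangle> = j \<ge> 0\<close> is the sum of \<open>j R\<close> and a point orthogonal to \<open>n\<close>, whose character is not
  twisted. So both rings are generated over the same characters, one by \<open>y\<close> and \<open>t\<close>, the other by \<open>y g = y - t\<close>
  and \<open>t\<close>.
\<close>

lemma char_ring_ray:
  assumes "pairing n R = 1"
  shows "char_ring R n (cone_of {n}) = char_ring R 0 (cone_of {n})"
  unfolding char_ring_def
proof (rule adjoin_eqI)
  have dual_eq: "dual (cone_of {n}) = {w. 0 \<le> pairing n w}"
    by (simp add: dual_cone_of)
  let ?G = "insert tvar (twisted_char R n ` dual (cone_of {n}))"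
  let ?H = "insert tvar (twisted_char R 0 ` dual (cone_of {n}))"
  have gen: "tvar \<in> adjoin ?G" "tvar \<in> adjoin ?H"
    "\<And>u. 0 \<le> pairing n u \<Longrightarrow> twisted_char R n u \<in> adjoin ?G"
    "\<And>u. 0 \<le> pairing n u \<Longrightarrow> incl (chi u) \<in> adjoin ?H"
    by (auto simp: dual_eq untwisted_char intro!: adjoin.gen)
  have unit: "incl (chi R) * twist_unit R = incl (chi R) - tvar"
    by (simp add: twist_unit_def chi_minus incl_inverse right_diff_distrib)
  have split: "incl (chi u) = incl (chi (u - lscale (int j) R)) * incl (chi R) ^ j" for u j
    by (simp add: chi_diff chi_lscale incl_divide flip: incl_power_int power_int_of_nat)
  show "?G \<subseteq> adjoin ?H"
  proof
    fix f assume "f \<in> ?G"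
    then consider "f = tvar" | u where "0 \<le> pairing n u" "f = twisted_char R n u"
      unfolding dual_eq by blast
    then show "f \<in> adjoin ?H"
    proof cases
      case 2
      obtain j where j: "pairing n u = int j"
        using 2(1) nonneg_int_cases by blast
      have "f = incl (chi (u - lscale (int j) R)) * (incl (chi R) * twist_unit R) ^ j"
        by (simp add: 2(2) twisted_char_def j power_mult_distrib mult.assoc[symmetric] flip: split)
      moreover have "0 \<le> pairing n (u - lscale (int j) R)" "0 \<le> pairing n R"
        by (simp_all add: pairing_lin j assms)
      ultimately show ?thesis
        unfolding unit by (auto intro!: adjoin.mult adjoin_power adjoin_diff gen)
    qed (simp add: gen)
  qed
  show "?H \<subseteq> adjoin ?G"
  proof
    fix f assume "f \<in> ?H"
    then consider "f = tvar" | u where "0 \<le> pairing n u" "f = incl (chi u)"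
      unfolding dual_eq untwisted_char by blast
    then show "f \<in> adjoin ?G"
    proof cases
      case 2
      obtain j where j: "pairing n u = int j"
        using 2(1) nonneg_int_cases by blast
      have "twisted_char R n (u - lscale (int j) R) = incl (chi (u - lscale (int j) R))"
        "twisted_char R n R = incl (chi R) - tvar"
        by (simp_all add: twisted_char_def pairing_lin j assms unit)
      then have "f = twisted_char R n (u - lscale (int j) R) * (twisted_char R n R + tvar) ^ j"
        using split[of u j] 2(2) by simp
      moreover have "0 \<le> pairing n (u - lscale (int j) R)" "0 \<le> pairing n R"
        by (simp_all add: pairing_lin j assms)
      ultimately show ?thesis
        by (auto intro!: adjoin.mult adjoin_power adjoin.add gen)
    qed (simp add: gen)
  qed
qed

lemma degree_field_in_vector_fields_ray:
  assumes "pairing n R = 1"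
  shows "degree_field R n \<in> vector_fields (cone_of {n})"
  unfolding degree_field_def vf_in_vector_fields_iff
proof
  fix w assume "w \<in> dual (cone_of {n})"
  then have "0 \<le> pairing n w" by (simp add: dual_cone_of)
  then have "pairing n w = 0 \<or> 0 \<le> pairing n (w - R)"
    by (auto simp: pairing_lin assms)
  moreover have "cpair (of_int (fst n), of_int (snd n)) w = of_int (pairing n w)"
    by (simp add: cpair_def pairing_def)
  ultimately show "cpair (of_int (fst n), of_int (snd n)) w = 0 \<or> w + - R \<in> dual (cone_of {n})"
    by (auto simp: dual_cone_of)
qed

lemma vf_in_vector_fields_if_regular:
  assumes "u \<in> dual \<tau>"
  shows "vf u n \<in> vector_fields \<tau>"
  unfolding vf_in_vector_fields_iff using assms dual_add by blast

section \<open>The charts and overlaps of the step deformations\<close>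

context sliced_fan
begin

lemma dual_max_cone: "dual (\<sigma> i) = {w. 0 \<le> pairing (\<nu> i) w \<and> 0 \<le> pairing (\<nu> (Suc i)) w}"
  unfolding max_cone_def by (subst dual_cone_of) auto

lemma dual_basis:
  assumes i: "i < l"
  shows "pairing (\<nu> i) (w1 \<nu> i) = 1" "pairing (\<nu> (Suc i)) (w1 \<nu> i) = 0"
    "pairing (\<nu> i) (w2 \<nu> i) = 0" "pairing (\<nu> (Suc i)) (w2 \<nu> i) = 1"
    "det2 (w1 \<nu> i) (w2 \<nu> i) = 1"
  using det_1[OF i] by (simp_all add: w1_def w2_def pairing_def det2_def algebra_simps)

lemma w_in_dual:
  assumes "i < l"
  shows "w1 \<nu> i \<in> dual (\<sigma> i)" "w2 \<nu> i \<in> dual (\<sigma> i)"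
  by (simp_all add: dual_max_cone dual_basis[OF assms])

lemma dual_expansion:
  assumes i: "i < l"
  shows "u = lscale (pairing (\<nu> i) u) (w1 \<nu> i) + lscale (pairing (\<nu> (Suc i)) u) (w2 \<nu> i)"
  using cramer[OF dual_basis(5)[OF i], of u]
  by (simp add: w1_def w2_def pairing_def det2_def algebra_simps)

lemma dual_generated:
  assumes i: "i < l" and u: "u \<in> dual (\<sigma> i)"
  shows "\<exists>a b. u = lscale (int a) (w1 \<nu> i) + lscale (int b) (w2 \<nu> i)"
proof -
  obtain a b where "pairing (\<nu> i) u = int a" "pairing (\<nu> (Suc i)) u = int b"
    using u unfolding dual_max_cone by (metis (no_types, lifting) mem_Collect_eq nonneg_int_cases)
  then show ?thesis using dual_expansion[OF i, of u] by metis
qed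

lemma char_ring_generators:
  assumes i: "i < l"
  shows "adjoin {tvar, twisted_char R n (w1 \<nu> i), twisted_char R n (w2 \<nu> i)} = char_ring R n (\<sigma> i)"
  unfolding char_ring_def
proof (rule adjoin_eqI)
  let ?G = "{tvar, twisted_char R n (w1 \<nu> i), twisted_char R n (w2 \<nu> i)}"
  show "?G \<subseteq> adjoin (insert tvar (twisted_char R n ` dual (\<sigma> i)))"
    using w_in_dual[OF i] by (auto intro: adjoin.gen)
  have "twisted_char R n u \<in> adjoin ?G" if "u \<in> dual (\<sigma> i)" for u
  proof -
    obtain a b where "u = lscale (int a) (w1 \<nu> i) + lscale (int b) (w2 \<nu> i)"
      using dual_generated[OF i \<open>u \<in> dual (\<sigma> i)\<close>] by blast
    then have "twisted_char R n u = twisted_char R n (w1 \<nu> i) ^ a * twisted_char R n (w2 \<nu> i) ^ b"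
      by (simp add: twisted_char_add twisted_char_lscale)
    also have "\<dots> \<in> adjoin ?G"
      by (intro adjoin.mult adjoin_power adjoin.gen) auto
    finally show ?thesis .
  qed
  then show "insert tvar (twisted_char R n ` dual (\<sigma> i)) \<subseteq> adjoin ?G"
    by (auto intro: adjoin.gen)
qed

lemma chi_coords: "chi w = chi S powi coord_r S R w * chi R powi coord_s S R w"
proof -
  have "w = lscale (coord_r S R w) S + lscale (coord_s S R w) R"
    using cramer[OF SR, of w] by (simp add: coord_r_def coord_s_def)
  then show ?thesis by (metis chi_add chi_lscale)
qed

lemma pairing_coords: "pairing (\<nu> i) w = coord_r S R w * x i + coord_s S R w * h i"
proof -
  have "w = lscale (coord_r S R w) S + lscale (coord_s S R w) R"
    using cramer[OF SR, of w] by (simp add: coord_r_def coord_s_def)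
  then have "pairing (\<nu> i) w = pairing (\<nu> i) (lscale (coord_r S R w) S + lscale (coord_s S R w) R)"
    by simp
  then show ?thesis by (simp add: pairing_lin x_def h_def)
qed

lemma y_minus_t: "incl (chi R) - tvar = incl (chi R) * twist_unit R"
  by (simp add: twist_unit_def chi_minus incl_inverse right_diff_distrib)

lemma Z_tilde_untwisted: "Z_tilde S R 1 0 w = twisted_char R 0 w"
  by (simp add: Z_tilde_def untwisted_char incl_power_int chi_coords[of w])

text \<open>
  The exponent \<open>s + \<lambda> r\<close> of \<open>y - t\<close> is the value of \<open>\<nu>(\<rho>\<^sub>k) = (x k, 1)\<close> at \<open>w\<close>, since \<open>\<lambda> = x k\<close>.
\<close>

lemma Z_tilde_twisted:
  assumes "h k = 1"
  shows "Z_tilde S R (- 1) (x k) w = twisted_char R (\<nu> k) w"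
proof -
  define r s where "r = coord_r S R w" and "s = coord_s S R w"
  have y: "incl (chi R) \<noteq> 0" by simp
  have p: "pairing (\<nu> k) w = s + x k * r"
    using assms by (simp add: pairing_coords r_def s_def mult.commute)
  have "Z_tilde S R (- 1) (x k) w = incl (chi S) powi r * (incl (chi R) powi (- x k * r) *
      incl (chi R) powi (s + x k * r)) * twist_unit R powi (s + x k * r)"
    by (simp add: Z_tilde_def Let_def y_minus_t power_int_mult_distrib mult.assoc flip: r_def s_def)
  also have "incl (chi R) powi (- x k * r) * incl (chi R) powi (s + x k * r) = incl (chi R) powi s"
    using y by (simp flip: power_int_add)
  finally show ?thesis
    unfolding twisted_char_def p chi_coords[of w] r_def s_def by (simp add: incl_power_int)
qed

lemma seg_inter:
  assumes "i < l" "Suc i < l" and "h (Suc i) = 1"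
  shows "seg S R \<nu> i \<inter> seg S R \<nu> (Suc i) = {of_int (x (Suc i))}"
proof -
  have "x (Suc i) * h i \<le> x i" "x (Suc (Suc i)) \<le> x (Suc i) * h (Suc (Suc i))"
    using xh_1[OF assms(1)] xh_1[OF assms(2)] assms(3) by (simp_all add: algebra_simps)
  then have "(of_int (x (Suc i) * h i) :: rat) \<le> of_int (x i)"
    "(of_int (x (Suc (Suc i))) :: rat) \<le> of_int (x (Suc i) * h (Suc (Suc i)))"
    by (simp_all only: of_int_le_iff)
  then show ?thesis
    using assms(3) by (auto simp: seg_iff[OF assms(1)] seg_iff[OF assms(2)])
qed

lemma neg_R_in_dual_iff: "- R \<in> dual \<tau> \<longleftrightarrow> (\<forall>v\<in>\<tau>. pairing_rat v R \<le> 0)"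
  by (auto simp: dual_lattice_points_def pairing_rat_lin)

lemma neg_R_in_dual_max_cone:
  assumes "m + 1 < i" and "i < l"
  shows "- R \<in> dual (\<sigma> i)"
  using height_nonpos[OF assms] by (simp add: dual_max_cone pairing_lin h_def)

end

locale step_family = sliced_fan +
  fixes k :: nat
  assumes k: "2 \<le> k" "k \<le> m" and height_k: "h k = 1"
begin

definition twist :: "nat \<Rightarrow> lattice" where
  "twist i = (if k \<le> i \<and> i \<le> m + 1 then \<nu> k else 0)"

abbreviation twist_field :: "nat \<Rightarrow> K0 \<Rightarrow> K0" where
  "twist_field i \<equiv> degree_field R (twist i)"

abbreviation chart :: "nat \<Rightarrow> K set" where
  "chart \<equiv> step_deformation \<nu> m S R k"

lemma pairing_k: "pairing (\<nu> k) R = 1"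
  using height_k by (simp add: h_def)

lemma seg_inter_k: "seg S R \<nu> (k - 1) \<inter> seg S R \<nu> k = {of_int (x k)}"
  using seg_inter[of "k - 1"] k m_less height_k by simp

lemma admissible_step: "admissible \<nu> m S R (step_tuple k)"
  unfolding admissible_def
proof (intro conjI allI impI)
  fix i assume "i \<le> m" "step_tuple k i \<noteq> step_tuple k (Suc i)"
  then have "Suc i = k" by (auto simp: step_tuple_def split: if_splits)
  then show "\<exists>j::int. seg S R \<nu> i \<inter> seg S R \<nu> (Suc i) = {of_int j}"
    using seg_inter_k by auto
qed (simp add: step_tuple_def)

text \<open>
  At the step the new shift is \<open>x k - 0\<close>, the lattice point in which the two segments meet.
\<close>

lemma shift_step: "shift \<nu> m S R 0 (step_tuple k) i = (if k \<le> i \<and> i \<le> m + 1 then x k else 0)"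
proof (induction i)
  case (Suc i)
  consider "m + 1 < Suc i" | "Suc i \<le> m + 1" "Suc i = k" | "Suc i \<le> m + 1" "Suc i \<noteq> k" by linarith
  then show ?case
  proof cases
    case 2
    have eq: "seg S R \<nu> i \<inter> seg S R \<nu> (Suc i) = {of_int (x k)}"
      using seg_inter_k unfolding 2(2)[symmetric] by simp
    have "(THE j::int. seg S R \<nu> i \<inter> seg S R \<nu> (Suc i) = {of_int j}) = x k"
      unfolding eq by (rule the_equality) simp_all
    moreover have "step_tuple k (Suc i) \<noteq> step_tuple k i"
      using 2(2) by (auto simp: step_tuple_def)
    moreover have "shift \<nu> m S R 0 (step_tuple k) i = 0"
      unfolding Suc using 2(2) by simp
    ultimately show ?thesis
      using 2(1) unfolding 2(2)[symmetric] by simp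
  next
    case 3
    have "step_tuple k (Suc i) = step_tuple k i"
      using 3(2) by (auto simp: step_tuple_def)
    moreover have "k \<le> Suc i \<longleftrightarrow> k \<le> i" using 3(2) by linarith
    ultimately show ?thesis using 3(1) Suc by simp
  qed simp
qed (use k in simp)

lemma chart_generators:
  "chart i = adjoin ({tvar, twisted_char R (twist i) (w1 \<nu> i), twisted_char R (twist i) (w2 \<nu> i)} \<union>
     (if i \<le> m + 1 then {} else {inverse (twist_unit R)}))"
proof -
  have Z: "Z_tilde S R (tuple_ext m (step_tuple k) i) (shift \<nu> m S R 0 (step_tuple k) i) w
      = twisted_char R (twist i) w" for w
    by (auto simp: shift_step tuple_ext_def step_tuple_def twist_def Z_tilde_untwisted
        Z_tilde_twisted[OF height_k])
  have "incl (chi R) / (incl (chi R) - tvar) = inverse (twist_unit R)"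
    by (simp add: y_minus_t divide_inverse mult.assoc[symmetric])
  then show ?thesis
    by (simp add: step_deformation_def deformation_def Z insert_commute)
qed

lemma twist_beyond: "m + 1 < i \<Longrightarrow> twist i = 0"
  by (simp add: twist_def)

lemma twist_cases: "twist i = 0 \<or> pairing (twist i) R = 1"
  by (simp add: twist_def pairing_k)

lemma chart_inner: "i \<le> m + 1 \<Longrightarrow> chart i = char_ring R (twist i) (\<sigma> i)"
  using char_ring_generators[of i "twist i"] m_less by (simp add: chart_generators)

lemma chart_outer:
  assumes "m + 1 < i" and i: "i < l"
  shows "chart i = unit_ring R (\<sigma> i)"
proof -
  let ?G = "{tvar, twisted_char R 0 (w1 \<nu> i), twisted_char R 0 (w2 \<nu> i)}"
  have eq: "adjoin ?G = char_ring R 0 (\<sigma> i)"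
    by (rule char_ring_generators[OF i])
  have "chart i = adjoin (insert (inverse (twist_unit R)) ?G)"
    using assms by (simp add: chart_generators twist_beyond insert_commute)
  also have "\<dots> = unit_ring R (\<sigma> i)"
    unfolding unit_ring_def
  proof (rule adjoin_eqI)
    have mono: "adjoin A \<subseteq> adjoin (insert (inverse (twist_unit R)) A)" for A
      by (rule adjoin_subset) (auto intro: adjoin.gen)
    let ?H = "insert tvar (twisted_char R 0 ` dual (\<sigma> i))"
    have "?G \<subseteq> adjoin ?H" "?H \<subseteq> adjoin ?G"
      using eq unfolding char_ring_def by (metis adjoin.gen subsetI)+
    then show "insert (inverse (twist_unit R)) ?G \<subseteq> adjoin (insert (inverse (twist_unit R)) ?H)"
      "insert (inverse (twist_unit R)) ?H \<subseteq> adjoin (insert (inverse (twist_unit R)) ?G)"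
      using mono[of ?G] mono[of ?H] by (auto intro: adjoin.gen)
  qed
  finally show ?thesis .
qed

lemma trivialization_chart:
  assumes "i < l"
  shows "trivialization (chart i) (coord_ring (\<sigma> i)) (taylor (twist_field i))"
proof (cases "i \<le> m + 1")
  case True
  then show ?thesis by (simp add: chart_inner trivialization_char_ring)
next
  case False
  have zero: "degree_field R 0 = (\<lambda>f. 0)"
    by (simp add: fun_eq_iff degree_field_0)
  show ?thesis
    using False assms
    by (simp add: chart_outer twist_beyond zero trivialization_unit_ring neg_R_in_dual_max_cone vector_fields_0)
qed

lemma inner_localization:
  assumes i: "i \<le> m + 1" and j: "j < l"
  shows "is_localization (char_ring R (twist i) (\<sigma> i \<inter> \<sigma> j)) (chart i)"
proof -
  have il: "i < l" using i m_less by simp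
  obtain u where "u \<in> dual (\<sigma> i)" "\<sigma> i \<inter> \<sigma> j = {v \<in> \<sigma> i. pairing_rat v u = 0}"
    using face_vector[OF il j] .
  then show ?thesis
    unfolding chart_inner[OF i] max_cone_def by (intro char_ring_localization) auto
qed

lemma unit_localization:
  assumes i: "i < l" and j: "j < l" and neg: "- R \<in> dual (\<sigma> i \<inter> \<sigma> j)"
  shows "is_localization (unit_ring R (\<sigma> i \<inter> \<sigma> j)) (chart i)"
proof (cases "i \<le> m + 1")
  case True
  have "is_localization (unit_ring R (\<sigma> i \<inter> \<sigma> j)) (char_ring R (twist i) (\<sigma> i \<inter> \<sigma> j))"
    using twist_cases[of i] unit_ring_localizes_untwisted[OF neg]
      unit_ring_localizes_twisted[OF neg, of "twist i"] by auto
  then show ?thesis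
    using inner_localization[OF True j] is_localization_trans unfolding chart_inner[OF True] char_ring_def
    by blast
next
  case False
  obtain u where "u \<in> dual (\<sigma> i)" "\<sigma> i \<inter> \<sigma> j = {v \<in> \<sigma> i. pairing_rat v u = 0}"
    using face_vector[OF i j] .
  then have "is_localization (unit_ring R (\<sigma> i \<inter> \<sigma> j)) (unit_ring R (\<sigma> i))"
    unfolding max_cone_def by (intro unit_ring_localization) auto
  then show ?thesis
    using False i by (simp add: chart_outer)
qed

text \<open>
  If \<open>\<chi>\<^sup>-\<^sup>R\<close> is not regular on the overlap, then the two cones meet above height zero; so they are equal or adjacent, and
  charts twisted differently meet in \<open>\<rho>\<^sub>k\<close>.
\<close>

lemma overlap_above:
  assumes i: "i < l" and j: "j < l" and above: "- R \<notin> dual (\<sigma> i \<inter> \<sigma> j)"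
  shows "i \<le> m + 1" and "j \<le> m + 1"
    and "twist i = twist j \<or> \<sigma> i \<inter> \<sigma> j = cone_of {\<nu> k} \<and> {twist i, twist j} = {0, \<nu> k}"
proof -
  have sub: "dual (\<sigma> i) \<subseteq> dual (\<sigma> i \<inter> \<sigma> j)"
    "dual (\<sigma> j) \<subseteq> dual (\<sigma> i \<inter> \<sigma> j)"
    by (auto intro!: dual_antimono)
  show bounds: "i \<le> m + 1" "j \<le> m + 1"
    using neg_R_in_dual_max_cone[of i] neg_R_in_dual_max_cone[of j] sub above i j
    by (meson not_less subsetD)+
  obtain v where v: "v \<in> \<sigma> i \<inter> \<sigma> j" "pairing_rat v R > 0"
    using above unfolding neg_R_in_dual_iff by (auto simp: not_le)
  have adj: "j = Suc i \<or> i = Suc j \<or> i = j"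
    using inter_above_imp_adjacent[of i j v] inter_above_imp_adjacent[of j i v] v bounds
    by (metis Int_commute linorder_neqE_nat)
  show "twist i = twist j \<or> \<sigma> i \<inter> \<sigma> j = cone_of {\<nu> k} \<and> {twist i, twist j} = {0, \<nu> k}"
  proof (cases "twist i = twist j")
    case False
    then have "(Suc i = k \<and> j = k) \<or> (Suc j = k \<and> i = k)"
      using adj bounds by (auto simp: twist_def split: if_splits)
    then show ?thesis
      using adjacent_cones_inter[of i] adjacent_cones_inter[of j] i j k
      by (auto simp: twist_def Int_commute)
  qed simp
qed

text \<open>
  Either \<open>\<chi>\<^sup>-\<^sup>R\<close> is regular on the overlap, so that all fields of degree \<open>-R\<close> are regular and \<open>g\<close> may be inverted, or the
  overlap lies in charts of one kind or is the chart of \<open>\<rho>\<^sub>k\<close>, where twisting does not change the ring.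
\<close>

lemma overlap:
  assumes i: "i < l" and j: "j < l"
  shows "(\<lambda>f. twist_field j f - twist_field i f) \<in> vector_fields (\<sigma> i \<inter> \<sigma> j) \<and>
    (\<exists>B. is_localization B (chart i) \<and> is_localization B (chart j) \<and>
      trivialization B (coord_ring (\<sigma> i \<inter> \<sigma> j)) (taylor (twist_field i)) \<and>
      trivialization B (coord_ring (\<sigma> i \<inter> \<sigma> j)) (taylor (twist_field j)) \<and>
      (\<forall>f\<in>B. regular f))"
proof (cases "- R \<in> dual (\<sigma> i \<inter> \<sigma> j)")
  case True
  have VF: "twist_field i' \<in> vector_fields (\<sigma> i \<inter> \<sigma> j)" for i'
    unfolding degree_field_def using True by (rule vf_in_vector_fields_if_regular)
  have "is_localization (unit_ring R (\<sigma> i \<inter> \<sigma> j)) (chart j)"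
    using unit_localization[OF j i] True by (simp add: Int_commute)
  moreover have "regular f" if "f \<in> unit_ring R (\<sigma> i \<inter> \<sigma> j)" for f
    using that unfolding unit_ring_def
    by (elim regular_adjoin[rotated]) (auto intro: regular_twist_unit regular_tvar regular_twisted_char)
  ultimately show ?thesis
    using unit_localization[OF i j True] trivialization_unit_ring[OF True VF] vector_fields_diff[OF VF VF]
    by blast
next
  case False
  note above = overlap_above[OF i j False]
  have "is_localization (char_ring R (twist j) (\<sigma> i \<inter> \<sigma> j)) (chart j)"
    using inner_localization[OF above(2) i] by (simp add: Int_commute)
  moreover have "char_ring R (twist i) (\<sigma> i \<inter> \<sigma> j) = char_ring R (twist j) (\<sigma> i \<inter> \<sigma> j)"
    using above(3) char_ring_ray[OF pairing_k] by (auto simp: doubleton_eq_iff)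
  moreover have "regular f" if "f \<in> char_ring R (twist i) (\<sigma> i \<inter> \<sigma> j)" for f
    using that unfolding char_ring_def
    by (elim regular_adjoin[rotated]) (auto intro: regular_tvar regular_twisted_char)
  moreover have "(\<lambda>f. twist_field j f - twist_field i f) \<in> vector_fields (\<sigma> i \<inter> \<sigma> j)"
  proof (cases "twist i = twist j")
    case True
    then show ?thesis by (simp add: vector_fields_0)
  next
    case False
    then have \<tau>: "\<sigma> i \<inter> \<sigma> j = cone_of {\<nu> k}" and tw: "{twist i, twist j} = {0, \<nu> k}"
      using above(3) by auto
    have zero: "degree_field R 0 = (\<lambda>f. 0)"
      by (simp add: fun_eq_iff degree_field_0)
    have VF: "degree_field R n \<in> vector_fields (cone_of {\<nu> k})" if "n \<in> {0, \<nu> k}" for n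
      using that degree_field_in_vector_fields_ray[OF pairing_k] by (auto simp: zero vector_fields_0)
    have "twist i \<in> {0, \<nu> k}" "twist j \<in> {0, \<nu> k}"
      using tw by auto
    then show ?thesis
      unfolding \<tau> by (intro vector_fields_diff VF)
  qed
  ultimately show ?thesis
    using inner_localization[OF above(1) j] trivialization_char_ring by metis
qed

definition cocycle :: cochain where
  "cocycle i j = (if i < l \<and> j < l then (\<lambda>f. twist_field j f - twist_field i f) else (\<lambda>f. 0))"

lemma KS_cocycle_step: "KS_cocycle l \<sigma> chart (\<lambda>i. taylor (twist_field i)) cocycle"
  unfolding KS_cocycle_def
proof (intro conjI allI impI)
  fix i j assume i: "i < l" and j: "j < l"
  note ov = overlap[OF i j]
  show "cocycle i j \<in> vector_fields (\<sigma> i \<inter> \<sigma> j)"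
    using ov i j by (simp add: cocycle_def)
  obtain B where B: "is_localization B (chart i)" "is_localization B (chart j)"
      "trivialization B (coord_ring (\<sigma> i \<inter> \<sigma> j)) (taylor (twist_field i))"
      "trivialization B (coord_ring (\<sigma> i \<inter> \<sigma> j)) (taylor (twist_field j))"
    and reg: "\<And>f. f \<in> B \<Longrightarrow> regular f"
    using ov by blast
  have "taylor (twist_field j) f = id_plus_t (cocycle i j) (taylor (twist_field i) f)" for f
    using i j by (simp add: taylor_def id_plus_t_comp cocycle_def)
  then show "\<exists>B \<theta>i \<theta>j. is_localization B (chart i) \<and> is_localization B (chart j) \<and>
      trivialization B (coord_ring (\<sigma> i \<inter> \<sigma> j)) \<theta>i \<and> (\<forall>f\<in>chart i. \<theta>i f = taylor (twist_field i) f) \<and>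
      trivialization B (coord_ring (\<sigma> i \<inter> \<sigma> j)) \<theta>j \<and> (\<forall>f\<in>chart j. \<theta>j f = taylor (twist_field j) f) \<and>
      (\<forall>f\<in>B. \<theta>j f = id_plus_t (cocycle i j) (\<theta>i f))"
    using B by blast
qed (auto simp: trivialization_chart cocycle_def)

lemma cocycle_in_cocycles: "cocycle \<in> cocycles l \<sigma>"
  unfolding cocycles_def using overlap by (auto simp: cocycle_def)

lemma cocycle_eq_vf:
  "i < l \<Longrightarrow> j < l \<Longrightarrow> cocycle i j = vf (- R) ((of_int (fst (twist j)), of_int (snd (twist j))) -
    (of_int (fst (twist i)), of_int (snd (twist i))))"
  unfolding cocycle_def degree_field_def fun_eq_iff vf_diff by simp

lemma trivializations_of_chart:
  assumes i: "i < l" and triv: "trivialization (chart i) (coord_ring (\<sigma> i)) \<theta>"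
    and triv': "trivialization (chart i) (coord_ring (\<sigma> i)) \<theta>'"
  shows "\<exists>D\<in>vector_fields (\<sigma> i). \<forall>f\<in>chart i. \<theta>' f = id_plus_t D (\<theta> f)"
proof -
  let ?Z1 = "twisted_char R (twist i) (w1 \<nu> i)" and ?Z2 = "twisted_char R (twist i) (w2 \<nu> i)"
  let ?E = "if i \<le> m + 1 then {} else {inverse (twist_unit R)}"
  let ?G = "{tvar, ?Z1, ?Z2} \<union> ?E"
  have val: "value_at_0 (twisted_char R n w) (chi w)" for n w
    using first_order_imp_value_at_0[OF first_order_twisted_char] by simp
  have extra: "\<exists>u\<in>adjoin {tvar, ?Z1, ?Z2}. g * u = 1" if g: "g \<in> ?E" for g
  proof -
    have out: "m + 1 < i" "g = inverse (twist_unit R)" using g by (auto split: if_splits)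
    then have "twist_unit R \<in> adjoin {tvar, ?Z1, ?Z2}"
      using twist_unit_in_char_ring[OF neg_R_in_dual_max_cone[OF _ i]] char_ring_generators[OF i, of 0]
      by (simp add: twist_beyond)
    then show ?thesis using out(2) by (intro bexI[of _ "twist_unit R"]) simp_all
  qed
  obtain D where "D \<in> vector_fields (\<sigma> i)" "\<And>f. f \<in> adjoin ?G \<Longrightarrow> \<theta>' f = id_plus_t D (\<theta> f)"
  proof (rule trivializations_differ_by_vector_field[OF triv[unfolded chart_generators]
        triv'[unfolded chart_generators] w_in_dual[OF i] dual_basis(5)[OF i] dual_generated[OF i]])
    show "?Z1 \<in> ?G" "?Z2 \<in> ?G" "tvar \<in> ?G" by auto
    show "value_at_0 ?Z1 (chi (w1 \<nu> i))" "value_at_0 ?Z2 (chi (w2 \<nu> i))" by (rule val)+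
    show "g \<in> {tvar, ?Z1, ?Z2} \<or> (\<exists>u\<in>adjoin {tvar, ?Z1, ?Z2}. g * u = 1)" if "g \<in> ?G" for g
      using that extra by blast
  qed blast+
  then show ?thesis
    unfolding chart_generators by blast
qed

lemma KS_class_cohomologous:
  assumes "KS_cocycle l \<sigma> chart \<theta> d" and "KS_cocycle l \<sigma> chart \<theta>' d'"
  shows "(\<lambda>i j f. d' i j f - d i j f) \<in> coboundaries l \<sigma>"
proof (rule KS_cocycles_cohomologous[OF assms])
  fix i assume i: "i < l"
  show "\<exists>G. chart i = adjoin G"
    unfolding chart_generators by blast
  show "\<exists>D\<in>vector_fields (\<sigma> i). \<forall>f\<in>chart i. \<theta>' i f = id_plus_t D (\<theta> i f)"
    using assms i unfolding KS_cocycle_def by (intro trivializations_of_chart) simp_all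
  show "\<exists>u\<in>dual (\<sigma> i). v + u \<in> dual (\<sigma> i)" for v
    using dual_full[OF w_in_dual[OF i] dual_basis(5)[OF i]] .
qed

end

section \<open>Graded Cech cohomology as a vector space\<close>

definition homogeneous_cocycles :: "nat \<Rightarrow> (nat \<Rightarrow> cone) \<Rightarrow> lattice \<Rightarrow> cochain set" where
  "homogeneous_cocycles l \<sigma> u = {d \<in> cocycles l \<sigma>. \<forall>i<l. \<forall>j<l. homogeneous u (d i j)}"

lemma coboundaryI:
  "(\<And>i. i < l \<Longrightarrow> D i \<in> vector_fields (\<sigma> i)) \<Longrightarrow>
    (\<lambda>i j f. if i < l \<and> j < l then D j f - D i f else 0) \<in> coboundaries l \<sigma>"
  unfolding coboundaries_def by blast

lemma coboundaryE:
  assumes "b \<in> coboundaries l \<sigma>"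
  obtains D where "\<forall>i<l. D i \<in> vector_fields (\<sigma> i)"
    "b = (\<lambda>i j f. if i < l \<and> j < l then D j f - D i f else 0)"
  using assms unfolding coboundaries_def by blast

lemma coboundaries_0: "(\<lambda>i j f. 0) \<in> coboundaries l \<sigma>"
  using coboundaryI[of l "\<lambda>i f. 0" \<sigma>] by (simp add: vector_fields_0 cong: if_cong)

lemma coboundaries_add:
  assumes "b \<in> coboundaries l \<sigma>" and "b' \<in> coboundaries l \<sigma>"
  shows "(\<lambda>i j f. b i j f + b' i j f) \<in> coboundaries l \<sigma>"
proof -
  obtain D where D: "\<forall>i<l. D i \<in> vector_fields (\<sigma> i)"
    and b: "b = (\<lambda>i j f. if i < l \<and> j < l then D j f - D i f else 0)"
    using assms(1) by (rule coboundaryE)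
  obtain D' where D': "\<forall>i<l. D' i \<in> vector_fields (\<sigma> i)"
    and b': "b' = (\<lambda>i j f. if i < l \<and> j < l then D' j f - D' i f else 0)"
    using assms(2) by (rule coboundaryE)
  have "(\<lambda>i j f. b i j f + b' i j f) = (\<lambda>i j f. if i < l \<and> j < l then (D j f + D' j f) - (D i f + D' i f) else 0)"
    unfolding b b' by (intro ext) simp
  then show ?thesis
    using coboundaryI[of l "\<lambda>i f. D i f + D' i f" \<sigma>] D D' by (simp add: vector_fields_add)
qed

lemma coboundaries_smult:
  assumes "b \<in> coboundaries l \<sigma>"
  shows "(\<lambda>i j f. const0 c * b i j f) \<in> coboundaries l \<sigma>"
proof -
  obtain D where D: "\<forall>i<l. D i \<in> vector_fields (\<sigma> i)"
    and b: "b = (\<lambda>i j f. if i < l \<and> j < l then D j f - D i f else 0)"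
    using assms by (rule coboundaryE)
  have "(\<lambda>i j f. const0 c * b i j f) = (\<lambda>i j f. if i < l \<and> j < l then const0 c * D j f - const0 c * D i f else 0)"
    unfolding b by (intro ext) (simp add: right_diff_distrib)
  then show ?thesis
    using coboundaryI[of l "\<lambda>i f. const0 c * D i f" \<sigma>] D by (simp add: vector_fields_smult)
qed

lemma coboundaries_minus: "b \<in> coboundaries l \<sigma> \<Longrightarrow> (\<lambda>i j f. - b i j f) \<in> coboundaries l \<sigma>"
  using coboundaries_smult[of b l \<sigma> "- 1"] by simp

lemma coboundaries_diff:
  "b \<in> coboundaries l \<sigma> \<Longrightarrow> b' \<in> coboundaries l \<sigma> \<Longrightarrow> (\<lambda>i j f. b i j f - b' i j f) \<in> coboundaries l \<sigma>"
  using coboundaries_add[OF _ coboundaries_minus, of b l \<sigma> b'] by simp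

lemma in_cohomology_class_iff:
  "d' \<in> cohomology_class l \<sigma> d \<longleftrightarrow> (\<lambda>i j f. d' i j f - d i j f) \<in> coboundaries l \<sigma>"
proof
  assume "d' \<in> cohomology_class l \<sigma> d"
  then have "\<exists>b. d' = (\<lambda>i j f. d i j f + b i j f) \<and> b \<in> coboundaries l \<sigma>"
    by (simp only: cohomology_class_def mem_Collect_eq)
  then obtain b where "d' = (\<lambda>i j f. d i j f + b i j f)" "b \<in> coboundaries l \<sigma>"
    by (elim exE conjE)
  then show "(\<lambda>i j f. d' i j f - d i j f) \<in> coboundaries l \<sigma>" by simp
next
  assume b: "(\<lambda>i j f. d' i j f - d i j f) \<in> coboundaries l \<sigma>"
  show "d' \<in> cohomology_class l \<sigma> d"
    unfolding cohomology_class_def using b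
    by (intro CollectI exI[of _ "\<lambda>i j f. d' i j f - d i j f"] conjI) simp_all
qed

lemma cohomology_class_self: "d \<in> cohomology_class l \<sigma> d"
  by (simp add: in_cohomology_class_iff coboundaries_0)

lemma cohomology_class_eq_iff:
  "cohomology_class l \<sigma> d = cohomology_class l \<sigma> d' \<longleftrightarrow> (\<lambda>i j f. d i j f - d' i j f) \<in> coboundaries l \<sigma>"
proof
  assume "cohomology_class l \<sigma> d = cohomology_class l \<sigma> d'"
  then show "(\<lambda>i j f. d i j f - d' i j f) \<in> coboundaries l \<sigma>"
    using cohomology_class_self[of d l \<sigma>] by (simp add: in_cohomology_class_iff)
next
  assume dd': "(\<lambda>i j f. d i j f - d' i j f) \<in> coboundaries l \<sigma>"
  show "cohomology_class l \<sigma> d = cohomology_class l \<sigma> d'"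
  proof (intro equalityI subsetI)
    fix e assume "e \<in> cohomology_class l \<sigma> d"
    then show "e \<in> cohomology_class l \<sigma> d'"
      using coboundaries_add[OF _ dd', of "\<lambda>i j f. e i j f - d i j f"] by (simp add: in_cohomology_class_iff)
  next
    fix e assume "e \<in> cohomology_class l \<sigma> d'"
    then show "e \<in> cohomology_class l \<sigma> d"
      using coboundaries_diff[OF _ dd', of "\<lambda>i j f. e i j f - d' i j f"] by (simp add: in_cohomology_class_iff)
  qed
qed

lemma T1_zero: "zero (T1_degree l \<sigma> u) = cohomology_class l \<sigma> (\<lambda>i j f. 0)"
  by (auto simp: T1_degree_def T1_def in_cohomology_class_iff)

lemma T1_carrier: "carrier (T1_degree l \<sigma> u) = cohomology_class l \<sigma> ` homogeneous_cocycles l \<sigma> u"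
  by (auto simp: T1_degree_def homogeneous_cocycles_def)

lemma T1_add:
  "add (T1_degree l \<sigma> u) (cohomology_class l \<sigma> d) (cohomology_class l \<sigma> d')
    = cohomology_class l \<sigma> (\<lambda>i j f. d i j f + d' i j f)"
proof -
  have "{\<lambda>i j f. e i j f + e' i j f | e e'. e \<in> cohomology_class l \<sigma> d \<and> e' \<in> cohomology_class l \<sigma> d'}
      = cohomology_class l \<sigma> (\<lambda>i j f. d i j f + d' i j f)"
  proof (intro equalityI subsetI)
    fix z assume "z \<in> {\<lambda>i j f. e i j f + e' i j f | e e'. e \<in> cohomology_class l \<sigma> d \<and> e' \<in> cohomology_class l \<sigma> d'}"
    then obtain e e' where z: "z = (\<lambda>i j f. e i j f + e' i j f)"
      and e: "(\<lambda>i j f. e i j f - d i j f) \<in> coboundaries l \<sigma>" "(\<lambda>i j f. e' i j f - d' i j f) \<in> coboundaries l \<sigma>"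
      by (auto simp: in_cohomology_class_iff)
    show "z \<in> cohomology_class l \<sigma> (\<lambda>i j f. d i j f + d' i j f)"
      using coboundaries_add[OF e] by (simp add: z in_cohomology_class_iff algebra_simps)
  next
    fix z assume z: "z \<in> cohomology_class l \<sigma> (\<lambda>i j f. d i j f + d' i j f)"
    define e where "e = (\<lambda>i j f. z i j f - d' i j f)"
    have "e \<in> cohomology_class l \<sigma> d"
      using z by (simp add: e_def in_cohomology_class_iff algebra_simps)
    then show "z \<in> {\<lambda>i j f. e i j f + e' i j f | e e'. e \<in> cohomology_class l \<sigma> d \<and> e' \<in> cohomology_class l \<sigma> d'}"
      by (intro CollectI exI[of _ e] exI[of _ d'] conjI cohomology_class_self) (simp add: e_def)
  qed
  then show ?thesis by (simp add: T1_degree_def T1_def)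
qed

lemma T1_smult:
  "module.smult (T1_degree l \<sigma> u) c (cohomology_class l \<sigma> d) = cohomology_class l \<sigma> (\<lambda>i j f. const0 c * d i j f)"
proof -
  have "{\<lambda>i j f. const0 c * e i j f + b i j f | e b. e \<in> cohomology_class l \<sigma> d \<and> b \<in> coboundaries l \<sigma>}
      = cohomology_class l \<sigma> (\<lambda>i j f. const0 c * d i j f)"
  proof (intro equalityI subsetI)
    fix z assume "z \<in> {\<lambda>i j f. const0 c * e i j f + b i j f | e b. e \<in> cohomology_class l \<sigma> d \<and> b \<in> coboundaries l \<sigma>}"
    then obtain e b where z: "z = (\<lambda>i j f. const0 c * e i j f + b i j f)"
      and e: "(\<lambda>i j f. e i j f - d i j f) \<in> coboundaries l \<sigma>" "b \<in> coboundaries l \<sigma>"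
      by (auto simp: in_cohomology_class_iff)
    show "z \<in> cohomology_class l \<sigma> (\<lambda>i j f. const0 c * d i j f)"
      using coboundaries_add[OF coboundaries_smult[OF e(1), of c] e(2)]
      by (simp add: z in_cohomology_class_iff algebra_simps)
  next
    fix z assume z: "z \<in> cohomology_class l \<sigma> (\<lambda>i j f. const0 c * d i j f)"
    define b where "b = (\<lambda>i j f. z i j f - const0 c * d i j f)"
    have "b \<in> coboundaries l \<sigma>"
      using z by (simp add: b_def in_cohomology_class_iff)
    then show "z \<in> {\<lambda>i j f. const0 c * e i j f + b i j f | e b. e \<in> cohomology_class l \<sigma> d \<and> b \<in> coboundaries l \<sigma>}"
      by (intro CollectI exI[of _ d] exI[of _ b] conjI cohomology_class_self) (simp_all add: b_def)
  qed
  then show ?thesis by (simp add: T1_degree_def T1_def)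
qed

lemma homogeneous_0: "homogeneous u (\<lambda>f. 0)"
  unfolding homogeneous_iff by (rule exI[of _ 0]) (simp add: fun_eq_iff vf_0)

lemma homogeneous_add:
  assumes "homogeneous u D" and "homogeneous u E"
  shows "homogeneous u (\<lambda>f. D f + E f)"
proof -
  obtain n n' where "D = vf u n" "E = vf u n'"
    using assms unfolding homogeneous_iff by blast
  then have "(\<lambda>f. D f + E f) = vf u (n + n')"
    by (simp add: fun_eq_iff vf_add)
  then show ?thesis
    unfolding homogeneous_iff by blast
qed

lemma homogeneous_smult:
  assumes "homogeneous u D"
  shows "homogeneous u (\<lambda>f. const0 c * D f)"
proof -
  obtain n where "D = vf u n"
    using assms unfolding homogeneous_iff by blast
  then have "(\<lambda>f. const0 c * D f) = vf u (c * fst n, c * snd n)"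
    by (simp add: fun_eq_iff vf_smult)
  then show ?thesis
    unfolding homogeneous_iff by blast
qed

lemma homogeneous_cocycles_0: "(\<lambda>i j f. 0) \<in> homogeneous_cocycles l \<sigma> u"
  by (simp add: homogeneous_cocycles_def cocycles_def vector_fields_0 homogeneous_0)

lemma homogeneous_cocycles_add:
  assumes d: "d \<in> homogeneous_cocycles l \<sigma> u" and d': "d' \<in> homogeneous_cocycles l \<sigma> u"
  shows "(\<lambda>i j f. d i j f + d' i j f) \<in> homogeneous_cocycles l \<sigma> u"
proof -
  have "d i j f + d' i j f + (d j k f + d' j k f) = d i k f + d' i k f" if "i < l" "j < l" "k < l" for i j k f
  proof -
    have "d i j f + d j k f = d i k f" "d' i j f + d' j k f = d' i k f"
      using d d' that unfolding homogeneous_cocycles_def cocycles_def by simp_all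
    then show ?thesis by (simp add: algebra_simps)
  qed
  then show ?thesis
    using d d' unfolding homogeneous_cocycles_def cocycles_def
    by (simp add: vector_fields_add homogeneous_add)
qed

lemma homogeneous_cocycles_smult:
  assumes d: "d \<in> homogeneous_cocycles l \<sigma> u"
  shows "(\<lambda>i j f. const0 c * d i j f) \<in> homogeneous_cocycles l \<sigma> u"
  using d unfolding homogeneous_cocycles_def cocycles_def
  by (simp add: vector_fields_smult homogeneous_smult flip: distrib_left)

lemma vectorspace_T1_degree: "vectorspace class_ring (T1_degree l \<sigma> u)"
proof -
  let ?V = "T1_degree l \<sigma> u"
  have rep: "\<exists>d\<in>homogeneous_cocycles l \<sigma> u. x = cohomology_class l \<sigma> d" if "x \<in> carrier ?V" for x
    using that unfolding T1_carrier by blast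
  have closed: "cohomology_class l \<sigma> d \<in> carrier ?V" if "d \<in> homogeneous_cocycles l \<sigma> u" for d
    using that unfolding T1_carrier by blast
  have "abelian_group ?V"
  proof (rule abelian_groupI)
    fix x y assume "x \<in> carrier ?V" "y \<in> carrier ?V"
    then obtain d e where de: "d \<in> homogeneous_cocycles l \<sigma> u" "e \<in> homogeneous_cocycles l \<sigma> u"
      "x = cohomology_class l \<sigma> d" "y = cohomology_class l \<sigma> e"
      using rep by metis
    show "x \<oplus>\<^bsub>?V\<^esub> y \<in> carrier ?V"
      using de by (simp add: T1_add closed homogeneous_cocycles_add)
    show "x \<oplus>\<^bsub>?V\<^esub> y = y \<oplus>\<^bsub>?V\<^esub> x"
      by (simp add: de T1_add add.commute)
  next
    fix x y z assume "x \<in> carrier ?V" "y \<in> carrier ?V" "z \<in> carrier ?V"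
    then show "x \<oplus>\<^bsub>?V\<^esub> y \<oplus>\<^bsub>?V\<^esub> z = x \<oplus>\<^bsub>?V\<^esub> (y \<oplus>\<^bsub>?V\<^esub> z)"
      by (auto simp: T1_carrier T1_add add.assoc)
  next
    fix x assume "x \<in> carrier ?V"
    then obtain d where d: "d \<in> homogeneous_cocycles l \<sigma> u" "x = cohomology_class l \<sigma> d"
      using rep by metis
    show "\<zero>\<^bsub>?V\<^esub> \<oplus>\<^bsub>?V\<^esub> x = x"
      by (simp add: d T1_add T1_zero)
    show "\<exists>y\<in>carrier ?V. y \<oplus>\<^bsub>?V\<^esub> x = \<zero>\<^bsub>?V\<^esub>"
    proof (rule bexI)
      show "cohomology_class l \<sigma> (\<lambda>i j f. const0 (- 1) * d i j f) \<in> carrier ?V"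
        by (rule closed[OF homogeneous_cocycles_smult[OF d(1)]])
      show "cohomology_class l \<sigma> (\<lambda>i j f. const0 (- 1) * d i j f) \<oplus>\<^bsub>?V\<^esub> x = \<zero>\<^bsub>?V\<^esub>"
        by (simp add: d T1_add T1_zero)
    qed
  qed (simp add: T1_zero closed homogeneous_cocycles_0)
  then have "module class_ring ?V"
  proof (rule moduleI[rotated])
    show "cring (class_ring :: complex ring)" by (rule class_cring.is_cring)
  next
    fix c x assume "x \<in> carrier ?V"
    then obtain d where d: "d \<in> homogeneous_cocycles l \<sigma> u" "x = cohomology_class l \<sigma> d"
      using rep by metis
    show "c \<odot>\<^bsub>?V\<^esub> x \<in> carrier ?V"
      using d by (simp add: T1_smult closed homogeneous_cocycles_smult)
  next
    fix a b x assume "x \<in> carrier ?V"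
    then obtain d where d: "d \<in> homogeneous_cocycles l \<sigma> u" "x = cohomology_class l \<sigma> d"
      using rep by metis
    show "(a \<oplus>\<^bsub>class_ring\<^esub> b) \<odot>\<^bsub>?V\<^esub> x = (a \<odot>\<^bsub>?V\<^esub> x) \<oplus>\<^bsub>?V\<^esub> (b \<odot>\<^bsub>?V\<^esub> x)"
      by (simp add: d T1_smult T1_add distrib_right)
    show "(a \<otimes>\<^bsub>class_ring\<^esub> b) \<odot>\<^bsub>?V\<^esub> x = a \<odot>\<^bsub>?V\<^esub> (b \<odot>\<^bsub>?V\<^esub> x)"
      by (simp add: d T1_smult mult.assoc)
  next
    fix a x y assume "x \<in> carrier ?V" "y \<in> carrier ?V"
    then show "a \<odot>\<^bsub>?V\<^esub> (x \<oplus>\<^bsub>?V\<^esub> y) = (a \<odot>\<^bsub>?V\<^esub> x) \<oplus>\<^bsub>?V\<^esub> (a \<odot>\<^bsub>?V\<^esub> y)"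
      by (auto simp: T1_carrier T1_smult T1_add distrib_left)
  next
    fix x assume "x \<in> carrier ?V"
    then show "\<one>\<^bsub>class_ring\<^esub> \<odot>\<^bsub>?V\<^esub> x = x"
      by (auto simp: T1_carrier T1_smult)
  qed
  then show ?thesis
    unfolding vectorspace_def using class_field.field_axioms by blast
qed

text \<open>
  Independence and spanning of classes, expressed by cocycles modulo coboundaries. A function on classes and a
  family of scalars on indices correspond to each other because independence makes the classes distinct.
\<close>

lemma T1_degree_basisI:
  fixes d :: "nat \<Rightarrow> cochain"
  assumes fin: "finite I" and d: "\<And>t. t \<in> I \<Longrightarrow> d t \<in> homogeneous_cocycles l \<sigma> u"
    and indep: "\<And>c t. (\<lambda>i j f. \<Sum>t\<in>I. const0 (c t) * d t i j f) \<in> coboundaries l \<sigma> \<Longrightarrow> t \<in> I \<Longrightarrow> c t = 0"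
    and spanning: "\<And>z. z \<in> homogeneous_cocycles l \<sigma> u \<Longrightarrow>
      \<exists>c. (\<lambda>i j f. z i j f - (\<Sum>t\<in>I. const0 (c t) * d t i j f)) \<in> coboundaries l \<sigma>"
  shows "inj_on (\<lambda>t. cohomology_class l \<sigma> (d t)) I"
    and "vectorspace.basis class_ring (T1_degree l \<sigma> u) ((\<lambda>t. cohomology_class l \<sigma> (d t)) ` I)"
proof -
  let ?V = "T1_degree l \<sigma> u" and ?C = "\<lambda>t. cohomology_class l \<sigma> (d t)"
  interpret V: vectorspace "class_ring :: complex ring" ?V
    by (rule vectorspace_T1_degree)
  show inj: "inj_on ?C I"
  proof (rule inj_onI, rule ccontr)
    fix s t assume st: "s \<in> I" "t \<in> I" "?C s = ?C t" "s \<noteq> t"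
    define c :: "nat \<Rightarrow> complex" where "c = (\<lambda>r. if r = s then 1 else if r = t then - 1 else 0)"
    have "(\<Sum>r\<in>I. const0 (c r) * d r i j f) = d s i j f - d t i j f" for i j f
    proof -
      have "(\<Sum>r\<in>I. const0 (c r) * d r i j f) = (\<Sum>r\<in>{s, t}. const0 (c r) * d r i j f)"
        using fin st by (intro sum.mono_neutral_right) (auto simp: c_def)
      then show ?thesis using st(4) by (simp add: c_def)
    qed
    then have "(\<lambda>i j f. \<Sum>r\<in>I. const0 (c r) * d r i j f) \<in> coboundaries l \<sigma>"
      using st(3) by (simp add: cohomology_class_eq_iff)
    from indep[OF this st(1)] show False by (simp add: c_def)
  qed
  have C: "?C t \<in> carrier ?V" if "t \<in> I" for t
    using d[OF that] by (auto simp: T1_carrier)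
  have lincomb: "V.lincomb a (?C ` I) = cohomology_class l \<sigma> (\<lambda>i j f. \<Sum>t\<in>I. const0 (a (?C t)) * d t i j f)" for a
  proof -
    have "(\<Oplus>\<^bsub>?V\<^esub>v\<in>?C ` J. a v \<odot>\<^bsub>?V\<^esub> v) = cohomology_class l \<sigma> (\<lambda>i j f. \<Sum>t\<in>J. const0 (a (?C t)) * d t i j f)"
      if "finite J" "J \<subseteq> I" for J
      using that
    proof (induction J rule: finite_induct)
      case empty
      then show ?case by (simp add: T1_zero)
    next
      case (insert s J)
      have new: "?C s \<notin> ?C ` J"
        using inj_on_image_mem_iff[OF inj, of s J] insert.hyps(2) insert.prems by simp
      have closed: "(\<lambda>v. a v \<odot>\<^bsub>?V\<^esub> v) \<in> ?C ` J \<rightarrow> carrier ?V" "a (?C s) \<odot>\<^bsub>?V\<^esub> ?C s \<in> carrier ?V"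
        using insert.prems by (auto simp: subset_iff intro!: V.smult_closed C)
      have "(\<Oplus>\<^bsub>?V\<^esub>v\<in>?C ` insert s J. a v \<odot>\<^bsub>?V\<^esub> v) = (a (?C s) \<odot>\<^bsub>?V\<^esub> ?C s) \<oplus>\<^bsub>?V\<^esub> (\<Oplus>\<^bsub>?V\<^esub>v\<in>?C ` J. a v \<odot>\<^bsub>?V\<^esub> v)"
        unfolding image_insert using insert.hyps(1) new closed by (intro V.finsum_insert) auto
      then show ?case
        using insert by (simp add: T1_smult T1_add)
    qed
    from this[OF fin order_refl] show ?thesis
      unfolding V.lincomb_def .
  qed
  have "V.lin_indpt (?C ` I)"
  proof (rule V.finite_lin_indpt2)
    fix a assume "V.lincomb a (?C ` I) = \<zero>\<^bsub>?V\<^esub>"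
    then have "(\<lambda>i j f. \<Sum>t\<in>I. const0 (a (?C t)) * d t i j f) \<in> coboundaries l \<sigma>"
      by (simp add: lincomb T1_zero cohomology_class_eq_iff)
    from indep[OF this] show "\<forall>v\<in>?C ` I. a v = \<zero>\<^bsub>class_ring\<^esub>"
      by simp
  qed (use fin C in auto)
  moreover have "V.span (?C ` I) = carrier ?V"
  proof (intro equalityI subsetI)
    fix v assume "v \<in> V.span (?C ` I)"
    then show "v \<in> carrier ?V"
      using V.span_is_subset2[of "?C ` I"] C by auto
  next
    fix v assume "v \<in> carrier ?V"
    then obtain z where z: "z \<in> homogeneous_cocycles l \<sigma> u" "v = cohomology_class l \<sigma> z"
      unfolding T1_carrier by blast
    obtain c where "(\<lambda>i j f. z i j f - (\<Sum>t\<in>I. const0 (c t) * d t i j f)) \<in> coboundaries l \<sigma>"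
      using spanning[OF z(1)] by blast
    then have v: "v = cohomology_class l \<sigma> (\<lambda>i j f. \<Sum>t\<in>I. const0 (c t) * d t i j f)"
      unfolding z(2) cohomology_class_eq_iff .
    define a where "a w = c (inv_into I ?C w)" for w
    have "a (?C t) = c t" if "t \<in> I" for t
      unfolding a_def using inv_into_f_f[OF inj that] by simp
    then have "v = V.lincomb a (?C ` I)"
      unfolding v lincomb by (simp cong: sum.cong)
    then show "v \<in> V.span (?C ` I)"
      unfolding V.span_def using fin by auto
  qed
  moreover have "?C ` I \<subseteq> carrier ?V"
    using C by blast
  ultimately show "vectorspace.basis class_ring ?V (?C ` I)"
    unfolding V.basis_def by blast
qed

section \<open>The component of degree minus R\<close>

definition cscale :: "complex \<Rightarrow> lattice \<Rightarrow> complex \<times> complex" where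
  "cscale c n = (c * of_int (fst n), c * of_int (snd n))"

lemma cpair_cscale: "cpair (cscale c n) w = c * of_int (pairing n w)"
  by (simp add: cpair_def cscale_def pairing_def algebra_simps)

lemma cscale_0 [simp]: "cscale 0 n = 0" "cscale c 0 = 0"
  by (simp_all add: cscale_def zero_prod_def)

lemma cscale_minus: "cscale (- c) n = - cscale c n"
  by (simp add: cscale_def)

lemma cpair_ext:
  assumes "\<And>w. cpair n w = cpair n' w"
  shows "n = n'"
  using assms[of "(1, 0)"] assms[of "(0, 1)"] by (simp add: cpair_def prod_eq_iff)

lemma vf_inject:
  assumes "vf u n = vf u n'"
  shows "n = n'"
proof (rule cpair_ext)
  fix w
  have "vf u n (chi w) = vf u n' (chi w)" using assms by simp
  then show "cpair n w = cpair n' w" by (simp add: vf_chi)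
qed

context sliced_fan
begin

text \<open>
  The form \<open>\<langle>n, _\<rangle>\<close> vanishes at each \<open>w\<close> with \<open>0 \<le> \<langle>\<nu>(\<rho>\<^sub>i), w\<rangle> < h i\<close>, because \<open>w - R\<close> is negative on \<open>\<rho>\<^sub>i\<close>. Values 0 and, if
  \<open>h i > 1\<close>, also 1 are possible for \<open>\<langle>\<nu>(\<rho>\<^sub>i), w\<rangle>\<close>: the former leave the multiples of \<open>\<nu>(\<rho>\<^sub>i)\<close>, the latter only zero.
\<close>

lemma ray_section:
  assumes i: "i \<le> l" and pos: "h i > 0" and V: "vf (- R) n \<in> vector_fields (cone_of {\<nu> i})"
  obtains c where "n = cscale c (\<nu> i)" "h i \<noteq> 1 \<Longrightarrow> c = 0"
proof -
  have zero: "cpair n w = 0" if "0 \<le> pairing (\<nu> i) w" "pairing (\<nu> i) w < h i" for w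
  proof -
    have "w \<in> dual (cone_of {\<nu> i})" "w + - R \<notin> dual (cone_of {\<nu> i})"
      using that by (simp_all add: dual_cone_of pairing_lin h_def)
    then show ?thesis
      using V unfolding vf_in_vector_fields_iff by blast
  qed
  obtain p q where pq: "p * fst (\<nu> i) + q * snd (\<nu> i) = 1"
    using ray_primitive[OF i] bezout_int[of "fst (\<nu> i)" "snd (\<nu> i)"]
    by (auto simp: primitive_def coprime_iff_gcd_eq_1)
  then have pqc: "of_int p * of_int (fst (\<nu> i)) + of_int q * of_int (snd (\<nu> i)) = (1 :: complex)"
    by (metis of_int_1 of_int_add of_int_mult)
  define c where "c = cpair n (p, q)"
  have "cpair n (- snd (\<nu> i), fst (\<nu> i)) = 0"
    using pos by (intro zero) (simp_all add: pairing_def)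
  then have par: "snd n * of_int (fst (\<nu> i)) = fst n * of_int (snd (\<nu> i))"
    by (simp add: cpair_def)
  have "fst n = fst n * (of_int p * of_int (fst (\<nu> i)) + of_int q * of_int (snd (\<nu> i)))"
    "snd n = snd n * (of_int p * of_int (fst (\<nu> i)) + of_int q * of_int (snd (\<nu> i)))"
    by (simp_all add: pqc)
  moreover have "fst n * (of_int p * of_int (fst (\<nu> i)) + of_int q * of_int (snd (\<nu> i)))
      = c * of_int (fst (\<nu> i)) + of_int q * (fst n * of_int (snd (\<nu> i)) - snd n * of_int (fst (\<nu> i)))"
    "snd n * (of_int p * of_int (fst (\<nu> i)) + of_int q * of_int (snd (\<nu> i)))
      = c * of_int (snd (\<nu> i)) + of_int p * (snd n * of_int (fst (\<nu> i)) - fst n * of_int (snd (\<nu> i)))"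
    by (simp_all add: c_def cpair_def algebra_simps)
  ultimately have "n = cscale c (\<nu> i)"
    by (simp add: cscale_def prod_eq_iff par)
  moreover have "c = 0" if "h i \<noteq> 1"
    unfolding c_def using that pos pq by (intro zero) (simp_all add: pairing_def mult.commute)
  ultimately show ?thesis using that by blast
qed

text \<open>
  Both generators of the dual cone become negative on a ray after subtraction of \<open>R\<close>.
\<close>

lemma inner_section_zero:
  assumes i: "1 \<le> i" "i \<le> m" and V: "vf (- R) n \<in> vector_fields (\<sigma> i)"
  shows "n = 0"
proof (rule cpair_ext)
  have il: "i < l" using i m_less by simp
  have pos: "h i > 0" "h (Suc i) > 0"
    using height_pos i by simp_all
  have "w1 \<nu> i + - R \<notin> dual (\<sigma> i)" "w2 \<nu> i + - R \<notin> dual (\<sigma> i)"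
    using pos by (simp_all add: dual_max_cone pairing_lin dual_basis[OF il] h_def)
  then have zero: "cpair n (w1 \<nu> i) = 0" "cpair n (w2 \<nu> i) = 0"
    using V w_in_dual[OF il] unfolding vf_in_vector_fields_iff by blast+
  fix w
  have "cpair n w = cpair n (lscale (pairing (\<nu> i) w) (w1 \<nu> i) + lscale (pairing (\<nu> (Suc i)) w) (w2 \<nu> i))"
    using dual_expansion[OF il, of w] by simp
  then show "cpair n w = cpair 0 w"
    by (simp add: cpair_simps zero)
qed

text \<open>
  Applied to the charts 0 and \<open>m + 1\<close>: where \<open>\<nu>(\<rho>\<^sub>t)\<close> is positive it is at least \<open>h t = 1\<close>, and on the other ray
  subtraction of \<open>R\<close> does not decrease the value.
\<close>

lemma end_section:
  assumes "{t, t'} = {i, Suc i}" and "c = 0 \<or> h t = 1" and "h t' \<le> 0"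
  shows "vf (- R) (cscale c (\<nu> t)) \<in> vector_fields (\<sigma> i)"
  unfolding vf_in_vector_fields_iff
proof
  have dual_eq: "dual (\<sigma> i) = {w. 0 \<le> pairing (\<nu> t) w \<and> 0 \<le> pairing (\<nu> t') w}"
    using assms(1) unfolding dual_max_cone by (auto simp: doubleton_eq_iff)
  fix w assume w: "w \<in> dual (\<sigma> i)"
  show "cpair (cscale c (\<nu> t)) w = 0 \<or> w + - R \<in> dual (\<sigma> i)"
    using w assms(2,3) unfolding dual_eq by (auto simp: cpair_cscale pairing_lin h_def)
qed

abbreviation steps :: "nat set" where "steps \<equiv> step_indices \<nu> m R"

abbreviation step_cocycle :: "nat \<Rightarrow> cochain" where
  "step_cocycle \<equiv> step_family.cocycle \<nu> l m R"

lemma step_family: "k \<in> steps \<Longrightarrow> step_family F \<nu> l m S R k"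
  by unfold_locales (simp_all add: step_indices_def h_def)

lemma finite_steps: "finite steps"
  by (rule finite_subset[of _ "{..m}"]) (auto simp: step_indices_def)

text \<open>
  The potential of the linear combination of the Kodaira-Spencer cocycles with coefficients \<open>c\<close>: on the charts up to
  \<open>m + 1\<close> it jumps by \<open>c k\<close> times \<open>\<nu> k\<close> at each step \<open>k\<close>.
\<close>

definition accumulated :: "(nat \<Rightarrow> complex) \<Rightarrow> nat \<Rightarrow> complex \<times> complex" where
  "accumulated c i = (\<Sum>k\<in>steps. if k \<le> i \<and> i \<le> m + 1 then cscale (c k) (\<nu> k) else 0)"

lemma accumulated_step:
  assumes "Suc i \<le> m + 1"
  shows "accumulated c (Suc i) = accumulated c i + (if Suc i \<in> steps then cscale (c (Suc i)) (\<nu> (Suc i)) else 0)"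
proof -
  have "accumulated c (Suc i) = (\<Sum>k\<in>steps. (if k \<le> i \<and> i \<le> m + 1 then cscale (c k) (\<nu> k) else 0)
      + (if k = Suc i then cscale (c (Suc i)) (\<nu> (Suc i)) else 0))"
    unfolding accumulated_def using assms by (intro sum.cong) auto
  then show ?thesis
    using finite_steps by (simp add: sum.distrib accumulated_def)
qed

lemma step_cocycle_sum:
  "(\<lambda>i j f. \<Sum>k\<in>steps. const0 (c k) * step_cocycle k i j f)
    = (\<lambda>i j f. if i < l \<and> j < l then vf (- R) (accumulated c j - accumulated c i) f else 0)"
proof (intro ext)
  fix i j f
  show "(\<Sum>k\<in>steps. const0 (c k) * step_cocycle k i j f)
      = (if i < l \<and> j < l then vf (- R) (accumulated c j - accumulated c i) f else 0)"
  proof (cases "i < l \<and> j < l")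
    case True
    have term_eq: "const0 (c k) * step_cocycle k i j f = vf (- R) (
        (if k \<le> j \<and> j \<le> m + 1 then cscale (c k) (\<nu> k) else 0) -
        (if k \<le> i \<and> i \<le> m + 1 then cscale (c k) (\<nu> k) else 0)) f" if "k \<in> steps" for k
    proof -
      interpret step_family F \<nu> l m S R k by (rule step_family[OF that])
      have tw: "(c k * of_int (fst (twist t)), c k * of_int (snd (twist t)))
          = (if k \<le> t \<and> t \<le> m + 1 then cscale (c k) (\<nu> k) else 0)" for t
        by (simp add: twist_def cscale_def zero_prod_def)
      show ?thesis
        using True unfolding tw[symmetric] by (simp add: cocycle_eq_vf vf_smult[symmetric] right_diff_distrib)
    qed
    have "(\<Sum>k\<in>steps. const0 (c k) * step_cocycle k i j f) = (\<Sum>k\<in>steps. vf (- R) (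
        (if k \<le> j \<and> j \<le> m + 1 then cscale (c k) (\<nu> k) else 0) -
        (if k \<le> i \<and> i \<le> m + 1 then cscale (c k) (\<nu> k) else 0)) f)"
      by (intro sum.cong refl term_eq)
    also have "\<dots> = vf (- R) (accumulated c j - accumulated c i) f"
      by (simp only: accumulated_def sum_subtractf vf_sum[symmetric])
    finally show ?thesis using True by simp
  next
    case False
    then have "step_cocycle k i j f = 0" if "k \<in> steps" for k
      using False by (auto simp: step_family.cocycle_def[OF step_family[OF that]])
    then show ?thesis using False by auto
  qed
qed

text \<open>
  The degree \<open>-R\<close> parts of the fields that bound the combination vanish on the charts \<open>1, \<dots>, m\<close>, among which are the two charts
  on both sides of \<open>\<rho>\<^sub>k\<close>. So the potential does not jump there.
\<close>

lemma step_cocycles_independent: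
  assumes cob: "(\<lambda>i j f. \<Sum>k\<in>steps. const0 (c k) * step_cocycle k i j f) \<in> coboundaries l \<sigma>"
    and k: "k \<in> steps"
  shows "c k = 0"
proof -
  obtain D where "\<forall>i<l. D i \<in> vector_fields (\<sigma> i)"
    and eq: "(\<lambda>i j f. if i < l \<and> j < l then vf (- R) (accumulated c j - accumulated c i) f else 0)
      = (\<lambda>i j f. if i < l \<and> j < l then D j f - D i f else 0)"
    using cob unfolding step_cocycle_sum by (rule coboundaryE)
  then have D: "D i \<in> vector_fields (\<sigma> i)" if "i < l" for i
    using that by simp
  have "\<exists>n. vf (- R) n \<in> vector_fields (\<sigma> i) \<and> (\<forall>w. coef (D i (chi w)) (w + - R) = cpair n w)" if i: "i < l" for i
    using homogeneous_component[OF D[OF i] dual_full[OF w_in_dual[OF i] dual_basis(5)[OF i]], where u = "- R"]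
    by blast
  then obtain n where n: "\<And>i. i < l \<Longrightarrow> vf (- R) (n i) \<in> vector_fields (\<sigma> i)"
    and coef_n: "\<And>i w. i < l \<Longrightarrow> coef (D i (chi w)) (w + - R) = cpair (n i) w"
    by metis
  have k': "2 \<le> k" "k \<le> m" "pairing (\<nu> k) R = 1"
    using k by (auto simp: step_indices_def)
  then obtain i where i: "k = Suc i" "1 \<le> i" "i < l" "Suc i < l"
    using m_less by (cases k) auto
  have "n i = 0" "n (Suc i) = 0"
    using inner_section_zero[OF _ _ n] i k' by simp_all
  moreover have "D (Suc i) (chi R) = D i (chi R) + const0 (c k) * chi (R + - R)"
  proof -
    have "vf (- R) (accumulated c (Suc i) - accumulated c i) (chi R) = D (Suc i) (chi R) - D i (chi R)"
      using fun_cong[OF fun_cong[OF fun_cong[OF eq, of i], of "Suc i"], of "chi R"] i by simp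
    moreover have "accumulated c (Suc i) - accumulated c i = cscale (c k) (\<nu> k)"
      using accumulated_step[of i c] i k k' by simp
    ultimately show ?thesis
      using k' by (simp add: vf_chi cpair_cscale)
  qed
  then have "coef (D (Suc i) (chi R)) (R + - R) = coef (D i (chi R)) (R + - R) + c k"
    using vector_field_laurent[OF D[OF i(3)] dual_full[OF w_in_dual[OF i(3)] dual_basis(5)[OF i(3)]]]
    by (simp only: coef_add coord.spanned_term dual_empty UNIV_I coef_term simp_thms if_True)
  ultimately show "c k = 0"
    using coef_n[OF i(3), of R] coef_n[OF i(4), of R] by (simp add: cpair_simps)
qed

text \<open>
  The potential \<open>P\<close> of the cocycle, normalized to vanish on chart 0, jumps by \<open>c i\<close> times \<open>\<nu> i\<close> for \<open>1 \<le> i \<le> m + 1\<close>. The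
  remainder \<open>e\<close> is what is left of it after the jumps at the steps are removed and the jump at the first ray is
  moved to chart 0. It vanishes on the charts \<open>1, \<dots>, m\<close> and is regular on all others, so it gives a coboundary.
\<close>

lemma step_cocycles_span:
  assumes z: "z \<in> homogeneous_cocycles l \<sigma> (- R)"
  shows "\<exists>c. (\<lambda>i j f. z i j f - (\<Sum>k\<in>steps. const0 (c k) * step_cocycle k i j f)) \<in> coboundaries l \<sigma>"
proof -
  have hom: "homogeneous (- R) (z i j)" if "i < l" "j < l" for i j
    using z that by (simp add: homogeneous_cocycles_def)
  have VF: "z i j \<in> vector_fields (\<sigma> i \<inter> \<sigma> j)" if "i < l" "j < l" for i j
    using z that by (simp add: homogeneous_cocycles_def cocycles_def)
  have outside: "z i j f = 0" if "\<not> (i < l \<and> j < l)" for i j f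
    using z that by (simp add: homogeneous_cocycles_def cocycles_def)
  have add: "z 0 i f + z i j f = z 0 j f" if "i < l" "j < l" for i j f
    using z that by (simp add: homogeneous_cocycles_def cocycles_def)
  have "\<exists>n. z i j = vf (- R) n" if "i < l" "j < l" for i j
    using hom[OF that] unfolding homogeneous_iff .
  then obtain n where n: "\<And>i j. i < l \<Longrightarrow> j < l \<Longrightarrow> z i j = vf (- R) (n i j)"
    by metis
  define P where "P = n 0"
  have zP: "z i j = vf (- R) (P j - P i)" if "i < l" "j < l" for i j
  proof -
    have "vf (- R) (P i + n i j) = vf (- R) (P j)"
      using add[OF that] n that unfolding P_def by (simp add: fun_eq_iff vf_add)
    then have "P i + n i j = P j" by (rule vf_inject)
    then have "n i j = P j - P i" by (metis add_diff_cancel_left')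
    then show ?thesis using n that by simp
  qed
  have P0: "P 0 = 0"
  proof -
    have "vf (- R) (P 0) = vf (- R) 0"
      using zP[of 0 0] n[of 0 0] m_less unfolding P_def by simp
    then show ?thesis by (rule vf_inject)
  qed
  have "\<exists>c. P (Suc i) - P i = cscale c (\<nu> (Suc i)) \<and> (h (Suc i) \<noteq> 1 \<longrightarrow> c = 0)" if "i \<le> m" for i
  proof -
    have i: "i < l" "Suc i < l" using that m_less by simp_all
    have "vf (- R) (P (Suc i) - P i) \<in> vector_fields (cone_of {\<nu> (Suc i)})"
      using VF[OF i] adjacent_cones_inter[OF i(2)] zP[OF i] by simp
    then show ?thesis
      using ray_section[of "Suc i"] height_pos[of "Suc i"] i that by (metis Suc_eq_plus1 Suc_le_mono le_add2 less_imp_le)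
  qed
  then obtain c0 where c0: "\<And>i. i \<le> m \<Longrightarrow> P (Suc i) - P i = cscale (c0 i) (\<nu> (Suc i))"
    "\<And>i. i \<le> m \<Longrightarrow> h (Suc i) \<noteq> 1 \<Longrightarrow> c0 i = 0"
    by metis
  define c where "c i = c0 (i - 1)" for i
  have c: "P (Suc i) = P i + cscale (c (Suc i)) (\<nu> (Suc i))" "h (Suc i) \<noteq> 1 \<Longrightarrow> c (Suc i) = 0" if "i \<le> m" for i
    using c0[OF that] by (simp_all add: c_def algebra_simps)
  define e where "e i = P i - accumulated c i - cscale (c 1) (\<nu> 1)" for i
  have acc0: "accumulated c 0 = 0" "accumulated c 1 = 0"
    unfolding accumulated_def by (auto simp: step_indices_def intro!: sum.neutral)
  have e1: "e 1 = 0"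
    using c(1)[of 0] by (simp add: e_def acc0[simplified] P0)
  have e_step: "e (Suc i) = e i + (if Suc i \<in> steps then 0 else cscale (c (Suc i)) (\<nu> (Suc i)))" if "i \<le> m" for i
    using c(1)[OF that] accumulated_step[of i c] that by (simp add: e_def algebra_simps)
  have inner: "e i = 0" if "1 \<le> i" "i \<le> m" for i
    using that
  proof (induction i rule: nat_induct_at_least)
    case base
    then show ?case using e1 by simp
  next
    case (Suc i)
    have "Suc i \<notin> steps \<Longrightarrow> c (Suc i) = 0"
      using Suc by (intro c(2)) (auto simp: step_indices_def h_def)
    then show ?case
      using Suc e_step[of i] by simp
  qed
  have eV: "vf (- R) (e i) \<in> vector_fields (\<sigma> i)" if i: "i < l" for i
  proof -
    have zero: "vf (- R) (e i) \<in> vector_fields (\<sigma> i)" if "e i = 0"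
      using that vf_0[of "- R"] vector_fields_0[of "\<sigma> i"] by (metis ext)
    consider "i = 0" | "1 \<le> i" "i \<le> m" | "i = m + 1" | "m + 1 < i" by linarith
    then show ?thesis
    proof cases
      case 1
      have "e 0 = cscale (- c 1) (\<nu> 1)"
        by (simp add: e_def acc0 P0 cscale_minus)
      moreover have "vf (- R) (cscale (- c 1) (\<nu> 1)) \<in> vector_fields (\<sigma> 0)"
        using c(2)[of 0] height_ends(1) by (intro end_section[where t' = 0]) auto
      ultimately show ?thesis using 1 by simp
    next
      case 2
      then show ?thesis using inner zero by blast
    next
      case 3
      show ?thesis
      proof (cases "m = 0")
        case True
        then show ?thesis using 3 e1 zero by simp
      next
        case False
        have "m + 1 \<notin> steps" by (simp add: step_indices_def)
        then have "e (m + 1) = cscale (c (m + 1)) (\<nu> (m + 1))"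
          using e_step[of m] inner[of m] False by simp
        moreover have "vf (- R) (cscale (c (m + 1)) (\<nu> (m + 1))) \<in> vector_fields (\<sigma> (m + 1))"
          using c(2)[of m] height_ends(2) by (intro end_section[where t' = "m + 2"]) auto
        ultimately show ?thesis using 3 by simp
      qed
    next
      case 4
      show ?thesis
        by (rule vf_in_vector_fields_if_regular[OF neg_R_in_dual_max_cone[OF 4 i]])
    qed
  qed
  have "(\<lambda>i j f. z i j f - (\<Sum>k\<in>steps. const0 (c k) * step_cocycle k i j f))
      = (\<lambda>i j f. if i < l \<and> j < l then vf (- R) (e j) f - vf (- R) (e i) f else 0)"
  proof (intro ext)
    fix i j f
    have "(\<Sum>k\<in>steps. const0 (c k) * step_cocycle k i j f)
      = (if i < l \<and> j < l then vf (- R) (accumulated c j - accumulated c i) f else 0)"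
      using fun_cong[OF fun_cong[OF fun_cong[OF step_cocycle_sum[of c], of i], of j], of f] .
    then show "z i j f - (\<Sum>k\<in>steps. const0 (c k) * step_cocycle k i j f)
      = (if i < l \<and> j < l then vf (- R) (e j) f - vf (- R) (e i) f else 0)"
      by (auto simp: zP outside e_def vf_diff)
  qed
  moreover have "(\<lambda>i j f. if i < l \<and> j < l then vf (- R) (e j) f - vf (- R) (e i) f else 0) \<in> coboundaries l \<sigma>"
    using coboundaryI[of l "\<lambda>i. vf (- R) (e i)" \<sigma>] eV by blast
  ultimately show ?thesis
    by (intro exI[of _ c]) simp
qed

lemma step_cocycle_homogeneous: "k \<in> steps \<Longrightarrow> step_cocycle k \<in> homogeneous_cocycles l \<sigma> (- R)"
  using step_family.cocycle_in_cocycles[OF step_family] step_family.cocycle_eq_vf[OF step_family]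
  unfolding homogeneous_cocycles_def homogeneous_iff by blast

lemma is_KS_class_step_iff:
  assumes "k \<in> steps"
  shows "is_KS_class l \<sigma> (step_deformation \<nu> m S R k) C \<longleftrightarrow> C = cohomology_class l \<sigma> (step_cocycle k)"
proof -
  interpret step_family F \<nu> l m S R k by (rule step_family[OF assms])
  show ?thesis
  proof
    assume "is_KS_class l \<sigma> chart C"
    then obtain \<theta> d where KS: "KS_cocycle l \<sigma> chart \<theta> d" and C: "C = cohomology_class l \<sigma> d"
      unfolding is_KS_class_def by blast
    show "C = cohomology_class l \<sigma> (step_cocycle k)"
      unfolding C cohomology_class_eq_iff by (rule KS_class_cohomologous[OF KS_cocycle_step KS])
  next
    assume "C = cohomology_class l \<sigma> (step_cocycle k)"
    then show "is_KS_class l \<sigma> chart C"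
      unfolding is_KS_class_def using KS_cocycle_step by blast
  qed
qed

lemma KS_class_step:
  "k \<in> steps \<Longrightarrow> KS_class l \<sigma> (step_deformation \<nu> m S R k) = cohomology_class l \<sigma> (step_cocycle k)"
  unfolding KS_class_def by (rule the_equality) (simp_all add: is_KS_class_step_iff)

end

theorem corollary2p4:
  fixes F :: "cone set" and \<nu> :: "nat \<Rightarrow> lattice" and l m :: nat and S R :: lattice
  assumes "is_fan F" and "complete_fan F" and "smooth_fan F"
    and "primitive R" and "det2 S R = 1"
    and "ray_numbering F \<nu> l" and "slice_numbering F \<nu> l m S R"
  shows "(\<forall>i\<in>step_indices \<nu> m R.
            admissible \<nu> m S R (step_tuple i) \<and>
            (\<exists>!C. is_KS_class l (max_cone \<nu>) (step_deformation \<nu> m S R i) C)) \<and>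
         inj_on (\<lambda>i. KS_class l (max_cone \<nu>) (step_deformation \<nu> m S R i)) (step_indices \<nu> m R) \<and>
         vectorspace.basis class_ring
           (T1_degree l (max_cone \<nu>) (- fst R, - snd R))
           ((\<lambda>i. KS_class l (max_cone \<nu>) (step_deformation \<nu> m S R i)) ` step_indices \<nu> m R)"
proof -
  interpret sliced_fan F \<nu> l m S R
    using assms by unfold_locales
  have R: "(- fst R, - snd R) = - R"
    by (simp add: prod_eq_iff)
  have inj: "inj_on (\<lambda>k. cohomology_class l \<sigma> (step_cocycle k)) steps"
    and basis: "vectorspace.basis class_ring (T1_degree l \<sigma> (- R))
      ((\<lambda>k. cohomology_class l \<sigma> (step_cocycle k)) ` steps)"
    by (rule T1_degree_basisI[OF finite_steps]; (rule step_cocycle_homogeneous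
        step_cocycles_independent step_cocycles_span; assumption))+
  have "inj_on (\<lambda>i. KS_class l \<sigma> (step_deformation \<nu> m S R i)) steps"
    using inj by (simp add: KS_class_step cong: inj_on_cong)
  moreover have "(\<lambda>i. KS_class l \<sigma> (step_deformation \<nu> m S R i)) ` steps
      = (\<lambda>k. cohomology_class l \<sigma> (step_cocycle k)) ` steps"
    by (intro image_cong refl KS_class_step)
  moreover have "admissible \<nu> m S R (step_tuple i)" if "i \<in> steps" for i
    using step_family.admissible_step[OF step_family[OF that]] .
  ultimately show ?thesis
    unfolding R using basis is_KS_class_step_iff by simp
qed

end
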